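(* Let $\Omega=(0,1)$, $T>0$, $1<\alpha<2$ and $\mu<\frac14$. Let $u_0\in\mathcal H^1(\Omega)$, $u_1\in L^2(\Omega)$ and $q\in L^\infty(0,T)$ be known (fixed), and suppose that $$K_n(q):=\int_0^T(T-s)^{\alpha-1}E_{\alpha,\alpha}\bigl(-\lambda_n(T-s)^\alpha\bigr)q(s)\,ds\neq0\qquad\text{for all } n\ge1.$$ For $p\in L^2(\Omega)$ let $u[p]$ be the unique weak solution of $$\begin{cases}{}_0^C D_t^\alpha u-u_{xx}-\dfrac{\mu}{x^2}u=p(x)q(t), & (x,t)\in\Omega\times(0,T),\\ u(x,0)=u_0(x),\quad \partial_t u(x,0)=u_1(x), & x\in\Omega,\\ u(0,t)=u(1,t)=0,& t\in(0,T),\end{cases}$$ let $\mathcal A p:=u[p](\cdot,T)-u[0](\cdot,T)$, and for terminal data $\omega_{\mathrm{obs}}$ let $\omega:=\omega_{\mathrm{obs}}-u[0](\cdot,T)$. Then the inverse problem $\mathcal A p=\omega$ (equivalently, $u[p](\cdot,T)=\omega_{\mathrm{obs}}$) has at most one solution $p\in L^2(\Omega)$.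
   Context: Here $\mu$ is a real number with $\mu<1/4$ and $\Omega=(0,1)$. For $v,w\in H_0^1(\Omega)$ put $a_\mu(v,w)=\int_0^1 v_xw_x\,dx-\mu\int_0^1\frac{vw}{x^2}\,dx$. By Hardy's inequality $\int_0^1|v|^2/x^2\,dx\le 4\int_0^1|v_x|^2\,dx$ this is a continuous, symmetric, coercive form on $H_0^1(\Omega)$. Let $L_\mu$ be the associated positive self-adjoint operator in $L^2(\Omega)$ (the Friedrichs realization of $-\frac{d^2}{dx^2}-\frac{\mu}{x^2}$ with Dirichlet conditions): $v\in D(L_\mu)$ and $L_\mu v=g$ iff $v\in H_0^1(\Omega)$, $g\in L^2(\Omega)$ and $a_\mu(v,\varphi)=(g,\varphi)_{L^2(\Omega)}$ for all $\varphi\in H_0^1(\Omega)$. $L_\mu$ has compact resolvent; let $\{\phi_n\}_{n\ge1}$ be an orthonormal basis of $L^2(\Omega)$ of eigenfunctions, $L_\mu\phi_n=\lambda_n\phi_n$, $0<\lambda_1\le\lambda_2\le\cdots\to\infty$. For $\sigma\ge0$, $\mathcal H^\sigma(\Omega)=D(L_\mu^{\sigma/2})$ with $\|v\|_{\mathcal H^\sigma}^2=\sum_n\lambda_n^\sigma|(v,\phi_n)_{L^2(\Omega)}|^2$; for $\sigma<0$, $\mathcal H^\sigma(\Omega)$ is the completion of $L^2(\Omega)$ in the norm given by the same formula, equivalently $\mathcal H^{\sigma}=(\mathcal H^{-\sigma})'$ with pivot space $L^2(\Omega)$. In particular $\mathcal H^1(\Omega)=H_0^1(\Omega)$ with the equivalent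 norm $a_\mu(v,v)^{1/2}$. Mittag-Leffler function: $E_{\alpha,\beta}(z)=\sum_{k=0}^\infty \frac{z^k}{\Gamma(\alpha k+\beta)}$. Caputo derivative of order $1<\alpha<2$: ${}_0^C D_t^\alpha u(t)=I_{0+}^{2-\alpha}u''(t)$, where $I_{0+}^{\beta}g(t)=\frac1{\Gamma(\beta)}\int_0^t(t-s)^{\beta-1}g(s)\,ds$. For $u$ that is only $C^1$ in time (with values in $\mathcal H^{-1}(\Omega)$) it is understood as $\frac{d}{dt}I_{0+}^{2-\alpha}(\partial_tu-\partial_tu(0))$, with $\frac{d}{dt}$ in the sense of $\mathcal H^{-1}(\Omega)$-valued distributions on $(0,T)$. Weak solution: with $f(t):=p\,q(t)$, a function $u$ is a weak solution if $u\in C([0,T];\mathcal H^1(\Omega))\cap C^1([0,T];\mathcal H^{-1}(\Omega))$, ${}_0^C D_t^\alpha u\in L^2(0,T;\mathcal H^{-1}(\Omega))$, $u(\cdot,0)=u_0$ in $\mathcal H^1(\Omega)$, $\partial_tu(\cdot,0)=u_1$ in $\mathcal H^{-1}(\Omega)$, and for a.e. $t\in(0,T)$ $$\langle {}_0^C D_t^\alpha u(t),v\rangle_{\mathcal H^{-1},\mathcal H^1}+a_\mu(u(t),v)=(f(t),v)_{L^2(\Omega)}\qquad\forall v\in\mathcal H^1(\Omega).$$ For every $p\in L^2(\Omega)$, $q\in L^\infty(0,T)$, $u_0\in\mathcal H^1(\Omega)$, $u_1\in L^2(\Omega)$ there is a unique weak solution, so $u[p](\cdot,T)\in\mathcal H^1(\Omega)$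 is well defined; $u[0]$ is the solution with $p=0$ and the same initial data. *)

theory Defs
  imports "HOL-Analysis.Analysis"
begin

(* Elements of L^2, H_0^1, ... are represented by functions real => real; only their values on
   (0,1) up to null sets matter, and equality in these spaces is equality almost everywhere. *)

abbreviation Omega :: "real measure" where
  "Omega \<equiv> lebesgue_on {0<..<1}"

definition L2 :: "(real \<Rightarrow> real) set" where
  "L2 = {v. v \<in> borel_measurable Omega \<and> integrable Omega (\<lambda>x. (v x)\<^sup>2)}"

definition ip :: "(real \<Rightarrow> real) \<Rightarrow> (real \<Rightarrow> real) \<Rightarrow> real" where
  "ip v w = (LINT x|Omega. v x * w x)"

definition Linfty :: "real \<Rightarrow> (real \<Rightarrow> real) set" where
  "Linfty T = {q. q \<in> borel_measurable (lebesgue_on {0<..<T}) \<and>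
                  (\<exists>C. AE t in lebesgue_on {0<..<T}. \<bar>q t\<bar> \<le> C)}"

text \<open>Test functions \<open>C\<^sub>c\<^sup>\<infinity>(a,b)\<close>, extended by zero to the real line.\<close>

definition test_fun :: "real \<Rightarrow> real \<Rightarrow> (real \<Rightarrow> real) \<Rightarrow> bool" where
  "test_fun a b \<phi> \<longleftrightarrow>
     (\<forall>k. (deriv ^^ k) \<phi> differentiable_on UNIV) \<and>
     (\<exists>c d. a < c \<and> d < b \<and> (\<forall>x. x \<notin> {c..d} \<longrightarrow> \<phi> x = 0))"

definition weak_deriv :: "(real \<Rightarrow> real) \<Rightarrow> (real \<Rightarrow> real) \<Rightarrow> bool" where
  "weak_deriv v g \<longleftrightarrow> (\<forall>\<phi>. test_fun 0 1 \<phi> \<longrightarrow> ip v (deriv \<phi>) = - ip g \<phi>)"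

definition H1 :: "(real \<Rightarrow> real) set" where
  "H1 = {v \<in> L2. \<exists>g\<in>L2. weak_deriv v g}"

text \<open>A representative of the weak derivative; it is unique up to null sets.\<close>

definition wderiv :: "(real \<Rightarrow> real) \<Rightarrow> real \<Rightarrow> real" where
  "wderiv v = (SOME g. g \<in> L2 \<and> weak_deriv v g)"

text \<open>The closure of the test functions in \<open>H\<^sup>1(0,1)\<close>.\<close>

definition H01 :: "(real \<Rightarrow> real) set" where
  "H01 = {v \<in> H1. \<forall>\<epsilon>>0. \<exists>\<phi>. test_fun 0 1 \<phi> \<and>
            (LINT x|Omega. (v x - \<phi> x)\<^sup>2) + (LINT x|Omega. (wderiv v x - deriv \<phi> x)\<^sup>2) < \<epsilon>}"

definition a_form :: "real \<Rightarrow> (real \<Rightarrow> real) \<Rightarrow> (real \<Rightarrow> real) \<Rightarrow> real" where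
  "a_form \<mu> v w = (LINT x|Omega. wderiv v x * wderiv w x) - \<mu> * (LINT x|Omega. v x * w x / x\<^sup>2)"

text \<open>The graph of the operator: \<open>L_op \<mu> v g\<close> means that \<open>v\<close> is in the domain of \<open>L\<^sub>\<mu>\<close>
  and \<open>L\<^sub>\<mu> v = g\<close>.\<close>

definition L_op :: "real \<Rightarrow> (real \<Rightarrow> real) \<Rightarrow> (real \<Rightarrow> real) \<Rightarrow> bool" where
  "L_op \<mu> v g \<longleftrightarrow> v \<in> H01 \<and> g \<in> L2 \<and> (\<forall>w\<in>H01. a_form \<mu> v w = ip g w)"

text \<open>Sequences are indexed from 1; the values at index 0 are irrelevant throughout.\<close>

definition eigenbasis :: "real \<Rightarrow> (nat \<Rightarrow> real \<Rightarrow> real) \<Rightarrow> (nat \<Rightarrow> real) \<Rightarrow> bool" where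
  "eigenbasis \<mu> \<phi> lam \<longleftrightarrow>
     (\<forall>n\<ge>1. L_op \<mu> (\<phi> n) (\<lambda>x. lam n * \<phi> n x)) \<and>
     (\<forall>m\<ge>1. \<forall>n\<ge>1. ip (\<phi> m) (\<phi> n) = (if m = n then 1 else 0)) \<and>
     (\<forall>v\<in>L2. (\<lambda>N. LINT x|Omega. (v x - (\<Sum>n=1..N. ip v (\<phi> n) * \<phi> n x))\<^sup>2) \<longlonglongrightarrow> 0) \<and>
     0 < lam 1 \<and>
     (\<forall>m\<ge>1. \<forall>n\<ge>m. lam m \<le> lam n) \<and>
     filterlim lam at_top sequentially"

text \<open>\<open>\<H>\<^sup>\<sigma>\<close> for \<open>\<sigma> \<ge> 0\<close>, i.e. the domain of \<open>L\<^sub>\<mu>\<close> to the power \<open>\<sigma>/2\<close>, and its norm.\<close>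

definition Hs :: "(nat \<Rightarrow> real \<Rightarrow> real) \<Rightarrow> (nat \<Rightarrow> real) \<Rightarrow> real \<Rightarrow> (real \<Rightarrow> real) set" where
  "Hs \<phi> lam \<sigma> = {v \<in> L2. (\<lambda>n. lam n powr \<sigma> * (ip v (\<phi> n))\<^sup>2) summable_on {1..}}"

definition Hs_norm :: "(nat \<Rightarrow> real \<Rightarrow> real) \<Rightarrow> (nat \<Rightarrow> real) \<Rightarrow> real \<Rightarrow> (real \<Rightarrow> real) \<Rightarrow> real" where
  "Hs_norm \<phi> lam \<sigma> v = sqrt (\<Sum>\<^sub>\<infinity>n\<in>{1..}. lam n powr \<sigma> * (ip v (\<phi> n))\<^sup>2)"

text \<open>The space of order \<open>-\<sigma>\<close>, for \<open>\<sigma> \<ge> 0\<close>, is the dual of \<open>\<H>\<^sup>\<sigma>\<close>: its elements are the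
  functionals that are linear and bounded on \<open>Hs \<phi> lam \<sigma>\<close> (hence insensitive to null sets), with
  arbitrary values elsewhere. The duality pairing is application, and a function \<open>v\<close> in \<open>L\<^sup>2\<close> (the
  pivot space) is identified with the functional \<open>ip v\<close>.\<close>

definition Hdual ::
  "(nat \<Rightarrow> real \<Rightarrow> real) \<Rightarrow> (nat \<Rightarrow> real) \<Rightarrow> real \<Rightarrow> ((real \<Rightarrow> real) \<Rightarrow> real) set" where
  "Hdual \<phi> lam \<sigma> = {\<xi>.
     (\<forall>v\<in>Hs \<phi> lam \<sigma>. \<forall>w\<in>Hs \<phi> lam \<sigma>. \<forall>a b. \<xi> (\<lambda>x. a * v x + b * w x) = a * \<xi> v + b * \<xi> w) \<and>
     (\<exists>C. \<forall>v\<in>Hs \<phi> lam \<sigma>. \<bar>\<xi> v\<bar> \<le> C * Hs_norm \<phi> lam \<sigma> v)}"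

definition Hdual_norm ::
  "(nat \<Rightarrow> real \<Rightarrow> real) \<Rightarrow> (nat \<Rightarrow> real) \<Rightarrow> real \<Rightarrow> ((real \<Rightarrow> real) \<Rightarrow> real) \<Rightarrow> real" where
  "Hdual_norm \<phi> lam \<sigma> \<xi> = (SUP v\<in>{v \<in> Hs \<phi> lam \<sigma>. Hs_norm \<phi> lam \<sigma> v \<le> 1}. \<bar>\<xi> v\<bar>)"

definition mittag_leffler :: "real \<Rightarrow> real \<Rightarrow> real \<Rightarrow> real" where
  "mittag_leffler \<alpha> \<beta> z = (\<Sum>k. z ^ k / Gamma (\<alpha> * real k + \<beta>))"

definition RL_integral :: "real \<Rightarrow> (real \<Rightarrow> real) \<Rightarrow> real \<Rightarrow> real" where
  "RL_integral \<beta> g t = 1 / Gamma \<beta> * (LINT s|lebesgue_on {0<..<t}. (t - s) powr (\<beta> - 1) * g s)"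

text \<open>\<open>L\<^sup>2(0,T; \<H>\<^sup>-\<^sup>1)\<close> in the sense of Bochner: almost everywhere limits of simple functions with
  square integrable norm.\<close>

definition L2_Hm1 ::
  "(nat \<Rightarrow> real \<Rightarrow> real) \<Rightarrow> (nat \<Rightarrow> real) \<Rightarrow> real \<Rightarrow> (real \<Rightarrow> (real \<Rightarrow> real) \<Rightarrow> real) set" where
  "L2_Hm1 \<phi> lam T = {g.
     (AE t in lebesgue_on {0<..<T}. g t \<in> Hdual \<phi> lam 1) \<and>
     (\<exists>s :: nat \<Rightarrow> real \<Rightarrow> (real \<Rightarrow> real) \<Rightarrow> real.
        (\<forall>k. s k ` {0<..<T} \<subseteq> Hdual \<phi> lam 1 \<and> finite (s k ` {0<..<T}) \<and>
             (\<forall>\<xi>. {t \<in> {0<..<T}. s k t = \<xi>} \<in> sets lebesgue)) \<and>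
        (AE t in lebesgue_on {0<..<T}.
           (\<lambda>k. Hdual_norm \<phi> lam 1 (\<lambda>w. s k t w - g t w)) \<longlonglongrightarrow> 0)) \<and>
     integrable (lebesgue_on {0<..<T}) (\<lambda>t. (Hdual_norm \<phi> lam 1 (g t))\<^sup>2)}"

definition C0_H1 ::
  "(nat \<Rightarrow> real \<Rightarrow> real) \<Rightarrow> (nat \<Rightarrow> real) \<Rightarrow> real \<Rightarrow> (real \<Rightarrow> real \<Rightarrow> real) set" where
  "C0_H1 \<phi> lam T = {u. \<forall>t\<in>{0..T}. u t \<in> Hs \<phi> lam 1 \<and>
     ((\<lambda>s. Hs_norm \<phi> lam 1 (\<lambda>x. u s x - u t x)) \<longlongrightarrow> 0) (at t within {0..T})}"

text \<open>\<open>C1_Hm1_deriv \<phi> lam T u u'\<close>: the \<open>L\<^sup>2\<close>-valued function \<open>u\<close>, regarded as an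
  \<open>\<H>\<^sup>-\<^sup>1\<close>-valued one, is continuously differentiable on \<open>[0,T]\<close> with derivative \<open>u'\<close>.\<close>

definition C1_Hm1_deriv ::
  "(nat \<Rightarrow> real \<Rightarrow> real) \<Rightarrow> (nat \<Rightarrow> real) \<Rightarrow> real \<Rightarrow> (real \<Rightarrow> real \<Rightarrow> real) \<Rightarrow>
   (real \<Rightarrow> (real \<Rightarrow> real) \<Rightarrow> real) \<Rightarrow> bool" where
  "C1_Hm1_deriv \<phi> lam T u u' \<longleftrightarrow>
     (\<forall>t\<in>{0..T}. u t \<in> L2 \<and> u' t \<in> Hdual \<phi> lam 1 \<and>
        ((\<lambda>s. Hdual_norm \<phi> lam 1 (\<lambda>w. (ip (u s) w - ip (u t) w) / (s - t) - u' t w))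
           \<longlongrightarrow> 0) (at t within {0..T}) \<and>
        ((\<lambda>s. Hdual_norm \<phi> lam 1 (\<lambda>w. u' s w - u' t w)) \<longlongrightarrow> 0) (at t within {0..T}))"

text \<open>\<open>D\<close> is the Caputo derivative of order \<open>\<alpha>\<close>, \<open>1 < \<alpha> < 2\<close>, of a function with continuous
  \<open>\<H>\<^sup>-\<^sup>1\<close>-valued time derivative \<open>u'\<close>: the distributional derivative on \<open>(0,T)\<close> of the
  Riemann-Liouville integral of order \<open>2 - \<alpha>\<close> of \<open>u' - u'(0)\<close>. The \<open>\<H>\<^sup>-\<^sup>1\<close>-valued integrals
  involved commute with evaluation at \<open>w\<close>, so both sides are written after evaluation.\<close>

definition caputo_deriv ::
  "(nat \<Rightarrow> real \<Rightarrow> real) \<Rightarrow> (nat \<Rightarrow> real) \<Rightarrow> real \<Rightarrow> real \<Rightarrow>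
   (real \<Rightarrow> (real \<Rightarrow> real) \<Rightarrow> real) \<Rightarrow> (real \<Rightarrow> (real \<Rightarrow> real) \<Rightarrow> real) \<Rightarrow> bool" where
  "caputo_deriv \<phi> lam \<alpha> T u' D \<longleftrightarrow>
     (\<forall>\<psi>. test_fun 0 T \<psi> \<longrightarrow> (\<forall>w\<in>Hs \<phi> lam 1.
        (LINT t|lebesgue_on {0<..<T}. deriv \<psi> t * RL_integral (2 - \<alpha>) (\<lambda>s. u' s w - u' 0 w) t)
        = - (LINT t|lebesgue_on {0<..<T}. \<psi> t * D t w)))"

definition weak_solution ::
  "real \<Rightarrow> (nat \<Rightarrow> real \<Rightarrow> real) \<Rightarrow> (nat \<Rightarrow> real) \<Rightarrow> real \<Rightarrow> real \<Rightarrow>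
   (real \<Rightarrow> real) \<Rightarrow> (real \<Rightarrow> real) \<Rightarrow> (real \<Rightarrow> real \<Rightarrow> real) \<Rightarrow> (real \<Rightarrow> real \<Rightarrow> real) \<Rightarrow> bool" where
  "weak_solution \<mu> \<phi> lam \<alpha> T u0 u1 f u \<longleftrightarrow>
     u \<in> C0_H1 \<phi> lam T \<and>
     (\<exists>u' D.
        C1_Hm1_deriv \<phi> lam T u u' \<and>
        D \<in> L2_Hm1 \<phi> lam T \<and>
        caputo_deriv \<phi> lam \<alpha> T u' D \<and>
        (AE x in Omega. u 0 x = u0 x) \<and>
        (\<forall>w\<in>Hs \<phi> lam 1. u' 0 w = ip u1 w) \<and>
        (AE t in lebesgue_on {0<..<T}. \<forall>v\<in>Hs \<phi> lam 1. D t v + a_form \<mu> (u t) v = ip (f t) v))"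

definition K_coeff :: "(nat \<Rightarrow> real) \<Rightarrow> real \<Rightarrow> real \<Rightarrow> (real \<Rightarrow> real) \<Rightarrow> nat \<Rightarrow> real" where
  "K_coeff lam \<alpha> T q n =
     (LINT s|lebesgue_on {0<..<T}.
        (T - s) powr (\<alpha> - 1) * mittag_leffler \<alpha> \<alpha> (- lam n * (T - s) powr \<alpha>) * q s)"

text \<open>\<open>solution_for \<dots> p u\<close> says \<open>u = u[p]\<close> and \<open>A_graph \<dots> p w\<close> says \<open>\<A> p = w\<close>. Stating
  these as relations keeps existence and uniqueness of weak solutions out of the definitions:
  nothing has to be assumed about them.\<close>

definition solution_for ::
  "real \<Rightarrow> (nat \<Rightarrow> real \<Rightarrow> real) \<Rightarrow> (nat \<Rightarrow> real) \<Rightarrow> real \<Rightarrow> real \<Rightarrow>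
   (real \<Rightarrow> real) \<Rightarrow> (real \<Rightarrow> real) \<Rightarrow> (real \<Rightarrow> real) \<Rightarrow> (real \<Rightarrow> real) \<Rightarrow> (real \<Rightarrow> real \<Rightarrow> real) \<Rightarrow> bool" where
  "solution_for \<mu> \<phi> lam \<alpha> T u0 u1 q p u \<longleftrightarrow>
     weak_solution \<mu> \<phi> lam \<alpha> T u0 u1 (\<lambda>t x. p x * q t) u"

definition A_graph ::
  "real \<Rightarrow> (nat \<Rightarrow> real \<Rightarrow> real) \<Rightarrow> (nat \<Rightarrow> real) \<Rightarrow> real \<Rightarrow> real \<Rightarrow>
   (real \<Rightarrow> real) \<Rightarrow> (real \<Rightarrow> real) \<Rightarrow> (real \<Rightarrow> real) \<Rightarrow> (real \<Rightarrow> real) \<Rightarrow> (real \<Rightarrow> real) \<Rightarrow> bool" where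
  "A_graph \<mu> \<phi> lam \<alpha> T u0 u1 q p w \<longleftrightarrow>
     (\<exists>u z. solution_for \<mu> \<phi> lam \<alpha> T u0 u1 q p u \<and>
            solution_for \<mu> \<phi> lam \<alpha> T u0 u1 q (\<lambda>_. 0) z \<and>
            (AE x in Omega. u T x - z T x = w x))"

definition at_most_one_in_L2 :: "((real \<Rightarrow> real) \<Rightarrow> bool) \<Rightarrow> bool" where
  "at_most_one_in_L2 P \<longleftrightarrow>
     (\<forall>p\<in>L2. \<forall>p'\<in>L2. P p \<longrightarrow> P p' \<longrightarrow> (AE x in Omega. p x = p' x))"

end

theory Submission
  imports Defs
begin

text \<open>
The inverse problem decouples in the eigenbasis. Let \<open>u\<close> and \<open>v\<close> be weak solutions for the sources \<open>p\<close> and \<open>p'\<close> with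
the same initial data. Testing the weak formulation with \<open>\<phi>\<^sub>n\<close> shows that the difference
\<open>d(t) = (u(t) - v(t), \<phi>\<^sub>n)\<close> solves the scalar fractional equation \<open>D\<^sup>\<alpha> d + \<lambda>\<^sub>n d = (p - p', \<phi>\<^sub>n) q\<close> with vanishing
initial values. This equation is equivalent to the Volterra equation \<open>d = I\<^sup>\<alpha>((p - p', \<phi>\<^sub>n) q - \<lambda>\<^sub>n d)\<close>, and iterating
the latter produces the Mittag-Leffler series, so that
\<open>d(T) = (p - p', \<phi>\<^sub>n) K\<^sub>n(q)\<close> (\<open>terminal_coefficient_difference\<close>). If the terminal states agree, then
\<open>K\<^sub>n(q) \<noteq> 0\<close> forces \<open>(p, \<phi>\<^sub>n) = (p', \<phi>\<^sub>n)\<close> for every \<open>n\<close>, and the eigenfunctions are complete in \<open>L\<^sup>2\<close>.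

Three steps of this argument carry the weight.

First, \<open>a\<^sub>\<mu>(u(t), \<phi>\<^sub>n) = \<lambda>\<^sub>n (u(t), \<phi>\<^sub>n)\<close> needs \<open>u(t) \<in> H\<^sub>0\<^sup>1\<close>, while a weak solution takes values in the space \<open>\<H>\<^sup>1\<close>
that is defined by the decay of coefficients. The inclusion (\<open>Hs_subset_H01\<close>) rests on Hardy's inequality, which makes
the form coercive for \<open>\<mu> < 1/4\<close>, on the completeness of \<open>L\<^sup>2\<close>, and on the uniqueness of weak derivatives.

Second, the Caputo derivative is a distributional one. The lemma of du Bois-Reymond, applied with smoothed indicator
functions of intervals, turns the equation into \<open>I\<^sup>2\<^sup>-\<^sup>\<alpha>(y' - y'(0)) = I\<^sup>1(\<dots>)\<close>, and the semigroup property of the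
Riemann-Liouville integrals yields the Volterra equation (\<open>caputo_ode_imp_Volterra\<close>). The same smoothed indicators give
the fundamental lemma of the calculus of variations, hence the uniqueness of weak derivatives.

Third, solutions are differentiable in time only with respect to the dual norm of \<open>\<H>\<^sup>-\<^sup>1\<close>. Parseval's identity shows
that \<open>L\<^sup>2\<close> functions act as bounded functionals on \<open>\<H>\<^sup>1\<close>, and so the dual norm controls each single coefficient
(\<open>C1_Hm1_derivD\<close>).
\<close>

section \<open>A smooth step function\<close>


text \<open>Smoothness is split by order of differentiability, so that closure under products, reciprocals and
  affine substitutions is an induction on the order; for the quantifier over all orders at once there
  would be no induction hypothesis about the derivative of a product.\<close>

fun times_diff :: "nat \<Rightarrow> (real \<Rightarrow> real) \<Rightarrow> bool" where
  "times_diff 0 f = True"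
| "times_diff (Suc k) f = ((\<forall>x. f differentiable at x) \<and> times_diff k (deriv f))"

definition smooth :: "(real \<Rightarrow> real) \<Rightarrow> bool" where
  "smooth f \<longleftrightarrow> (\<forall>k. times_diff k f)"

lemma DERIV_deriv_real: "f differentiable at x \<Longrightarrow> (f has_real_derivative deriv f x) (at x)"
  for f :: "real \<Rightarrow> real"
  using DERIV_deriv_iff_real_differentiable by blast

lemma times_diff_SucD: "times_diff (Suc k) f \<Longrightarrow> times_diff k f"
proof (induction k arbitrary: f)
  case (Suc k)
  then show ?case by (metis times_diff.simps(2))
qed simp

lemma times_diff_SucI:
  assumes "\<And>x. (f has_real_derivative f' x) (at x)" and "times_diff k f'"
  shows "times_diff (Suc k) f"
proof -
  have "deriv f = f'" using assms(1) DERIV_imp_deriv by blast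
  then show ?thesis using assms real_differentiable_def by auto
qed

lemma times_diff_const: "times_diff k (\<lambda>_. c)"
proof (induction k arbitrary: c)
  case (Suc k)
  show ?case by (rule times_diff_SucI[where f' = "\<lambda>_. 0"]) (auto simp: Suc)
qed simp

lemma times_diff_add: "times_diff k f \<Longrightarrow> times_diff k g \<Longrightarrow> times_diff k (\<lambda>x. f x + g x)"
proof (induction k arbitrary: f g)
  case (Suc k)
  show ?case
    by (rule times_diff_SucI[where f' = "\<lambda>x. deriv f x + deriv g x"])
       (use Suc in \<open>auto intro!: derivative_eq_intros DERIV_deriv_real\<close>)
qed simp

lemma times_diff_mult: "times_diff k f \<Longrightarrow> times_diff k g \<Longrightarrow> times_diff k (\<lambda>x. f x * g x)"
proof (induction k arbitrary: f g)
  case (Suc k)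
  have s: "times_diff k f" "times_diff k g" using Suc.prems times_diff_SucD by blast+
  show ?case
  proof (rule times_diff_SucI[where f' = "\<lambda>x. deriv f x * g x + deriv g x * f x"])
    show "((\<lambda>x. f x * g x) has_real_derivative deriv f x * g x + deriv g x * f x) (at x)" for x
      using Suc.prems by (auto intro!: DERIV_mult DERIV_deriv_real)
    show "times_diff k (\<lambda>x. deriv f x * g x + deriv g x * f x)"
      by (intro times_diff_add Suc.IH) (use Suc.prems s in auto)
  qed
qed simp

lemma times_diff_inverse:
  "times_diff k f \<Longrightarrow> (\<And>x. f x \<noteq> 0) \<Longrightarrow> times_diff k (\<lambda>x. inverse (f x))"
proof (induction k arbitrary: f)
  case (Suc k)
  have s: "times_diff k (\<lambda>x. inverse (f x))" using Suc times_diff_SucD by blast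
  show ?case
  proof (rule times_diff_SucI[where f' = "\<lambda>x. (- 1) * (inverse (f x) * deriv f x * inverse (f x))"])
    show "((\<lambda>x. inverse (f x)) has_real_derivative (- 1) * (inverse (f x) * deriv f x * inverse (f x))) (at x)" for x
      using DERIV_inverse'[of f "deriv f x" x UNIV] DERIV_deriv_real[of f x] Suc.prems by simp
    show "times_diff k (\<lambda>x. (- 1) * (inverse (f x) * deriv f x * inverse (f x)))"
      by (intro times_diff_mult times_diff_const s) (use Suc.prems in auto)
  qed
qed simp

lemma times_diff_affine: "times_diff k f \<Longrightarrow> times_diff k (\<lambda>x. f (a * x + b))"
proof (induction k arbitrary: f)
  case (Suc k)
  show ?case
  proof (rule times_diff_SucI[where f' = "\<lambda>x. a * deriv f (a * x + b)"])
    show "((\<lambda>x. f (a * x + b)) has_real_derivative a * deriv f (a * x + b)) (at x)" for x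
    proof -
      have "((\<lambda>x. a * x + b) has_real_derivative a) (at x)" by (auto intro!: derivative_eq_intros)
      with DERIV_chain2[of f "deriv f (a * x + b)" "\<lambda>x. a * x + b" x a UNIV]
      show ?thesis using DERIV_deriv_real[of f "a * x + b"] Suc.prems by (simp add: mult.commute)
    qed
    show "times_diff k (\<lambda>x. a * deriv f (a * x + b))"
      by (intro times_diff_mult times_diff_const Suc.IH) (use Suc.prems in auto)
  qed
qed simp

lemma smooth_iff_deriv: "smooth f \<longleftrightarrow> (\<forall>k. (deriv ^^ k) f differentiable_on UNIV)"
proof -
  have "times_diff n f \<longleftrightarrow> (\<forall>k<n. \<forall>x. (deriv ^^ k) f differentiable at x)" for n
  proof (induction n arbitrary: f)
    case (Suc n)
    have "(\<forall>k<Suc n. P k) \<longleftrightarrow> P 0 \<and> (\<forall>k<n. P (Suc k))" for P by (auto simp: less_Suc_eq_0_disj)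
    then show ?case using Suc by (simp add: funpow_swap1 del: funpow.simps(2)) (simp add: funpow_swap1)
  qed simp
  then show ?thesis
    unfolding smooth_def by (auto simp: differentiable_on_def)
qed

lemma smooth_add: "smooth f \<Longrightarrow> smooth g \<Longrightarrow> smooth (\<lambda>x. f x + g x)"
  by (simp add: smooth_def times_diff_add)

lemma smooth_cmult: "smooth f \<Longrightarrow> smooth (\<lambda>x. c * f x)"
  by (simp add: smooth_def times_diff_mult times_diff_const)

lemma smooth_affine: "smooth f \<Longrightarrow> smooth (\<lambda>x. f (a * x + b))"
  by (simp add: smooth_def times_diff_affine)

lemma smooth_deriv: "smooth f \<Longrightarrow> smooth (deriv f)"
  unfolding smooth_def by (metis times_diff.simps(2))

lemma smooth_has_deriv: "smooth f \<Longrightarrow> (f has_real_derivative deriv f x) (at x)"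
  unfolding smooth_def by (metis times_diff.simps(2) DERIV_deriv_real)

lemma smooth_continuous: "smooth f \<Longrightarrow> continuous_on S f"
  by (meson DERIV_continuous_on has_field_derivative_at_within smooth_has_deriv)

lemma smooth_times: "smooth f \<Longrightarrow> smooth g \<Longrightarrow> smooth (\<lambda>x. f x * g x)"
  by (simp add: smooth_def times_diff_mult)

lemma smooth_inverse: "smooth f \<Longrightarrow> (\<And>x. f x \<noteq> 0) \<Longrightarrow> smooth (\<lambda>x. inverse (f x))"
  by (simp add: smooth_def times_diff_inverse)

text \<open>The family \<open>x\<^sup>-\<^sup>n exp(-1/x)\<close>, continued by zero to the left. It is closed under differentiation up to
  linear combinations, which makes \<open>exp(-1/x)\<close> (the case \<open>n = 0\<close>) smooth without any bookkeeping of
  polynomials in \<open>1/x\<close>.\<close>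

definition flat :: "nat \<Rightarrow> real \<Rightarrow> real" where
  "flat n x = (if x \<le> 0 then 0 else inverse x ^ n * exp (- inverse x))"

lemma flat_tendsto_0: "(flat n \<longlongrightarrow> 0) (at 0)"
proof -
  have "((\<lambda>x. inverse x ^ n / exp (inverse x)) \<longlongrightarrow> (0::real)) (at_right 0)"
    using filterlim_compose[OF tendsto_power_div_exp_0 filterlim_inverse_at_top_right] .
  then have r: "(flat n \<longlongrightarrow> 0) (at_right 0)"
    by (rule Lim_transform_eventually)
       (auto simp: eventually_at_filter flat_def exp_minus divide_simps)
  have "(flat n \<longlongrightarrow> 0) (at_left 0)"
    by (rule Lim_transform_eventually[of "\<lambda>_. 0"]) (auto simp: eventually_at_filter flat_def)
  with r show ?thesis by (simp add: filterlim_split_at_real)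
qed

lemma flat_has_deriv:
  "(flat n has_real_derivative (- real n) * flat (Suc n) x + flat (Suc (Suc n)) x) (at x)"
proof (cases x "0 :: real" rule: linorder_cases)
  case less
  have "((\<lambda>_. 0) has_real_derivative 0) (at x)" by simp
  then have "(flat n has_real_derivative 0) (at x)"
    by (rule has_field_derivative_transform_within_open[where S = "{..<0}"])
       (use less in \<open>auto simp: flat_def\<close>)
  then show ?thesis using less by (simp add: flat_def)
next
  case equal
  \<comment> \<open>At the origin the difference quotient of one member is the next member of the family.\<close>
  have "((\<lambda>h. flat n h / h) \<longlongrightarrow> 0) (at 0)"
    by (rule Lim_transform_eventually[OF flat_tendsto_0[of "Suc n"]])
       (auto simp: eventually_at_filter flat_def divide_simps)
  then show ?thesis using equal by (simp add: DERIV_def flat_def)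
next
  case greater
  have "((\<lambda>x. inverse x ^ n * exp (- inverse x)) has_real_derivative
     (- real n) * flat (Suc n) x + flat (Suc (Suc n)) x) (at x)"
  proof -
    have "((\<lambda>x. inverse x ^ n * exp (- inverse x)) has_real_derivative
       (real n * inverse x ^ (n - 1) * (inverse x)\<^sup>2) * (- exp (- inverse x))
        + inverse x ^ n * (exp (- inverse x) * (inverse x)\<^sup>2)) (at x)"
      using greater by (auto intro!: derivative_eq_intros simp: power2_eq_square)
    moreover have "real n * inverse x ^ (n - 1) * (inverse x)\<^sup>2 = real n * inverse x ^ Suc n"
      by (cases n) (auto simp: power2_eq_square)
    ultimately have "((\<lambda>x. inverse x ^ n * exp (- inverse x)) has_real_derivative
       (real n * inverse x ^ Suc n) * (- exp (- inverse x))
        + inverse x ^ n * (exp (- inverse x) * (inverse x)\<^sup>2)) (at x)" by (simp only:)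
    then show ?thesis
      using greater by (simp add: flat_def power2_eq_square algebra_simps)
  qed
  then show ?thesis
    by (rule has_field_derivative_transform_within_open[where S = "{0<..}"])
       (use greater in \<open>auto simp: flat_def\<close>)
qed

lemma smooth_flat: "smooth (flat n)"
proof -
  have "times_diff k (flat n)" for k
  proof (induction k arbitrary: n)
    case (Suc k)
    show ?case
      by (rule times_diff_SucI[OF flat_has_deriv]) (intro times_diff_add times_diff_mult times_diff_const Suc)
  qed simp
  then show ?thesis by (simp add: smooth_def)
qed

text \<open>With \<open>f(x) = exp(-1/x)\<close> the quotient \<open>f(x) / (f(x) + f(1 - x))\<close> is a smooth step: its denominator never
  vanishes because \<open>x\<close> and \<open>1 - x\<close> cannot both be nonpositive.\<close>

lemma smooth_step_exists:
  obtains B :: "real \<Rightarrow> real" where "smooth B" and "\<And>x. x \<le> 0 \<Longrightarrow> B x = 0"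
    and "\<And>x. 1 \<le> x \<Longrightarrow> B x = 1" and "\<And>x. 0 \<le> B x \<and> B x \<le> 1"
proof
  define B where "B = (\<lambda>x. flat 0 x * inverse (flat 0 x + flat 0 ((-1) * x + 1)))"
  have nn: "flat 0 x \<ge> 0" for x by (simp add: flat_def)
  have pos: "flat 0 x + flat 0 ((-1) * x + 1) > 0" for x
    by (auto simp: flat_def add_pos_nonneg add_nonneg_pos)
  show "smooth B"
    unfolding B_def
    by (intro smooth_times smooth_inverse smooth_add smooth_affine smooth_flat) (metis pos less_irrefl)
  show "x \<le> 0 \<Longrightarrow> B x = 0" for x by (simp add: B_def flat_def)
  show "1 \<le> x \<Longrightarrow> B x = 1" for x by (simp add: B_def flat_def)
  show "0 \<le> B x \<and> B x \<le> 1" for x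
    using nn[of x] nn[of "(-1) * x + 1"] pos[of x] by (auto simp: B_def field_simps)
qed

section \<open>Test functions and the lemma of du Bois-Reymond\<close>


lemma test_fun_iff_smooth:
  "test_fun a b \<psi> \<longleftrightarrow> smooth \<psi> \<and> (\<exists>c d. a < c \<and> d < b \<and> (\<forall>x. x \<notin> {c..d} \<longrightarrow> \<psi> x = 0))"
  by (simp add: test_fun_def smooth_iff_deriv)

lemma integral_lebesgue_on_eq_lborel:
  fixes f :: "real \<Rightarrow> real"
  assumes "S \<in> sets borel" "(\<lambda>x. indicator S x * f x) \<in> borel_measurable borel"
  shows "(LINT x|lebesgue_on S. f x) = (LBINT x. indicator S x * f x)"
proof -
  have "(LINT x|lebesgue_on S. f x) = (LINT x|lebesgue. indicator S x *\<^sub>R f x)"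
    using assms(1) by (intro integral_restrict_space) auto
  also have "\<dots> = (LBINT x. indicator S x * f x)"
    using assms(2) by (simp add: integral_completion)
  finally show ?thesis .
qed

text \<open>The derivative of a step of width \<open>1/m\<close> starting at \<open>r\<close> has total mass one and lives on \<open>[r, r + 1/m]\<close>.
  After rescaling this interval to \<open>[0,1]\<close> the claim is dominated convergence. The bound \<open>m k \<ge> M\<close> keeps
  all these intervals inside one compact subset of \<open>(a,b)\<close>, where \<open>g\<close> is bounded.\<close>

lemma approximate_identity:
  fixes g B :: "real \<Rightarrow> real" and m :: "nat \<Rightarrow> real"
  assumes ab: "a < r" and B: "smooth B" "\<And>x. x \<le> 0 \<Longrightarrow> B x = 0" "\<And>x. 1 \<le> x \<Longrightarrow> B x = 1"
    and g: "continuous_on {a<..<b} g"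
    and m: "filterlim m at_top sequentially" "\<And>k. m k \<ge> M" "M > 0" "r + 1 / M < b"
  shows "integrable (lebesgue_on {a<..<b}) (\<lambda>x. m k * deriv B (m k * x + - (m k * r)) * g x)"
    and "(\<lambda>k. LINT x|lebesgue_on {a<..<b}. m k * deriv B (m k * x + - (m k * r)) * g x) \<longlonglongrightarrow> g r"
proof -
  have cB: "continuous_on S (deriv B)" for S
    using B(1) smooth_deriv smooth_continuous by blast
  have B0: "deriv B x = 0" if "x \<notin> {0..1}" for x
  proof -
    have "(B has_real_derivative 0) (at x)"
    proof (cases "x < 0")
      case True
      have "((\<lambda>_. 0) has_real_derivative 0) (at x)" by simp
      then show ?thesis
        by (rule has_field_derivative_transform_within_open[where S = "{..<0}"]) (use True B in auto)
    next
      case False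
      have "((\<lambda>_. 1) has_real_derivative 0) (at x)" by simp
      then show ?thesis
        by (rule has_field_derivative_transform_within_open[where S = "{1<..}"]) (use False that B in auto)
    qed
    then show ?thesis by (rule DERIV_imp_deriv)
  qed
  have mpos: "m k > 0" for k using m(2)[of k] m(3) by linarith
  have rng: "r + z / m k \<in> {r..r + 1 / M}" if "z \<in> {0..1}" for z k
    using that mpos[of k] m(2)[of k] m(3) by (auto simp: frac_le)
  have sub: "{r..r + 1 / M} \<subseteq> {a<..<b}" using ab m by auto
  define F where "F k z = indicator {0..1} z * (deriv B z * g (r + z / m k))" for k z
  have Fm[measurable]: "F k \<in> borel_measurable borel" for k
  proof -
    have "continuous_on {0..1} (\<lambda>z. deriv B z * g (r + z / m k))"
      by (intro continuous_intros cB continuous_on_compose2[OF g])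
         (use rng[of _ k] sub mpos[of k] in \<open>fastforce\<close>)+
    from borel_measurable_continuous_on_indicator[OF _ this] show ?thesis
      unfolding F_def by simp
  qed
  obtain C where C0: "\<forall>y\<in>deriv B ` {0..1}. norm y \<le> C"
    using compact_continuous_image[OF cB compact_Icc, THEN compact_imp_bounded] bounded_iff by metis
  obtain G where G0: "\<forall>y\<in>g ` {r..r + 1 / M}. norm y \<le> G"
    using compact_continuous_image[OF continuous_on_subset[OF g sub] compact_Icc, THEN compact_imp_bounded]
      bounded_iff by metis
  have C: "\<bar>deriv B z\<bar> \<le> C" if "z \<in> {0..1}" for z using C0 that by auto
  have G: "\<bar>g z\<bar> \<le> G" if "z \<in> {r..r + 1 / M}" for z using G0 that by auto
  have dom: "norm (F k z) \<le> indicator {0..1} z * (C * G)" for k z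
    using C[of z] G[OF rng[of z k]] unfolding F_def
    by (auto simp: indicator_def abs_mult intro!: mult_mono)
  have domi: "integrable lborel (\<lambda>z::real. indicator {0..1} z * (C * G))"
    using borel_integrable_atLeastAtMost'[of 0 1 "\<lambda>_. C * G"] by (simp add: set_integrable_def)
  have Fi: "integrable lborel (F k)" for k
    by (rule Bochner_Integration.integrable_bound[OF domi]) (use dom[of k] in \<open>auto intro: order_trans[OF _ abs_ge_self]\<close>)
  have eq: "indicator {a<..<b} x * (m k * deriv B (m k * x + - (m k * r)) * g x)
      = m k * F k (- (m k * r) + m k * x)" for k x
  proof (cases "- (m k * r) + m k * x \<in> {0..1}")
    case True
    have "r + (- (m k * r) + m k * x) / m k = x" using mpos[of k] by (simp add: field_simps)
    moreover from this have "x \<in> {a<..<b}" using rng[OF True, of k] sub by auto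
    ultimately show ?thesis using True by (simp add: F_def algebra_simps)
  next
    case False
    then have "deriv B (m k * x + - (m k * r)) = 0" by (intro B0) (simp add: algebra_simps)
    then show ?thesis using False by (simp add: F_def)
  qed
  have "integrable lborel (\<lambda>x. m k * F k (- (m k * r) + m k * x))"
    using lborel_integrable_real_affine[OF Fi, of "m k" k "- (m k * r)"] mpos[of k] by simp
  then show "integrable (lebesgue_on {a<..<b}) (\<lambda>x. m k * deriv B (m k * x + - (m k * r)) * g x)"
    by (subst integrable_restrict_space) (simp, simp only: real_scaleR_def eq, simp add: integrable_completion)
  have int: "(LINT x|lebesgue_on {a<..<b}. m k * deriv B (m k * x + - (m k * r)) * g x) = integral\<^sup>L lborel (F k)" for k
  proof -
    have "(LINT x|lebesgue_on {a<..<b}. m k * deriv B (m k * x + - (m k * r)) * g x)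
        = (LBINT x. m k * F k (- (m k * r) + m k * x))"
      by (subst integral_lebesgue_on_eq_lborel) (simp, simp only: eq, measurable, simp only: eq)
    then show ?thesis
      using mpos[of k] lborel_integral_real_affine[of "m k" "F k" "- (m k * r)"] by simp
  qed
  have "(\<lambda>k. integral\<^sup>L lborel (F k)) \<longlonglongrightarrow> (LBINT z. indicator {0..1} z * (deriv B z * g r))"
  proof (rule integral_dominated_convergence[OF _ _ domi])
    have "continuous_on {0..1} (\<lambda>z. deriv B z * g r)" by (intro continuous_intros cB)
    from borel_measurable_continuous_on_indicator[OF _ this]
    show "(\<lambda>z. indicator {0..1} z * (deriv B z * g r)) \<in> borel_measurable lborel" by simp
    show "AE z in lborel. (\<lambda>k. F k z) \<longlonglongrightarrow> indicator {0..1} z * (deriv B z * g r)"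
    proof (rule AE_I2)
      fix z
      have "(\<lambda>k. z / m k) \<longlonglongrightarrow> 0"
        using tendsto_divide_0[OF tendsto_const[of z] filterlim_at_top_imp_at_infinity[OF m(1)]] .
      then have "(\<lambda>k. r + z / m k) \<longlonglongrightarrow> r + 0" by (intro tendsto_intros)
      moreover have "isCont g r"
      proof -
        have "r < b" using m(3,4) by (smt (verit) zero_less_divide_1_iff)
        then show ?thesis using g ab by (simp add: continuous_on_eq_continuous_at)
      qed
      ultimately have "(\<lambda>k. g (r + z / m k)) \<longlonglongrightarrow> g r"
        using isCont_tendsto_compose[of r g] by simp
      then show "(\<lambda>k. F k z) \<longlonglongrightarrow> indicator {0..1} z * (deriv B z * g r)"
        unfolding F_def by (intro tendsto_intros)
    qed
  qed (use dom in auto)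
  also have "(LBINT z. indicator {0..1} z * (deriv B z * g r)) = g r"
  proof -
    have "(LBINT z. indicator {0..1} z *\<^sub>R (deriv B z)) = B 1 - B 0"
    proof (rule integral_FTC_atLeastAtMost)
      show "(B has_vector_derivative deriv B x) (at x within {0..1})" for x
        using has_field_derivative_at_within[OF smooth_has_deriv[OF B(1)]]
        by (simp add: has_real_derivative_iff_has_vector_derivative)
    qed (use cB in auto)
    then have "(LBINT z. (indicator {0..1} z * deriv B z) * g r) = g r" using B by simp
    then show ?thesis by (simp add: mult.assoc)
  qed
  finally show "(\<lambda>k. LINT x|lebesgue_on {a<..<b}. m k * deriv B (m k * x + - (m k * r)) * g x) \<longlonglongrightarrow> g r"
    by (simp only: int)
qed

text \<open>A step up at \<open>s\<close> followed by a step down at \<open>t\<close>, both of width \<open>1/m\<close>: the functions tend to the indicator of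
  \<open>(s,t]\<close>, and their derivatives tend to the difference of the point masses at \<open>s\<close> and at \<open>t\<close>.\<close>

lemma test_functions_to_indicator:
  fixes a b s t :: real
  assumes "a < s" "s < t" "t < b"
  obtains \<psi> :: "nat \<Rightarrow> real \<Rightarrow> real"
  where "\<And>k. test_fun a b (\<psi> k)" and "\<And>k x. \<bar>\<psi> k x\<bar> \<le> 1"
    and "\<And>x. (\<lambda>k. \<psi> k x) \<longlonglongrightarrow> indicator {s<..t} x"
    and "\<And>g. continuous_on {a<..<b} g \<Longrightarrow>
           (\<lambda>k. LINT x|lebesgue_on {a<..<b}. deriv (\<psi> k) x * g x) \<longlonglongrightarrow> g s - g t"
proof -
  obtain B :: "real \<Rightarrow> real" where B: "smooth B" "\<And>x. x \<le> 0 \<Longrightarrow> B x = 0"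
    "\<And>x. 1 \<le> x \<Longrightarrow> B x = 1" "\<And>x. 0 \<le> B x \<and> B x \<le> 1"
    using smooth_step_exists by blast
  \<comment> \<open>The second step ends at t + 1/m, which has to stay below b.\<close>
  define M where "M = 2 / (b - t)"
  have M: "M > 0" "t + 1 / M < b" "s + 1 / M < b" using assms by (auto simp: M_def field_simps)
  define m where "m k = real k + M" for k :: nat
  have m: "filterlim m at_top sequentially" "\<And>k. m k \<ge> M"
    unfolding m_def using filterlim_tendsto_add_at_top[OF tendsto_const filterlim_real_sequentially, of M]
    by (auto simp: add.commute)
  have mpos: "m k > 0" for k using m(2)[of k] M by linarith
  define \<psi> where "\<psi> k x = B (m k * x + - (m k * s)) + (-1) * B (m k * x + - (m k * t))" for k x
  have sm: "smooth (\<psi> k)" for k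
    unfolding \<psi>_def by (intro smooth_add smooth_cmult smooth_affine B)
  have z: "\<psi> k x = 0" if "x \<notin> {s..t + 1 / m k}" for k x
  proof (cases "x < s")
    case True
    then have "m k * x \<le> m k * s" "m k * x \<le> m k * t" using mpos[of k] assms by auto
    then show ?thesis using B by (simp add: \<psi>_def)
  next
    case False
    then have "x - t > 1 / m k" using that by auto
    then have "m k * x - m k * t \<ge> 1" using mpos[of k] by (simp add: field_simps)
    moreover have "m k * s \<le> m k * t" using mpos[of k] assms by simp
    ultimately show ?thesis using B by (simp add: \<psi>_def)
  qed
  have big: "eventually (\<lambda>k. m k * x - m k * y \<ge> 1) sequentially" if "y < x" for x y
  proof -
    have "eventually (\<lambda>k. m k \<ge> 1 / (x - y)) sequentially" using m(1) by (simp add: filterlim_at_top)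
    then show ?thesis by eventually_elim (use that in \<open>simp add: field_simps\<close>)
  qed
  show thesis
  proof (rule that[of \<psi>])
    show "test_fun a b (\<psi> k)" for k
    proof -
      have "1 / m k \<le> 1 / M" using m(2)[of k] M by (simp add: frac_le)
      then have "t + 1 / m k < b" using M by linarith
      then show ?thesis
        unfolding test_fun_iff_smooth using sm[of k] z[of _ k] assms(1) by blast
    qed
    show "\<bar>\<psi> k x\<bar> \<le> 1" for k x
      using B(4)[of "m k * x + - (m k * s)"] B(4)[of "m k * x + - (m k * t)"]
      unfolding \<psi>_def by linarith
    show "(\<lambda>k. \<psi> k x) \<longlonglongrightarrow> indicator {s<..t} x" for x
    proof -
      consider "x \<le> s" | "s < x" "x \<le> t" | "t < x" by linarith
      then have "eventually (\<lambda>k. \<psi> k x = indicator {s<..t} x) sequentially"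
      proof cases
        case 1
        then have "m k * x \<le> m k * s" "m k * x \<le> m k * t" for k using mpos[of k] assms by auto
        then show ?thesis using 1 B(2) by (auto simp: \<psi>_def)
      next
        case 2
        have le: "m k * x \<le> m k * t" for k using mpos[of k] 2 by auto
        show ?thesis using big[OF 2(1)]
          by eventually_elim (use 2 B(2,3) le in \<open>auto simp: \<psi>_def\<close>)
      next
        case 3
        show ?thesis using big[OF 3] big[OF less_trans[OF assms(2) 3]]
          by eventually_elim (use 3 B(3) in \<open>auto simp: \<psi>_def\<close>)
      qed
      then show ?thesis by (rule tendsto_eventually)
    qed
    fix g :: "real \<Rightarrow> real" assume g: "continuous_on {a<..<b} g"
    have d: "deriv (\<psi> k) x = m k * deriv B (m k * x + - (m k * s)) - m k * deriv B (m k * x + - (m k * t))" for k x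
    proof (rule DERIV_imp_deriv)
      have "((\<lambda>x. B (m k * x + c)) has_real_derivative m k * deriv B (m k * x + c)) (at x)" for c
      proof -
        have "((\<lambda>x. m k * x + c) has_real_derivative m k) (at x)" by (auto intro!: derivative_eq_intros)
        with DERIV_chain2[of B "deriv B (m k * x + c)" "\<lambda>x. m k * x + c" x "m k" UNIV]
        show ?thesis using smooth_has_deriv[OF B(1)] by (simp add: mult.commute)
      qed
      from DERIV_add[OF this DERIV_cmult[OF this], of "- (m k * s)" "-1" "- (m k * t)"]
      show "(\<psi> k has_real_derivative
        m k * deriv B (m k * x + - (m k * s)) - m k * deriv B (m k * x + - (m k * t))) (at x)"
        unfolding \<psi>_def by simp
    qed
    have A: "integrable (lebesgue_on {a<..<b}) (\<lambda>x. m k * deriv B (m k * x + - (m k * r)) * g x)"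
      "(\<lambda>k. LINT x|lebesgue_on {a<..<b}. m k * deriv B (m k * x + - (m k * r)) * g x) \<longlonglongrightarrow> g r"
      if "a < r" "r + 1 / M < b" for r k
      using approximate_identity[OF that(1) B(1) _ _ g m M(1) that(2)] B(2,3) by blast+
    have as: "a < t" using assms by linarith
    show "(\<lambda>k. LINT x|lebesgue_on {a<..<b}. deriv (\<psi> k) x * g x) \<longlonglongrightarrow> g s - g t"
      using tendsto_diff[OF A(2)[OF assms(1) M(3)] A(2)[OF as M(2)]]
      unfolding d left_diff_distrib Bochner_Integration.integral_diff[OF A(1)[OF assms(1) M(3)] A(1)[OF as M(2)]] .
  qed
qed

text \<open>A continuous function whose distributional derivative is an integrable \<open>h\<close> is a primitive of \<open>h\<close>: test with
  the functions that approximate the indicator of \<open>(s,t]\<close>.\<close>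

lemma du_Bois_Reymond:
  fixes g h :: "real \<Rightarrow> real"
  assumes g: "continuous_on {a<..<b} g" and h: "integrable (lebesgue_on {a<..<b}) h"
    and eq: "\<And>\<psi>. test_fun a b \<psi> \<Longrightarrow>
      (LINT x|lebesgue_on {a<..<b}. deriv \<psi> x * g x) = - (LINT x|lebesgue_on {a<..<b}. \<psi> x * h x)"
    and st: "a < s" "s < t" "t < b"
  shows "g t - g s = (LINT x|lebesgue_on {a<..<b}. indicator {s<..t} x * h x)"
proof -
  obtain \<psi> where \<psi>: "\<And>k. test_fun a b (\<psi> k)" "\<And>k x. \<bar>\<psi> k x\<bar> \<le> 1"
    "\<And>x. (\<lambda>k. \<psi> k x) \<longlonglongrightarrow> indicator {s<..t} x"
    "(\<lambda>k. LINT x|lebesgue_on {a<..<b}. deriv (\<psi> k) x * g x) \<longlonglongrightarrow> g s - g t"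
    by (rule test_functions_to_indicator[OF st]) (use g that in blast)
  have hm[measurable]: "h \<in> borel_measurable (lebesgue_on {a<..<b})" using h by auto
  have \<psi>m[measurable]: "\<psi> k \<in> borel_measurable (lebesgue_on {a<..<b})" for k
    using \<psi>(1)[of k] by (intro continuous_imp_measurable_on_sets_lebesgue)
      (auto simp: test_fun_iff_smooth smooth_continuous)
  have "(\<lambda>k. LINT x|lebesgue_on {a<..<b}. \<psi> k x * h x)
      \<longlonglongrightarrow> (LINT x|lebesgue_on {a<..<b}. indicator {s<..t} x * h x)"
  proof (rule integral_dominated_convergence[where w = "\<lambda>x. \<bar>h x\<bar>"])
    show "(\<lambda>x. indicat_real {s<..t} x * h x) \<in> borel_measurable (lebesgue_on {a<..<b})"
      by (intro borel_measurable_times hm borel_measurable_indicator) (use st in \<open>auto simp: sets_restrict_space_iff\<close>)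
    show "AE x in lebesgue_on {a<..<b}. norm (\<psi> k x * h x) \<le> \<bar>h x\<bar>" for k
      using \<psi>(2)[of k] by (auto simp: abs_mult mult_left_le_one_le)
  qed (use \<psi>(3) h in \<open>auto intro!: tendsto_intros\<close>)
  moreover have "(\<lambda>k. LINT x|lebesgue_on {a<..<b}. \<psi> k x * h x) \<longlonglongrightarrow> - (g s - g t)"
    using tendsto_minus[OF \<psi>(4)] by (simp add: eq[OF \<psi>(1)])
  ultimately show ?thesis using LIMSEQ_unique by fastforce
qed

text \<open>The case of a vanishing primitive in the previous lemma says that \<open>h\<close> has integral zero over every interval
  \<open>(s,t]\<close>; these intervals generate the Borel sets and are stable under intersection, so \<open>h\<close> has
  integral zero over every Borel set.\<close>

lemma fundamental_lemma_calculus_of_variations: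
  fixes h :: "real \<Rightarrow> real"
  assumes h: "integrable (lebesgue_on {a<..<b}) h"
    and eq: "\<And>\<psi>. test_fun a b \<psi> \<Longrightarrow> (LINT x|lebesgue_on {a<..<b}. \<psi> x * h x) = 0"
  shows "AE x in lebesgue_on {a<..<b}. h x = 0"
proof -
  have z: "(LINT x|lebesgue_on {a<..<b}. indicator {s<..t} x * h x) = 0" if "a < s" "s < t" "t < b" for s t
    using du_Bois_Reymond[OF continuous_on_const h _ that, of 0] eq by simp
  have "integrable lebesgue (\<lambda>x. indicator {a<..<b} x *\<^sub>R h x)"
    using h by (subst (asm) integrable_restrict_space) auto
  then have hl: "(\<lambda>x. indicator {a<..<b} x * h x) \<in> borel_measurable lebesgue"
    by auto
  then obtain H where H[measurable]: "H \<in> borel_measurable borel"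
    and Hh: "AE x in lborel. indicator {a<..<b} x * h x = H x"
    using completion_ex_borel_measurable_real by force
  have Hi: "integrable lborel H"
  proof -
    have "integrable lebesgue (\<lambda>x. indicator {a<..<b} x *\<^sub>R h x)"
      using h by (subst (asm) integrable_restrict_space) auto
    then have "integrable lebesgue H"
      by (rule integrable_cong_AE_imp) (use Hh in \<open>auto intro: AE_completion measurable_completion elim!: eventually_mono\<close>)
    then show ?thesis by (simp add: integrable_completion)
  qed
  \<comment> \<open>Intervals that reach the boundary of (a,b), or beyond, are exhausted by admissible ones.\<close>
  have basic: "(LBINT x. indicator {s<..t} x * H x) = 0" for s t
  proof -
    define s' where "s' n = max s (a + inverse (real (Suc n)))" for n
    define t' where "t' n = min t (b - inverse (real (Suc n)))" for n
    have "(LBINT x. indicator {s' n<..t' n} x * H x) = 0" for n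
    proof (cases "s' n < t' n")
      case True
      have "a < s' n" "t' n < b" unfolding s'_def t'_def by (smt (verit) inverse_positive_iff_positive of_nat_0_less_iff zero_less_Suc)+
      from z[OF this(1) True this(2)]
      have "0 = (LINT x|lebesgue. indicator {a<..<b} x * (indicator {s' n<..t' n} x * h x))"
        by (subst (asm) integral_restrict_space) auto
      also have "\<dots> = (LINT x|lebesgue. indicator {s' n<..t' n} x * H x)"
      proof (rule integral_cong_AE)
        have "(\<lambda>x. indicator {s' n<..t' n} x * (indicator {a<..<b} x * h x)) \<in> borel_measurable lebesgue"
          by (intro borel_measurable_times hl) (auto intro: measurable_completion)
        then show "(\<lambda>x. indicator {a<..<b} x * (indicator {s' n<..t' n} x * h x)) \<in> borel_measurable lebesgue"
          by (simp add: mult.left_commute)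
        show "(\<lambda>x. indicator {s' n<..t' n} x * H x) \<in> borel_measurable lebesgue"
          by (intro measurable_completion) measurable
        show "AE x in lebesgue. indicator {a<..<b} x * (indicator {s' n<..t' n} x * h x) = indicator {s' n<..t' n} x * H x"
          using AE_completion[OF Hh] by eventually_elim (simp add: mult.left_commute)
      qed
      finally show ?thesis by (simp add: integral_completion)
    qed (auto simp: indicator_def)
    moreover have "(\<lambda>n. LBINT x. indicator {s' n<..t' n} x * H x) \<longlonglongrightarrow> (LBINT x. indicator {s<..t} x * H x)"
    proof (rule integral_dominated_convergence[where w = "\<lambda>x. \<bar>H x\<bar>"])
      show "AE x in lborel. (\<lambda>n. indicator {s' n<..t' n} x * H x) \<longlonglongrightarrow> indicator {s<..t} x * H x"
        using Hh
      proof eventually_elim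
        case (elim x)
        show ?case
        proof (cases "x \<in> {a<..<b}")
          case True
          have "(\<lambda>n. a + inverse (real (Suc n))) \<longlonglongrightarrow> a + 0" "(\<lambda>n. b - inverse (real (Suc n))) \<longlonglongrightarrow> b - 0"
            by (intro tendsto_intros LIMSEQ_inverse_real_of_nat)+
          then have "eventually (\<lambda>n. a + inverse (real (Suc n)) < x) sequentially"
            "eventually (\<lambda>n. x < b - inverse (real (Suc n))) sequentially"
            using True by (auto intro: order_tendstoD)
          then have "eventually (\<lambda>n. indicator {s' n<..t' n} x * H x = indicator {s<..t} x * H x) sequentially"
            by eventually_elim (auto simp: s'_def t'_def indicator_def)
          then show ?thesis by (rule tendsto_eventually)
        qed (use elim in auto)
      qed
    qed (use Hi in \<open>auto simp: indicator_def\<close>)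
    ultimately show ?thesis by (simp add: LIMSEQ_const_iff)
  qed
  have tot: "(LBINT x. H x) = 0"
  proof -
    have "(LBINT x. H x) = (LBINT x. indicator {a<..b} x * H x)"
    proof (rule integral_cong_AE)
      show "AE x in lborel. H x = indicator {a<..b} x * H x"
        using Hh
      proof eventually_elim
        case (elim x)
        then show ?case by (cases "x \<in> {a<..<b}") auto
      qed
    qed auto
    then show ?thesis using basic by simp
  qed
  have "(LBINT x:A. H x) = 0" if that: "A \<in> sets lborel" for A
  proof -
    let ?G = "range (\<lambda>(a, b). {a <.. b::real})"
    have G: "Int_stable ?G" by (auto simp: Int_stable_def)
    have A: "A \<in> sigma_sets UNIV ?G" using that by (simp add: borel_sigma_sets_Ioc)
    have borel: "sigma_sets UNIV ?G = sets borel" by (simp add: borel_sigma_sets_Ioc)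
    have si: "set_integrable lborel A H" if "A \<in> sets borel" for A
      unfolding set_integrable_def using that Hi by (intro integrable_mult_indicator) auto
    from G subset_UNIV[of ?G, folded Pow_UNIV] A show ?thesis
    proof (induction rule: sigma_sets_induct_disjoint)
      case (compl A)
      then have [measurable]: "A \<in> sets borel" by (simp add: borel)
      have "(LBINT x:UNIV - A. H x) + (LBINT x:A. H x) = (LBINT x:(UNIV - A) \<union> A. H x)"
        by (rule set_integral_Un[symmetric]) (auto intro!: si)
      then show ?case using compl tot by (simp add: set_lebesgue_integral_def)
    next
      case (union A)
      then have [measurable]: "A i \<in> sets borel" for i using borel by blast
      have "(LBINT x:(\<Union>i. A i). H x) = (\<Sum>i. LBINT x:A i. H x)"
        by (rule lebesgue_integral_countable_add) (use union(1) in \<open>auto intro!: si simp: disjoint_family_on_def\<close>)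
      then show ?case using union by simp
    qed (use basic in \<open>auto simp: set_lebesgue_integral_def\<close>)
  qed
  then have "AE x in lborel. H x = 0" by (intro sigma_finite_measure.density_zero[OF sigma_finite_lborel] Hi)
  with Hh have "AE x in lborel. x \<in> {a<..<b} \<longrightarrow> h x = 0" by eventually_elim auto
  then show ?thesis by (subst AE_restrict_space_iff) (auto intro: AE_completion)
qed

section \<open>The Hilbert space of square integrable functions\<close>


abbreviation nsq :: "(real \<Rightarrow> real) \<Rightarrow> real" where
  "nsq v \<equiv> (LINT x|Omega. (v x)\<^sup>2)"

lemma L2D: "v \<in> L2 \<Longrightarrow> v \<in> borel_measurable Omega" "v \<in> L2 \<Longrightarrow> integrable Omega (\<lambda>x. (v x)\<^sup>2)"
  by (auto simp: L2_def)

lemma finite_measure_Omega: "finite_measure Omega"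
  by (rule finite_measureI) (simp add: emeasure_restrict_space)

lemma L2_mult_integrable:
  assumes "v \<in> L2" "w \<in> L2" shows "integrable Omega (\<lambda>x. v x * w x)"
proof (rule Bochner_Integration.integrable_bound)
  show "integrable Omega (\<lambda>x. (v x)\<^sup>2 + (w x)\<^sup>2)" using assms L2D by auto
  show "(\<lambda>x. v x * w x) \<in> borel_measurable Omega" using assms L2D by (intro borel_measurable_times) auto
  have "\<bar>a * b\<bar> \<le> a\<^sup>2 + b\<^sup>2" for a b :: real
  proof -
    have "2 * \<bar>a * b\<bar> \<le> a\<^sup>2 + b\<^sup>2"
      using sum_squares_bound[of "\<bar>a\<bar>" "\<bar>b\<bar>"] by (simp add: abs_mult mult.assoc)
    then show ?thesis using abs_ge_zero[of "a * b"] by linarith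
  qed
  then show "AE x in Omega. norm (v x * w x) \<le> norm ((v x)\<^sup>2 + (w x)\<^sup>2)" by auto
qed

lemma L2_lincomb:
  assumes "v \<in> L2" "w \<in> L2" shows "(\<lambda>x. a * v x + b * w x) \<in> L2"
proof -
  have "(a * v x + b * w x)\<^sup>2 = a\<^sup>2 * (v x)\<^sup>2 + 2 * a * b * (v x * w x) + b\<^sup>2 * (w x)\<^sup>2" for x
    by (simp add: power2_eq_square algebra_simps)
  moreover have "integrable Omega (\<lambda>x. a\<^sup>2 * (v x)\<^sup>2 + 2 * a * b * (v x * w x) + b\<^sup>2 * (w x)\<^sup>2)"
    using assms L2D(2) L2_mult_integrable by (intro Bochner_Integration.integrable_add integrable_mult_right) auto
  moreover have "(\<lambda>x. a * v x + b * w x) \<in> borel_measurable Omega"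
    using assms L2D(1) by (intro borel_measurable_add borel_measurable_times) auto
  ultimately show ?thesis by (simp add: L2_def)
qed

lemma L2_diff: "v \<in> L2 \<Longrightarrow> w \<in> L2 \<Longrightarrow> (\<lambda>x. v x - w x) \<in> L2"
  using L2_lincomb[of v w 1 "-1"] by simp

lemma L2_add: "v \<in> L2 \<Longrightarrow> w \<in> L2 \<Longrightarrow> (\<lambda>x. v x + w x) \<in> L2"
  using L2_lincomb[of v w 1 1] by simp

lemma L2_cmult: "v \<in> L2 \<Longrightarrow> (\<lambda>x. a * v x) \<in> L2"
  using L2_lincomb[of v v a 0] by simp

lemma L2_zero: "(\<lambda>x. 0) \<in> L2" by (simp add: L2_def)

lemma L2_sum: "finite I \<Longrightarrow> (\<And>i. i \<in> I \<Longrightarrow> v i \<in> L2) \<Longrightarrow> (\<lambda>x. \<Sum>i\<in>I. c i * v i x) \<in> L2"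
proof (induction I rule: finite_induct)
  case (insert i I)
  have "(\<lambda>x. c i * v i x + (\<Sum>i\<in>I. c i * v i x)) \<in> L2"
    by (rule L2_add[OF L2_cmult]) (use insert in auto)
  then show ?case using insert by simp
qed (simp add: L2_zero)

lemma L2_integrable: "v \<in> L2 \<Longrightarrow> integrable Omega v"
proof -
  interpret finite_measure Omega by (rule finite_measure_Omega)
  assume "v \<in> L2"
  moreover have "(\<lambda>_. 1) \<in> L2" by (simp add: L2_def)
  ultimately show ?thesis using L2_mult_integrable[of v "\<lambda>_. 1"] by simp
qed

lemma nsq_nonneg: "0 \<le> nsq v" by simp

lemma ip_lincomb_left:
  assumes "v \<in> L2" "w \<in> L2" "u \<in> L2"
  shows "ip (\<lambda>x. a * v x + b * w x) u = a * ip v u + b * ip w u"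
proof -
  have "ip (\<lambda>x. a * v x + b * w x) u = (LINT x|Omega. a * (v x * u x) + b * (w x * u x))"
    by (simp add: ip_def algebra_simps)
  then show ?thesis using assms L2_mult_integrable by (simp add: ip_def)
qed

lemma ip_commute: "ip v w = ip w v" by (simp add: ip_def mult.commute)

lemma ip_diff_left: "v \<in> L2 \<Longrightarrow> w \<in> L2 \<Longrightarrow> u \<in> L2 \<Longrightarrow> ip (\<lambda>x. v x - w x) u = ip v u - ip w u"
  using ip_lincomb_left[of v w u 1 "-1"] by simp

lemma nsq_lincomb:
  assumes "v \<in> L2" "w \<in> L2"
  shows "nsq (\<lambda>x. a * v x + b * w x) = a\<^sup>2 * nsq v + 2 * a * b * ip v w + b\<^sup>2 * nsq w"
proof -
  have "nsq (\<lambda>x. a * v x + b * w x) = (LINT x|Omega. a\<^sup>2 * (v x)\<^sup>2 + 2 * a * b * (v x * w x) + b\<^sup>2 * (w x)\<^sup>2)"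
    by (simp add: power2_eq_square algebra_simps)
  then show ?thesis using assms L2D(2) L2_mult_integrable by (simp add: ip_def)
qed

lemma nsq_eq_0_AE: "v \<in> L2 \<Longrightarrow> nsq v = 0 \<Longrightarrow> AE x in Omega. v x = 0"
  by (subst (asm) integral_nonneg_eq_0_iff_AE) (auto simp: L2D)

text \<open>The usual argument, expanding the square norm of \<open>\<parallel>w\<parallel>\<^sup>2 v - (v,w) w\<close>.\<close>

lemma ip_Cauchy_Schwarz:
  assumes "v \<in> L2" "w \<in> L2" shows "(ip v w)\<^sup>2 \<le> nsq v * nsq w"
proof (cases "nsq w = 0")
  case True
  then have "AE x in Omega. v x * w x = 0" using nsq_eq_0_AE[OF assms(2)] by auto
  then have "ip v w = 0" unfolding ip_def by (rule integral_eq_zero_AE)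
  then show ?thesis by simp
next
  case False
  then have pos: "nsq w > 0" using nsq_nonneg[of w] by linarith
  have "0 \<le> nsq (\<lambda>x. nsq w * v x + (- ip v w) * w x)" by (rule nsq_nonneg)
  also have "\<dots> = nsq w * (nsq v * nsq w - (ip v w)\<^sup>2)"
    by (subst nsq_lincomb[OF assms]) (simp add: power2_eq_square algebra_simps)
  finally show ?thesis using pos by (simp add: zero_le_mult_iff)
qed

lemma nsq_add_le:
  assumes "v \<in> L2" "w \<in> L2"
  shows "nsq (\<lambda>x. v x + w x) \<le> 2 * nsq v + 2 * nsq w"
proof -
  have "nsq (\<lambda>x. v x + w x) = nsq v + 2 * ip v w + nsq w"
    using nsq_lincomb[OF assms, of 1 1] by simp
  moreover have "nsq (\<lambda>x. v x - w x) = nsq v - 2 * ip v w + nsq w"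
    using nsq_lincomb[OF assms, of 1 "-1"] by simp
  ultimately show ?thesis using nsq_nonneg[of "\<lambda>x. v x - w x"] by linarith
qed

lemma L1_norm_le_nsq:
  assumes "v \<in> L2" shows "(LINT x|Omega. \<bar>v x\<bar>) \<le> sqrt (nsq v)"
proof -
  interpret finite_measure Omega by (rule finite_measure_Omega)
  have 1: "(\<lambda>_. 1) \<in> L2" by (simp add: L2_def)
  have a: "(\<lambda>x. \<bar>v x\<bar>) \<in> L2" using assms by (auto simp: L2_def)
  have "(LINT x|Omega. \<bar>v x\<bar>)\<^sup>2 \<le> nsq v * 1"
    using ip_Cauchy_Schwarz[OF a 1] by (simp add: ip_def measure_restrict_space)
  then show ?thesis by (simp add: real_le_rsqrt)
qed

lemma L2_tendsto_ip:
  assumes "\<And>k. v k \<in> L2" "v' \<in> L2" "w \<in> L2" "(\<lambda>k. nsq (\<lambda>x. v' x - v k x)) \<longlonglongrightarrow> 0"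
  shows "(\<lambda>k. ip (v k) w) \<longlonglongrightarrow> ip v' w"
proof -
  have "(\<lambda>k. ip v' w - ip (v k) w) \<longlonglongrightarrow> 0"
  proof (rule tendsto_0_le[where K = 1])
    have "(\<lambda>k. sqrt (nsq (\<lambda>x. v' x - v k x) * nsq w)) \<longlonglongrightarrow> sqrt (0 * nsq w)"
      by (intro tendsto_intros assms)
    then show "(\<lambda>k. sqrt (nsq (\<lambda>x. v' x - v k x) * nsq w)) \<longlonglongrightarrow> 0" by simp
    have "norm (ip v' w - ip (v k) w) \<le> norm (sqrt (nsq (\<lambda>x. v' x - v k x) * nsq w)) * 1" for k
      using ip_Cauchy_Schwarz[OF L2_diff[OF assms(2) assms(1)[of k]] assms(3)]
      by (simp add: ip_diff_left[OF assms(2) assms(1) assms(3)] real_le_rsqrt abs_le_square_iff real_sqrt_ge_zero)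
    then show "\<forall>\<^sub>F k in sequentially. norm (ip v' w - ip (v k) w) \<le> norm (sqrt (nsq (\<lambda>x. v' x - v k x) * nsq w)) * 1"
      by simp
  qed
  from tendsto_diff[OF tendsto_const this, of "ip v' w"] show ?thesis by simp
qed

lemma L2_tendsto_nsq:
  assumes "\<And>k. v k \<in> L2" "v' \<in> L2" "(\<lambda>k. nsq (\<lambda>x. v' x - v k x)) \<longlonglongrightarrow> 0"
  shows "(\<lambda>k. nsq (v k)) \<longlonglongrightarrow> nsq v'"
proof -
  have "nsq (\<lambda>x. v' x - v k x) = nsq v' - 2 * ip (v k) v' + nsq (v k)" for k
    using nsq_lincomb[OF assms(2) assms(1)[of k], of 1 "-1"] by (simp add: ip_commute)
  then have eq: "nsq (v k) = nsq (\<lambda>x. v' x - v k x) - nsq v' + 2 * ip (v k) v'" for k by simp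
  have "(\<lambda>k. nsq (v k)) \<longlonglongrightarrow> 0 - nsq v' + 2 * ip v' v'"
    unfolding eq by (intro tendsto_intros assms L2_tendsto_ip)
  moreover have "ip v' v' = nsq v'" by (simp add: ip_def power2_eq_square)
  ultimately show ?thesis by simp
qed

lemma L2_tendsto_AE_subseq:
  assumes "\<And>k. v k \<in> L2" "v' \<in> L2" "(\<lambda>k. nsq (\<lambda>x. v' x - v k x)) \<longlonglongrightarrow> 0"
  obtains r :: "nat \<Rightarrow> nat" where "strict_mono r" "AE x in Omega. (\<lambda>k. v (r k) x) \<longlonglongrightarrow> v' x"
proof -
  have d: "(\<lambda>x. v' x - v k x) \<in> L2" for k using assms L2_diff by blast
  have "(\<lambda>k. LINT x|Omega. norm (v' x - v k x)) \<longlonglongrightarrow> 0"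
  proof (rule tendsto_sandwich[of "\<lambda>_. 0"])
    show "(\<lambda>k. sqrt (nsq (\<lambda>x. v' x - v k x))) \<longlonglongrightarrow> 0"
      using tendsto_real_sqrt[OF assms(3)] by simp
  qed (use L1_norm_le_nsq[OF d] in auto)
  then obtain r :: "nat \<Rightarrow> nat" where r: "strict_mono r" "AE x in Omega. (\<lambda>k. v' x - v (r k) x) \<longlonglongrightarrow> 0"
    using tendsto_L1_AE_subseq[of Omega "\<lambda>k x. v' x - v k x"] L2_integrable[OF d] by blast
  have "AE x in Omega. (\<lambda>k. v (r k) x) \<longlonglongrightarrow> v' x"
    using r(2)
  proof eventually_elim
    case (elim x)
    from tendsto_diff[OF tendsto_const[of "v' x"] this] show ?case by simp
  qed
  with r(1) show thesis by (rule that)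
qed

text \<open>Fatou's lemma for real-valued functions. Allowing the bounds to vary with \<open>k\<close> lets the limit inherit a
  bound that is itself only a limit, such as a convergent sequence of Dirichlet integrals.\<close>

lemma Fatou_bound:
  fixes f :: "nat \<Rightarrow> 'a \<Rightarrow> real"
  assumes "\<And>k. integrable M (f k)" "\<And>k x. f k x \<ge> 0" "g \<in> borel_measurable M"
    and "AE x in M. (\<lambda>k. f k x) \<longlonglongrightarrow> g x" "(\<lambda>k. b k) \<longlonglongrightarrow> (C::real)"
    and "\<And>k. integral\<^sup>L M (f k) \<le> b k"
  shows "integrable M g \<and> integral\<^sup>L M g \<le> C"
proof -
  have [measurable]: "f k \<in> borel_measurable M" for k using assms(1) by auto
  have g0: "AE x in M. g x \<ge> 0"
    using assms(4) by eventually_elim (rule LIMSEQ_le_const, auto simp: assms(2))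
  have b0: "b k \<ge> 0" for k using order_trans[OF Bochner_Integration.integral_nonneg assms(6)] assms(2) by blast
  have C0: "C \<ge> 0" using LIMSEQ_le_const[OF assms(5)] b0 by blast
  have "(\<integral>\<^sup>+x. ennreal (g x) \<partial>M) = (\<integral>\<^sup>+x. liminf (\<lambda>k. ennreal (f k x)) \<partial>M)"
  proof (rule nn_integral_cong_AE)
    show "AE x in M. ennreal (g x) = liminf (\<lambda>k. ennreal (f k x))"
      using assms(4) by eventually_elim (metis lim_imp_Liminf sequentially_bot tendsto_ennrealI)
  qed
  also have "\<dots> \<le> liminf (\<lambda>k. \<integral>\<^sup>+x. ennreal (f k x) \<partial>M)"
    by (rule nn_integral_liminf) auto
  also have "\<dots> = liminf (\<lambda>k. ennreal (integral\<^sup>L M (f k)))"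
    using assms by (intro arg_cong[of _ _ liminf] ext nn_integral_eq_integral) auto
  also have "\<dots> \<le> liminf (\<lambda>k. ennreal (b k))"
    by (intro Liminf_mono) (intro always_eventually allI ennreal_leI assms(6))
  also have "\<dots> = ennreal C"
    using assms(5) by (metis lim_imp_Liminf sequentially_bot tendsto_ennrealI)
  finally have le: "(\<integral>\<^sup>+x. ennreal (g x) \<partial>M) \<le> ennreal C" .
  have i: "integrable M g"
  proof (rule integrableI_nonneg[OF assms(3) g0])
    show "(\<integral>\<^sup>+x. ennreal (g x) \<partial>M) < \<infinity>" using le by (metis ennreal_less_top infinity_ennreal_def order_le_less_trans)
  qed
  have "ennreal (integral\<^sup>L M g) \<le> ennreal C" using le nn_integral_eq_integral[OF i g0] by simp
  then show ?thesis using i C0 by (simp add: ennreal_le_iff)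
qed

text \<open>The theorem of Riesz and Fischer. On a space of measure one the sequence is also Cauchy in \<open>L\<^sup>1\<close>, so a
  subsequence converges almost everywhere, and Fatou's lemma turns the Cauchy estimate into an estimate for
  the distance to the limit.\<close>

lemma L2_complete:
  fixes v :: "nat \<Rightarrow> real \<Rightarrow> real"
  assumes v: "\<And>k. v k \<in> L2" and e: "e \<longlonglongrightarrow> 0"
    and cauchy: "\<And>M N. M \<le> N \<Longrightarrow> nsq (\<lambda>x. v N x - v M x) \<le> e M"
  obtains g where "g \<in> L2" "(\<lambda>k. nsq (\<lambda>x. g x - v k x)) \<longlonglongrightarrow> 0"
proof -
  have d: "(\<lambda>x. v i x - v j x) \<in> L2" for i j using v L2_diff by blast
  have "\<exists>N. \<forall>i\<ge>N. \<forall>j\<ge>N. LINT x|Omega. norm (v i x - v j x) < \<epsilon>" if "\<epsilon> > 0" for \<epsilon> :: real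
  proof -
    have "eventually (\<lambda>k. e k < \<epsilon>\<^sup>2) sequentially" using e that by (intro order_tendstoD) auto
    then obtain N where N: "\<And>k. k \<ge> N \<Longrightarrow> e k < \<epsilon>\<^sup>2" by (auto simp: eventually_sequentially)
    have *: "(LINT x|Omega. norm (v i x - v j x)) < \<epsilon>" if "i \<ge> j" "j \<ge> N" for i j
    proof -
      have "(LINT x|Omega. norm (v i x - v j x)) \<le> sqrt (nsq (\<lambda>x. v i x - v j x))"
        using L1_norm_le_nsq[OF d] by simp
      also have "\<dots> < \<epsilon>"
        using cauchy[OF that(1)] N[OF that(2)] \<open>\<epsilon> > 0\<close> by (intro real_less_lsqrt) auto
      finally show ?thesis .
    qed
    have "(LINT x|Omega. norm (v i x - v j x)) < \<epsilon>" if "i \<ge> N" "j \<ge> N" for i j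
    proof (cases "i \<ge> j")
      case False
      then have "(LINT x|Omega. norm (v j x - v i x)) < \<epsilon>" by (intro *) (use that in auto)
      then show ?thesis by (subst norm_minus_commute)
    qed (use * that in auto)
    then show ?thesis by blast
  qed
  then obtain r where r: "strict_mono r" "AE x in Omega. Cauchy (\<lambda>i. v (r i) x)"
    using cauchy_L1_AE_cauchy_subseq[of Omega v, OF L2_integrable[OF v]] by blast
  define g where "g x = lim (\<lambda>i. v (r i) x)" for x
  have gm: "g \<in> borel_measurable Omega"
    unfolding g_def by (intro borel_measurable_lim_metric) (use v L2D in auto)
  have lim: "AE x in Omega. (\<lambda>i. v (r i) x) \<longlonglongrightarrow> g x"
    using r(2) by eventually_elim (simp add: g_def Cauchy_convergent convergent_LIMSEQ_iff[symmetric])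
  have b: "integrable Omega (\<lambda>x. (g x - v k x)\<^sup>2) \<and> nsq (\<lambda>x. g x - v k x) \<le> e k" for k
  proof (rule Fatou_bound[where b = "\<lambda>_. e k" and f = "\<lambda>i x. (v (r (i + k)) x - v k x)\<^sup>2"])
    show "AE x in Omega. (\<lambda>i. (v (r (i + k)) x - v k x)\<^sup>2) \<longlonglongrightarrow> (g x - v k x)\<^sup>2"
      using lim
    proof eventually_elim
      case (elim x)
      from LIMSEQ_ignore_initial_segment[OF this, of k] show ?case by (intro tendsto_intros)
    qed
    show "integrable Omega (\<lambda>x. (v (r (i + k)) x - v k x)\<^sup>2)" for i using d L2D by blast
    show "(LINT x|Omega. (v (r (i + k)) x - v k x)\<^sup>2) \<le> e k" for i
      using cauchy[of k "r (i + k)"] seq_suble[OF r(1), of "i + k"] by simp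
    show "(\<lambda>x. (g x - v k x)\<^sup>2) \<in> borel_measurable Omega" using gm v[of k] L2D by (auto intro: borel_measurable_diff borel_measurable_power)
  qed auto
  have "(\<lambda>x. g x - v 0 x) \<in> L2" using b[of 0] borel_measurable_diff[OF gm L2D(1)[OF v[of 0]]] unfolding L2_def by blast
  from L2_add[OF this v[of 0]] have "g \<in> L2" by simp
  moreover have "(\<lambda>k. nsq (\<lambda>x. g x - v k x)) \<longlonglongrightarrow> 0"
    by (rule tendsto_sandwich[OF _ _ tendsto_const e]) (simp_all add: b)
  ultimately show thesis by (rule that)
qed

section \<open>Hardy's inequality and the closure of the test functions\<close>


lemma integrable_Omega_compact_support:
  fixes f :: "real \<Rightarrow> real"
  assumes cd: "0 < c" "d < 1" and f: "continuous_on {c..d} f"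
    and z: "\<And>x. x \<in> {0<..<1} \<Longrightarrow> x \<notin> {c..d} \<Longrightarrow> f x = 0"
  shows "integrable Omega f" and "(LINT x|Omega. f x) = (LBINT x. indicator {c..d} x *\<^sub>R f x)"
proof -
  have eq: "indicator {0<..<1} x *\<^sub>R f x = indicator {c..d} x *\<^sub>R f x" for x
    using z cd by (auto simp: indicator_def)
  have "integrable lborel (\<lambda>x. indicator {c..d} x *\<^sub>R f x)"
    using borel_integrable_atLeastAtMost'[OF f] by (simp add: set_integrable_def)
  moreover from borel_measurable_integrable[OF this]
  have m: "(\<lambda>x. indicator {c..d} x *\<^sub>R f x) \<in> borel_measurable borel" by simp
  ultimately show "integrable Omega f"
    by (subst integrable_restrict_space) (simp, simp only: eq, simp add: integrable_completion)
  show "(LINT x|Omega. f x) = (LBINT x. indicator {c..d} x *\<^sub>R f x)"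
    by (subst integral_restrict_space) (simp, simp only: eq, rule integral_completion, use m in simp)
qed

lemma test_fun_support:
  assumes "test_fun 0 1 \<psi>"
  obtains c d where "0 < c" "c < d" "d < 1" "\<And>x. x \<le> c \<or> d \<le> x \<Longrightarrow> \<psi> x = 0 \<and> deriv \<psi> x = 0"
proof -
  obtain c d where cd: "0 < c" "d < 1" "\<And>x. x \<notin> {c..d} \<Longrightarrow> \<psi> x = 0"
    using assms by (auto simp: test_fun_def)
  define c' d' where "c' = min c (1/2) / 2" and "d' = (max d (1/2) + 1) / 2"
  have b: "0 < c'" "c' < d'" "d' < 1" "c' < c" "d < d'"
    using cd by (auto simp: c'_def d'_def min_def max_def)
  have "deriv \<psi> x = 0" if "x < c \<or> d < x" for x
  proof (rule DERIV_imp_deriv)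
    have "((\<lambda>_. 0) has_real_derivative 0) (at x)" by simp
    then show "(\<psi> has_real_derivative 0) (at x)"
      by (rule has_field_derivative_transform_within_open[where S = "- {c..d}"])
         (use that cd in auto)
  qed
  then show thesis using b cd by (intro that[of c' d']) auto
qed

lemma continuous_imp_L2:
  assumes "continuous_on UNIV f" shows "f \<in> L2"
proof -
  have c: "continuous_on {0..1} (\<lambda>x. (f x)\<^sup>2)"
    using assms by (intro continuous_intros continuous_on_subset[OF assms]) auto
  have "integrable lebesgue (\<lambda>x. indicator {0..1} x *\<^sub>R (f x)\<^sup>2)"
    using borel_integrable_atLeastAtMost'[OF c] unfolding set_integrable_def
    by (subst integrable_completion) (use borel_measurable_continuous_on_indicator[OF _ c] in auto)
  then have "integrable lebesgue (\<lambda>x. indicator {0<..<1} x *\<^sub>R (indicator {0..1} x *\<^sub>R (f x)\<^sup>2))"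
    by (rule integrable_mult_indicator[rotated]) auto
  also have "(\<lambda>x. indicator {0<..<1} x *\<^sub>R (indicator {0..1} x *\<^sub>R (f x)\<^sup>2)) = (\<lambda>x. indicator {0<..<1} x *\<^sub>R (f x)\<^sup>2)"
    by (auto simp: indicator_def)
  finally have "integrable Omega (\<lambda>x. (f x)\<^sup>2)" by (subst integrable_restrict_space) auto
  moreover have "f \<in> borel_measurable Omega"
    using assms by (intro continuous_imp_measurable_on_sets_lebesgue) (auto intro: continuous_on_subset)
  ultimately show ?thesis by (simp add: L2_def)
qed

lemma test_fun_smooth: "test_fun a b \<psi> \<Longrightarrow> smooth \<psi>"
  by (simp add: test_fun_iff_smooth)

lemma test_fun_L2: "test_fun 0 1 \<psi> \<Longrightarrow> \<psi> \<in> L2" "test_fun 0 1 \<psi> \<Longrightarrow> deriv \<psi> \<in> L2"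
  using continuous_imp_L2 test_fun_smooth smooth_continuous smooth_deriv by metis+

lemma test_fun_lincomb:
  assumes "test_fun l r \<psi>" "test_fun l r \<eta>"
  shows "test_fun l r (\<lambda>x. a * \<psi> x + b * \<eta> x)"
    and "deriv (\<lambda>x. a * \<psi> x + b * \<eta> x) = (\<lambda>x. a * deriv \<psi> x + b * deriv \<eta> x)"
proof -
  obtain c d c' d' where s: "l < c" "d < r" "l < c'" "d' < r"
    "\<And>x. x \<notin> {c..d} \<Longrightarrow> \<psi> x = 0" "\<And>x. x \<notin> {c'..d'} \<Longrightarrow> \<eta> x = 0"
    using assms unfolding test_fun_def by blast
  have "a * \<psi> x + b * \<eta> x = 0" if "x \<notin> {min c c'..max d d'}" for x
  proof -
    have "x \<notin> {c..d}" "x \<notin> {c'..d'}" using that by auto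
    then show ?thesis using s(5,6) by simp
  qed
  then show "test_fun l r (\<lambda>x. a * \<psi> x + b * \<eta> x)"
    unfolding test_fun_iff_smooth
    using s(1-4) assms[THEN test_fun_smooth]
    by (intro conjI smooth_add smooth_cmult exI[of _ "min c c'"] exI[of _ "max d d'"]) auto
  show "deriv (\<lambda>x. a * \<psi> x + b * \<eta> x) = (\<lambda>x. a * deriv \<psi> x + b * deriv \<eta> x)"
    using assms[THEN test_fun_smooth]
    by (intro ext DERIV_imp_deriv DERIV_add DERIV_cmult smooth_has_deriv)
qed

lemma ip_test_fun_by_parts:
  assumes "test_fun 0 1 \<psi>" "test_fun 0 1 \<eta>"
  shows "ip \<psi> (deriv \<eta>) = - ip (deriv \<psi>) \<eta>"
proof -
  obtain c d where cd: "0 < c" "c < d" "d < 1" "\<And>x. x \<le> c \<or> d \<le> x \<Longrightarrow> \<psi> x = 0 \<and> deriv \<psi> x = 0"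
    using test_fun_support[OF assms(1)] by blast
  note sm = assms[THEN test_fun_smooth]
  have cont: "continuous_on {c..d} (\<lambda>x. \<psi> x * deriv \<eta> x + deriv \<psi> x * \<eta> x)"
    by (intro continuous_intros smooth_continuous smooth_deriv sm)
  have "(LINT x|Omega. \<psi> x * deriv \<eta> x + deriv \<psi> x * \<eta> x)
    = (LBINT x. indicator {c..d} x *\<^sub>R (\<psi> x * deriv \<eta> x + deriv \<psi> x * \<eta> x))"
    using cd by (intro integrable_Omega_compact_support(2) cont) auto
  also have "\<dots> = \<psi> d * \<eta> d - \<psi> c * \<eta> c"
  proof (rule integral_FTC_atLeastAtMost[OF _ _ cont, of "\<lambda>x. \<psi> x * \<eta> x"])
    show "((\<lambda>x. \<psi> x * \<eta> x) has_vector_derivative \<psi> x * deriv \<eta> x + deriv \<psi> x * \<eta> x) (at x within {c..d})" for x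
      using has_field_derivative_at_within[OF DERIV_mult'[OF smooth_has_deriv[OF sm(1)] smooth_has_deriv[OF sm(2)]]]
      by (simp add: has_real_derivative_iff_has_vector_derivative)
  qed (use cd in auto)
  also have "\<dots> = 0" using cd(4)[of c] cd(4)[of d] by simp
  finally show ?thesis
    using L2_mult_integrable[OF test_fun_L2(1)[OF assms(1)] test_fun_L2(2)[OF assms(2)]]
      L2_mult_integrable[OF test_fun_L2(2)[OF assms(1)] test_fun_L2(1)[OF assms(2)]]
    by (simp add: ip_def)
qed

text \<open>Integrate the inequality \<open>0 \<le> (\<psi>' - \<psi>/(2x))\<^sup>2\<close>. The mixed term is \<open>\<psi>\<psi>'/x\<close>, and
  \<open>F = \<psi>\<psi>'/x - \<psi>\<^sup>2/(2x\<^sup>2)\<close> is the derivative of \<open>\<psi>\<^sup>2/(2x)\<close>, which vanishes at both ends; what remains is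
  \<open>\<integral>\<psi>'\<^sup>2 - (1/4)\<integral>\<psi>\<^sup>2/x\<^sup>2\<close>.\<close>

lemma Hardy_test_fun:
  assumes "test_fun 0 1 \<psi>"
  shows "integrable Omega (\<lambda>x. (\<psi> x)\<^sup>2 / x\<^sup>2)" and "(LINT x|Omega. (\<psi> x)\<^sup>2 / x\<^sup>2) \<le> 4 * nsq (deriv \<psi>)"
proof -
  obtain c d where cd: "0 < c" "c < d" "d < 1" "\<And>x. x \<le> c \<or> d \<le> x \<Longrightarrow> \<psi> x = 0 \<and> deriv \<psi> x = 0"
    using test_fun_support[OF assms(1)] by blast
  note sm = test_fun_smooth[OF assms]
  have pos: "x \<noteq> 0" if "x \<in> {c..d}" for x using that cd by auto
  define F where "F x = \<psi> x * deriv \<psi> x / x - (\<psi> x)\<^sup>2 / (2 * x\<^sup>2)" for x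
  have cont: "continuous_on {c..d} F" "continuous_on {c..d} (\<lambda>x. (\<psi> x)\<^sup>2 / x\<^sup>2)"
    unfolding F_def using pos by (intro continuous_intros smooth_continuous smooth_deriv sm; fastforce)+
  show i: "integrable Omega (\<lambda>x. (\<psi> x)\<^sup>2 / x\<^sup>2)"
    using cd by (intro integrable_Omega_compact_support(1)[OF _ _ cont(2)]) auto
  have Fi: "integrable Omega F"
    using cd by (intro integrable_Omega_compact_support(1)[OF _ _ cont(1)]) (auto simp: F_def)
  have "(LINT x|Omega. F x) = (LBINT x. indicator {c..d} x *\<^sub>R F x)"
    using cd by (intro integrable_Omega_compact_support(2)[OF _ _ cont(1)]) (auto simp: F_def)
  also have "\<dots> = (\<psi> d)\<^sup>2 / (2 * d) - (\<psi> c)\<^sup>2 / (2 * c)"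
  proof (rule integral_FTC_atLeastAtMost[OF _ _ cont(1)])
    fix x assume "c \<le> x" "x \<le> d"
    then have x: "x \<noteq> 0" using cd by auto
    have "((\<lambda>x. (\<psi> x)\<^sup>2 / (2 * x)) has_real_derivative F x) (at x)"
      using x unfolding F_def
      by (auto intro!: derivative_eq_intros smooth_has_deriv[OF sm] simp: power2_eq_square field_simps)
    then show "((\<lambda>x. (\<psi> x)\<^sup>2 / (2 * x)) has_vector_derivative F x) (at x within {c..d})"
      using has_field_derivative_at_within by (fastforce simp flip: has_real_derivative_iff_has_vector_derivative)
  qed (use cd in auto)
  also have "\<dots> = 0" using cd(4)[of c] cd(4)[of d] by simp
  finally have F0: "(LINT x|Omega. F x) = 0" .
  have di: "integrable Omega (\<lambda>x. (deriv \<psi> x)\<^sup>2)" using test_fun_L2(2)[OF assms] L2D by blast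
  have "0 \<le> (LINT x|Omega. (deriv \<psi> x)\<^sup>2 - F x - ((\<psi> x)\<^sup>2 / x\<^sup>2) / 4)"
  proof (rule Bochner_Integration.integral_nonneg)
    fix x :: real assume "x \<in> space Omega"
    then have "x \<noteq> 0" by auto
    then have "(deriv \<psi> x)\<^sup>2 - F x - ((\<psi> x)\<^sup>2 / x\<^sup>2) / 4 = (deriv \<psi> x - \<psi> x / (2 * x))\<^sup>2"
      unfolding F_def by (simp add: power2_eq_square field_simps)
    then show "0 \<le> (deriv \<psi> x)\<^sup>2 - F x - ((\<psi> x)\<^sup>2 / x\<^sup>2) / 4" by simp
  qed
  also have "\<dots> = (LINT x|Omega. (deriv \<psi> x)\<^sup>2 - F x) - (LINT x|Omega. ((\<psi> x)\<^sup>2 / x\<^sup>2) / 4)"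
    by (intro Bochner_Integration.integral_diff Bochner_Integration.integrable_diff di Fi integrable_divide i)
  also have "\<dots> = nsq (deriv \<psi>) - (LINT x|Omega. (\<psi> x)\<^sup>2 / x\<^sup>2) / 4"
    by (subst Bochner_Integration.integral_diff[OF di Fi]) (simp only: F0 integral_divide_zero diff_0_right)
  finally show "(LINT x|Omega. (\<psi> x)\<^sup>2 / x\<^sup>2) \<le> 4 * nsq (deriv \<psi>)" by simp
qed

text \<open>The closure of the graph of differentiation on test functions. Working with pairs \<open>(v,g)\<close> avoids the
  representative \<open>wderiv v\<close>, which is chosen arbitrarily in its class and is linear only up to null sets;
  the two lemmas relating this graph to \<open>H01\<close> show that \<open>g\<close> is that representative almost everywhere.\<close>

definition H01_graph :: "(real \<Rightarrow> real) \<Rightarrow> (real \<Rightarrow> real) \<Rightarrow> bool" where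
  "H01_graph v g \<longleftrightarrow> v \<in> L2 \<and> g \<in> L2 \<and>
     (\<forall>\<epsilon>>0. \<exists>\<psi>. test_fun 0 1 \<psi> \<and> nsq (\<lambda>x. v x - \<psi> x) + nsq (\<lambda>x. g x - deriv \<psi> x) < \<epsilon>)"

lemma H01_graph_approx:
  assumes "H01_graph v g"
  obtains \<psi> where "\<And>k. test_fun 0 1 (\<psi> k)" "(\<lambda>k::nat. nsq (\<lambda>x. v x - \<psi> k x)) \<longlonglongrightarrow> 0"
    "(\<lambda>k. nsq (\<lambda>x. g x - deriv (\<psi> k) x)) \<longlonglongrightarrow> 0"
proof -
  have "\<exists>\<psi>. test_fun 0 1 \<psi> \<and> nsq (\<lambda>x. v x - \<psi> x) + nsq (\<lambda>x. g x - deriv \<psi> x) < inverse (real (Suc k))" for k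
    using assms unfolding H01_graph_def by simp
  then obtain \<psi> where \<psi>: "\<And>k. test_fun 0 1 (\<psi> k)"
    "\<And>k. nsq (\<lambda>x. v x - \<psi> k x) + nsq (\<lambda>x. g x - deriv (\<psi> k) x) < inverse (real (Suc k))"
    using choice[of "\<lambda>k \<psi>. test_fun 0 1 \<psi> \<and> nsq (\<lambda>x. v x - \<psi> x) + nsq (\<lambda>x. g x - deriv \<psi> x) < inverse (real (Suc k))"]
    by blast
  have "nsq (\<lambda>x. v x - \<psi> k x) \<le> inverse (real (Suc k)) \<and> nsq (\<lambda>x. g x - deriv (\<psi> k) x) \<le> inverse (real (Suc k))" for k
    using \<psi>(2)[of k] nsq_nonneg[of "\<lambda>x. v x - \<psi> k x"] nsq_nonneg[of "\<lambda>x. g x - deriv (\<psi> k) x"] by linarith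
  then have le: "nsq (\<lambda>x. v x - \<psi> k x) \<le> inverse (real (Suc k))"
    "nsq (\<lambda>x. g x - deriv (\<psi> k) x) \<le> inverse (real (Suc k))" for k by blast+
  have lim: "z \<longlonglongrightarrow> 0" if "\<And>k. 0 \<le> z k" "\<And>k. z k \<le> inverse (real (Suc k))" for z :: "nat \<Rightarrow> real"
    by (rule tendsto_sandwich[OF _ _ tendsto_const LIMSEQ_inverse_real_of_nat])
       (use that in \<open>auto intro!: always_eventually\<close>)
  show thesis
    by (rule that[OF \<psi>(1) lim[OF nsq_nonneg le(1)] lim[OF nsq_nonneg le(2)]])
qed

lemma H01_graph_weak_deriv:
  assumes "H01_graph v g" shows "weak_deriv v g"
  unfolding weak_deriv_def
proof (intro allI impI)
  fix \<eta> assume \<eta>: "test_fun 0 1 \<eta>"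
  obtain \<psi> where \<psi>: "\<And>k. test_fun 0 1 (\<psi> k)" "(\<lambda>k::nat. nsq (\<lambda>x. v x - \<psi> k x)) \<longlonglongrightarrow> 0"
    "(\<lambda>k. nsq (\<lambda>x. g x - deriv (\<psi> k) x)) \<longlonglongrightarrow> 0"
    using H01_graph_approx[OF assms] by blast
  have vg: "v \<in> L2" "g \<in> L2" using assms by (auto simp: H01_graph_def)
  have "(\<lambda>k. ip (\<psi> k) (deriv \<eta>)) \<longlonglongrightarrow> ip v (deriv \<eta>)"
    using vg \<eta> by (intro L2_tendsto_ip test_fun_L2(1)[OF \<psi>(1)] \<psi>(2) test_fun_L2(2))
  moreover have "(\<lambda>k. - ip (deriv (\<psi> k)) \<eta>) \<longlonglongrightarrow> - ip g \<eta>"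
    by (intro tendsto_minus L2_tendsto_ip test_fun_L2(2)[OF \<psi>(1)] \<psi>(3) vg test_fun_L2(1)[OF \<eta>])
  ultimately show "ip v (deriv \<eta>) = - ip g \<eta>"
    using ip_test_fun_by_parts[OF \<psi>(1) \<eta>] LIMSEQ_unique by simp
qed

text \<open>A sequence of test functions converging to \<open>v\<close> in \<open>L\<^sup>2\<close> converges almost everywhere along a subsequence, and
  Fatou's lemma carries Hardy's inequality over to the limit.\<close>

lemma Hardy:
  assumes "H01_graph v g"
  shows "integrable Omega (\<lambda>x. (v x)\<^sup>2 / x\<^sup>2) \<and> (LINT x|Omega. (v x)\<^sup>2 / x\<^sup>2) \<le> 4 * nsq g"
proof -
  obtain \<psi> where \<psi>: "\<And>k. test_fun 0 1 (\<psi> k)" "(\<lambda>k::nat. nsq (\<lambda>x. v x - \<psi> k x)) \<longlonglongrightarrow> 0"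
    "(\<lambda>k. nsq (\<lambda>x. g x - deriv (\<psi> k) x)) \<longlonglongrightarrow> 0"
    using H01_graph_approx[OF assms] by blast
  have vg: "v \<in> L2" "g \<in> L2" using assms by (auto simp: H01_graph_def)
  obtain r :: "nat \<Rightarrow> nat" where r: "strict_mono r" "AE x in Omega. (\<lambda>k. \<psi> (r k) x) \<longlonglongrightarrow> v x"
    using L2_tendsto_AE_subseq[OF test_fun_L2(1)[OF \<psi>(1)] vg(1) \<psi>(2)] by blast
  have "(\<lambda>k. nsq (deriv (\<psi> k))) \<longlonglongrightarrow> nsq g"
    by (intro L2_tendsto_nsq test_fun_L2(2)[OF \<psi>(1)] \<psi>(3) vg)
  from tendsto_mult[OF tendsto_const[of 4] LIMSEQ_subseq_LIMSEQ[OF this r(1)]]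
  have lim: "(\<lambda>k. 4 * nsq (deriv (\<psi> (r k)))) \<longlonglongrightarrow> 4 * nsq g" by (simp add: o_def)
  show ?thesis
  proof (rule Fatou_bound[where f = "\<lambda>k x. (\<psi> (r k) x)\<^sup>2 / x\<^sup>2", OF _ _ _ _ lim])
    show "AE x in Omega. (\<lambda>k. (\<psi> (r k) x)\<^sup>2 / x\<^sup>2) \<longlonglongrightarrow> (v x)\<^sup>2 / x\<^sup>2"
      using r(2) AE_space
    proof eventually_elim
      case (elim x)
      then show ?case by (intro tendsto_intros) auto
    qed
    have "(\<lambda>x. x) \<in> borel_measurable Omega" by (intro continuous_imp_measurable_on_sets_lebesgue) auto
    then show "(\<lambda>x. (v x)\<^sup>2 / x\<^sup>2) \<in> borel_measurable Omega"
      using L2D(1)[OF vg(1)] by measurable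
  qed (use Hardy_test_fun[OF \<psi>(1)] in auto)
qed

lemma weak_deriv_unique:
  assumes "g \<in> L2" "g' \<in> L2" "weak_deriv v g" "weak_deriv v g'"
  shows "AE x in Omega. g x = g' x"
proof -
  have "AE x in Omega. g x - g' x = 0"
  proof (rule fundamental_lemma_calculus_of_variations)
    show "integrable Omega (\<lambda>x. g x - g' x)" using assms L2_diff L2_integrable by blast
    fix \<psi> assume \<psi>: "test_fun 0 1 \<psi>"
    then have "ip g \<psi> = ip g' \<psi>" using assms(3,4) unfolding weak_deriv_def by fastforce
    then show "(LINT x|Omega. \<psi> x * (g x - g' x)) = 0"
      using ip_diff_left[OF assms(1,2) test_fun_L2(1)[OF \<psi>]] by (simp add: ip_def mult.commute)
  qed
  then show ?thesis by simp
qed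

text \<open>Weak derivatives are unique up to null sets, so replacing \<open>g\<close> by the chosen representative changes no
  integral.\<close>

lemma H01_graph_imp_H01:
  assumes "H01_graph v g" shows "v \<in> H01" and "AE x in Omega. wderiv v x = g x"
proof -
  have vg: "v \<in> L2" "g \<in> L2" "weak_deriv v g"
    using assms H01_graph_weak_deriv by (auto simp: H01_graph_def)
  have w: "wderiv v \<in> L2 \<and> weak_deriv v (wderiv v)"
    unfolding wderiv_def by (rule someI[of _ g]) (use vg in auto)
  show AE: "AE x in Omega. wderiv v x = g x" using weak_deriv_unique w vg by blast
  have eq: "nsq (\<lambda>x. wderiv v x - deriv \<psi> x) = nsq (\<lambda>x. g x - deriv \<psi> x)" if "test_fun 0 1 \<psi>" for \<psi>
    by (intro integral_cong_AE borel_measurable_power L2D(1)[OF L2_diff] vg(2) test_fun_L2(2)[OF that] conjunct1[OF w])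
       (use AE in \<open>auto elim: eventually_mono\<close>)
  have "\<exists>\<psi>. test_fun 0 1 \<psi> \<and> nsq (\<lambda>x. v x - \<psi> x) + nsq (\<lambda>x. wderiv v x - deriv \<psi> x) < \<epsilon>" if e: "\<epsilon> > 0" for \<epsilon>
  proof -
    obtain \<psi> where "test_fun 0 1 \<psi>" "nsq (\<lambda>x. v x - \<psi> x) + nsq (\<lambda>x. g x - deriv \<psi> x) < \<epsilon>"
      using assms e unfolding H01_graph_def by blast
    then show ?thesis using eq by (intro exI[of _ \<psi>]) simp
  qed
  then show "v \<in> H01" using vg unfolding H01_def H1_def by blast
qed

lemma H01_imp_H01_graph: "v \<in> H01 \<Longrightarrow> H01_graph v (wderiv v)"
proof -
  assume v: "v \<in> H01"
  then obtain g where "g \<in> L2 \<and> weak_deriv v g" by (auto simp: H01_def H1_def)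
  then have "wderiv v \<in> L2 \<and> weak_deriv v (wderiv v)" unfolding wderiv_def by (rule someI[where P = "\<lambda>g. g \<in> L2 \<and> weak_deriv v g"])
  with v show ?thesis by (auto simp: H01_def H1_def H01_graph_def)
qed

lemma H01_graph_lincomb:
  assumes "H01_graph v g" "H01_graph w h"
  shows "H01_graph (\<lambda>x. a * v x + b * w x) (\<lambda>x. a * g x + b * h x)"
proof -
  have L: "v \<in> L2" "g \<in> L2" "w \<in> L2" "h \<in> L2" using assms by (auto simp: H01_graph_def)
  obtain \<psi> where \<psi>: "\<And>k. test_fun 0 1 (\<psi> k)" "(\<lambda>k::nat. nsq (\<lambda>x. v x - \<psi> k x)) \<longlonglongrightarrow> 0"
    "(\<lambda>k. nsq (\<lambda>x. g x - deriv (\<psi> k) x)) \<longlonglongrightarrow> 0"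
    using H01_graph_approx[OF assms(1)] by blast
  obtain \<eta> where \<eta>: "\<And>k. test_fun 0 1 (\<eta> k)" "(\<lambda>k::nat. nsq (\<lambda>x. w x - \<eta> k x)) \<longlonglongrightarrow> 0"
    "(\<lambda>k. nsq (\<lambda>x. h x - deriv (\<eta> k) x)) \<longlonglongrightarrow> 0"
    using H01_graph_approx[OF assms(2)] by blast
  have gen: "(\<lambda>k. nsq (\<lambda>x. (a * v x + b * w x) - (a * p k x + b * r k x))) \<longlonglongrightarrow> 0"
    if "v \<in> L2" "w \<in> L2" "\<And>k::nat. p k \<in> L2" "\<And>k. r k \<in> L2" "(\<lambda>k. nsq (\<lambda>x. v x - p k x)) \<longlonglongrightarrow> 0"
      "(\<lambda>k. nsq (\<lambda>x. w x - r k x)) \<longlonglongrightarrow> 0" for v w p r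
  proof (rule tendsto_sandwich[of "\<lambda>_. 0"])
    show "(\<lambda>k. 2 * (a\<^sup>2 * nsq (\<lambda>x. v x - p k x)) + 2 * (b\<^sup>2 * nsq (\<lambda>x. w x - r k x))) \<longlonglongrightarrow> 0"
      using tendsto_add[OF tendsto_mult_right_zero[OF tendsto_mult_right_zero[OF that(5)]]
        tendsto_mult_right_zero[OF tendsto_mult_right_zero[OF that(6)]]] by simp
    have "nsq (\<lambda>x. (a * v x + b * w x) - (a * p k x + b * r k x))
      \<le> 2 * (a\<^sup>2 * nsq (\<lambda>x. v x - p k x)) + 2 * (b\<^sup>2 * nsq (\<lambda>x. w x - r k x))" for k
      using nsq_add_le[OF L2_cmult[OF L2_diff[OF that(1) that(3)[of k]]] L2_cmult[OF L2_diff[OF that(2) that(4)[of k]]], of a b]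
      by (simp add: power_mult_distrib flip: right_diff_distrib) (simp add: algebra_simps)
    then show "\<forall>\<^sub>F k in sequentially. nsq (\<lambda>x. (a * v x + b * w x) - (a * p k x + b * r k x))
      \<le> 2 * (a\<^sup>2 * nsq (\<lambda>x. v x - p k x)) + 2 * (b\<^sup>2 * nsq (\<lambda>x. w x - r k x))" by simp
  qed auto
  show ?thesis
    unfolding H01_graph_def
  proof (intro conjI L2_lincomb L allI impI)
    fix \<epsilon> :: real assume "\<epsilon> > 0"
    have "(\<lambda>k. nsq (\<lambda>x. (a * v x + b * w x) - (a * \<psi> k x + b * \<eta> k x))
        + nsq (\<lambda>x. (a * g x + b * h x) - (a * deriv (\<psi> k) x + b * deriv (\<eta> k) x))) \<longlonglongrightarrow> 0 + 0"
      by (intro tendsto_add gen L test_fun_L2 \<psi> \<eta>)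
    then have "eventually (\<lambda>k. nsq (\<lambda>x. (a * v x + b * w x) - (a * \<psi> k x + b * \<eta> k x))
        + nsq (\<lambda>x. (a * g x + b * h x) - (a * deriv (\<psi> k) x + b * deriv (\<eta> k) x)) < \<epsilon>) sequentially"
      using \<open>\<epsilon> > 0\<close> by (intro order_tendstoD) auto
    then obtain k where "nsq (\<lambda>x. (a * v x + b * w x) - (a * \<psi> k x + b * \<eta> k x))
        + nsq (\<lambda>x. (a * g x + b * h x) - (a * deriv (\<psi> k) x + b * deriv (\<eta> k) x)) < \<epsilon>"
      by (auto simp: eventually_sequentially)
    then show "\<exists>\<psi>. test_fun 0 1 \<psi> \<and> nsq (\<lambda>x. (a * v x + b * w x) - \<psi> x) + nsq (\<lambda>x. (a * g x + b * h x) - deriv \<psi> x) < \<epsilon>"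
      using test_fun_lincomb[OF \<psi>(1)[of k] \<eta>(1)[of k], of a b]
      by (intro exI[of _ "\<lambda>x. a * \<psi> k x + b * \<eta> k x"]) auto
  qed
qed

lemma H01_graph_sum:
  assumes "finite I" "\<And>i. i \<in> I \<Longrightarrow> H01_graph (v i) (g i)"
  shows "H01_graph (\<lambda>x. \<Sum>i\<in>I. c i * v i x) (\<lambda>x. \<Sum>i\<in>I. c i * g i x)"
  using assms
proof (induction I rule: finite_induct)
  case empty
  have "test_fun 0 1 (\<lambda>_. 0)"
    by (auto simp: test_fun_iff_smooth smooth_def times_diff_const intro!: exI[of _ "1/2"])
  then show ?case
    by (auto simp: H01_graph_def L2_zero intro!: exI[of _ "\<lambda>_. 0"])
next
  case (insert i I)
  have "H01_graph (\<lambda>x. c i * v i x + 1 * (\<Sum>i\<in>I. c i * v i x)) (\<lambda>x. c i * g i x + 1 * (\<Sum>i\<in>I. c i * g i x))"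
    by (rule H01_graph_lincomb) (use insert in auto)
  then show ?case using insert by simp
qed

lemma H01_graph_closed:
  assumes "\<And>k::nat. H01_graph (v k) (g k)" "v' \<in> L2" "g' \<in> L2"
    and "(\<lambda>k. nsq (\<lambda>x. v' x - v k x)) \<longlonglongrightarrow> 0" "(\<lambda>k. nsq (\<lambda>x. g' x - g k x)) \<longlonglongrightarrow> 0"
  shows "H01_graph v' g'"
  unfolding H01_graph_def
proof (intro conjI assms allI impI)
  fix \<epsilon> :: real assume e: "\<epsilon> > 0"
  have L: "v k \<in> L2" "g k \<in> L2" for k using assms(1) by (auto simp: H01_graph_def)
  have "(\<lambda>k. nsq (\<lambda>x. v' x - v k x) + nsq (\<lambda>x. g' x - g k x)) \<longlonglongrightarrow> 0 + 0"
    by (intro tendsto_add assms)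
  then have "eventually (\<lambda>k. nsq (\<lambda>x. v' x - v k x) + nsq (\<lambda>x. g' x - g k x) < \<epsilon> / 4) sequentially"
    using e by (intro order_tendstoD) auto
  then obtain k where k: "nsq (\<lambda>x. v' x - v k x) + nsq (\<lambda>x. g' x - g k x) < \<epsilon> / 4"
    by (auto simp: eventually_sequentially)
  obtain \<psi> where \<psi>: "test_fun 0 1 \<psi>" "nsq (\<lambda>x. v k x - \<psi> x) + nsq (\<lambda>x. g k x - deriv \<psi> x) < \<epsilon> / 4"
    using assms(1)[of k] e unfolding H01_graph_def by (meson zero_less_divide_iff zero_less_numeral)
  have "nsq (\<lambda>x. v' x - \<psi> x) \<le> 2 * nsq (\<lambda>x. v' x - v k x) + 2 * nsq (\<lambda>x. v k x - \<psi> x)"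
    using nsq_add_le[OF L2_diff[OF assms(2) L(1)[of k]] L2_diff[OF L(1)[of k] test_fun_L2(1)[OF \<psi>(1)]]] by simp
  moreover have "nsq (\<lambda>x. g' x - deriv \<psi> x) \<le> 2 * nsq (\<lambda>x. g' x - g k x) + 2 * nsq (\<lambda>x. g k x - deriv \<psi> x)"
    using nsq_add_le[OF L2_diff[OF assms(3) L(2)[of k]] L2_diff[OF L(2)[of k] test_fun_L2(2)[OF \<psi>(1)]]] by simp
  ultimately show "\<exists>\<psi>. test_fun 0 1 \<psi> \<and> nsq (\<lambda>x. v' x - \<psi> x) + nsq (\<lambda>x. g' x - deriv \<psi> x) < \<epsilon>"
    using k \<psi> by (intro exI[of _ \<psi>]) linarith
qed

section \<open>The energy space in terms of eigenfunctions\<close>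


lemma H01_weighted_integrable:
  assumes "H01_graph v g" "H01_graph w h"
  shows "integrable Omega (\<lambda>x. v x * w x / x\<^sup>2)"
proof (rule Bochner_Integration.integrable_bound)
  show "integrable Omega (\<lambda>x. (v x)\<^sup>2 / x\<^sup>2 + (w x)\<^sup>2 / x\<^sup>2)"
    using Hardy[OF assms(1)] Hardy[OF assms(2)] by (intro Bochner_Integration.integrable_add) auto
  have "(\<lambda>x. x) \<in> borel_measurable Omega" by (intro continuous_imp_measurable_on_sets_lebesgue) auto
  moreover have "v \<in> borel_measurable Omega" "w \<in> borel_measurable Omega"
    using assms L2D by (auto simp: H01_graph_def)
  ultimately show "(\<lambda>x. v x * w x / x\<^sup>2) \<in> borel_measurable Omega" by measurable
  have "\<bar>a * b / c\<^sup>2\<bar> \<le> a\<^sup>2 / c\<^sup>2 + b\<^sup>2 / c\<^sup>2" for a b c :: real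
  proof -
    have "2 * \<bar>a * b\<bar> \<le> a\<^sup>2 + b\<^sup>2"
      using sum_squares_bound[of "\<bar>a\<bar>" "\<bar>b\<bar>"] by (simp add: abs_mult mult.assoc)
    then have "\<bar>a * b\<bar> \<le> a\<^sup>2 + b\<^sup>2" using abs_ge_zero[of "a * b"] by linarith
    then show ?thesis by (simp add: divide_right_mono flip: add_divide_distrib)
  qed
  then show "AE x in Omega. norm (v x * w x / x\<^sup>2) \<le> norm ((v x)\<^sup>2 / x\<^sup>2 + (w x)\<^sup>2 / x\<^sup>2)"
    by (auto simp del: abs_divide)
qed

text \<open>Hardy's inequality bounds the singular term by \<open>4\<mu>\<close> times the Dirichlet integral if \<open>\<mu>\<close> is positive; otherwise the
  singular term only helps.\<close>

lemma a_form_coercive: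
  assumes "H01_graph v g" "\<mu> < 1/4"
  shows "min 1 (1 - 4 * \<mu>) * nsq g \<le> nsq g - \<mu> * (LINT x|Omega. (v x)\<^sup>2 / x\<^sup>2)"
proof -
  define h where "h = (LINT x|Omega. (v x)\<^sup>2 / x\<^sup>2)"
  have h: "0 \<le> h" "h \<le> 4 * nsq g" using Hardy[OF assms(1)] by (auto simp: h_def)
  have "min 1 (1 - 4 * \<mu>) * nsq g \<le> nsq g - \<mu> * h"
  proof (cases "\<mu> \<le> 0")
    case True
    then have "\<mu> * h \<le> 0" using h by (simp add: mult_nonpos_nonneg)
    then show ?thesis using True by (simp add: min_def)
  next
    case False
    then have "\<mu> * h \<le> \<mu> * (4 * nsq g)" using h by (intro mult_left_mono) auto
    then show ?thesis using False by (simp add: min_def algebra_simps)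
  qed
  then show ?thesis by (simp add: h_def)
qed

lemma integral_square_sum:
  fixes f :: "nat \<Rightarrow> real \<Rightarrow> real"
  assumes "\<And>i j. i \<in> I \<Longrightarrow> j \<in> I \<Longrightarrow> integrable M (\<lambda>x. f i x * f j x * \<rho> x)"
  shows "(LINT x|M. (\<Sum>i\<in>I. c i * f i x)\<^sup>2 * \<rho> x)
    = (\<Sum>i\<in>I. \<Sum>j\<in>I. c i * c j * (LINT x|M. f i x * f j x * \<rho> x))"
proof -
  have "(\<Sum>i\<in>I. c i * f i x)\<^sup>2 * \<rho> x = (\<Sum>i\<in>I. \<Sum>j\<in>I. c i * c j * (f i x * f j x * \<rho> x))" for x
    unfolding power2_eq_square sum_product unfolding sum_distrib_right
    by (intro sum.cong refl) (simp add: mult_ac)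
  then show ?thesis
    by (simp add: Bochner_Integration.integral_sum assms)
qed

locale eigenbasis_of =
  fixes \<mu> :: real and \<phi> :: "nat \<Rightarrow> real \<Rightarrow> real" and lam :: "nat \<Rightarrow> real"
  assumes eb: "eigenbasis \<mu> \<phi> lam" and mu: "\<mu> < 1/4"
begin

lemma eigenfunction:
  assumes "n \<ge> 1"
  shows "\<phi> n \<in> H01" "H01_graph (\<phi> n) (wderiv (\<phi> n))" "\<phi> n \<in> L2" "wderiv (\<phi> n) \<in> L2"
proof -
  show h: "\<phi> n \<in> H01" using eb assms by (auto simp: eigenbasis_def L_op_def)
  show g: "H01_graph (\<phi> n) (wderiv (\<phi> n))" by (rule H01_imp_H01_graph[OF h])
  show "\<phi> n \<in> L2" "wderiv (\<phi> n) \<in> L2" using g by (auto simp: H01_graph_def)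
qed

lemma lam_pos: "n \<ge> 1 \<Longrightarrow> 0 < lam n"
  using eb unfolding eigenbasis_def by (meson less_le_trans order_refl)

lemma lam_ge: "n \<ge> 1 \<Longrightarrow> lam 1 \<le> lam n"
  using eb unfolding eigenbasis_def by (meson order_refl)

lemma orthonormal: "m \<ge> 1 \<Longrightarrow> n \<ge> 1 \<Longrightarrow> ip (\<phi> m) (\<phi> n) = (if m = n then 1 else 0)"
  using eb unfolding eigenbasis_def by blast

text \<open>The eigenfunction relation gives this with the arguments exchanged, and the form is symmetric.\<close>

lemma a_form_eigenfunction:
  assumes "w \<in> H01" "n \<ge> 1"
  shows "a_form \<mu> w (\<phi> n) = lam n * ip w (\<phi> n)"
proof -
  have "a_form \<mu> w (\<phi> n) = a_form \<mu> (\<phi> n) w" by (simp add: a_form_def mult.commute)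
  also have "\<dots> = ip (\<lambda>x. lam n * \<phi> n x) w"
    using eb assms by (auto simp: eigenbasis_def L_op_def)
  also have "\<dots> = lam n * ip w (\<phi> n)" by (simp add: ip_def mult.assoc mult.commute[of "w _"])
  finally show ?thesis .
qed

text \<open>The left-hand side is the quadratic form of the finite sum, written without the chosen weak derivative of
  that sum, so that it can be expanded bilinearly.\<close>

lemma energy_sum:
  assumes I: "finite I" "I \<subseteq> {1..}"
  shows "nsq (\<lambda>x. \<Sum>i\<in>I. c i * wderiv (\<phi> i) x) - \<mu> * (LINT x|Omega. (\<Sum>i\<in>I. c i * \<phi> i x)\<^sup>2 / x\<^sup>2)
    = (\<Sum>i\<in>I. lam i * (c i)\<^sup>2)"
proof -
  have i: "i \<in> I \<Longrightarrow> i \<ge> 1" for i using I by auto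
  have 1: "nsq (\<lambda>x. \<Sum>i\<in>I. c i * wderiv (\<phi> i) x)
      = (\<Sum>i\<in>I. \<Sum>j\<in>I. c i * c j * (LINT x|Omega. wderiv (\<phi> i) x * wderiv (\<phi> j) x))"
    using integral_square_sum[of I Omega "\<lambda>i. wderiv (\<phi> i)" "\<lambda>_. 1" c]
      L2_mult_integrable[OF eigenfunction(4) eigenfunction(4)] i by simp
  have 2: "(LINT x|Omega. (\<Sum>i\<in>I. c i * \<phi> i x)\<^sup>2 / x\<^sup>2)
      = (\<Sum>i\<in>I. \<Sum>j\<in>I. c i * c j * (LINT x|Omega. \<phi> i x * \<phi> j x / x\<^sup>2))"
    using integral_square_sum[of I Omega \<phi> "\<lambda>x. 1 / x\<^sup>2" c] H01_weighted_integrable[OF eigenfunction(2) eigenfunction(2)] i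
    by simp
  have a: "a_form \<mu> (\<phi> i) (\<phi> j) = (if i = j then lam i else 0)" if "i \<in> I" "j \<in> I" for i j
    using a_form_eigenfunction[OF eigenfunction(1)[OF i] i] orthonormal[OF i i] that by auto
  have "nsq (\<lambda>x. \<Sum>i\<in>I. c i * wderiv (\<phi> i) x) - \<mu> * (LINT x|Omega. (\<Sum>i\<in>I. c i * \<phi> i x)\<^sup>2 / x\<^sup>2)
    = (\<Sum>i\<in>I. \<Sum>j\<in>I. c i * c j * a_form \<mu> (\<phi> i) (\<phi> j))"
    unfolding 1 2 a_form_def by (simp add: sum_distrib_left right_diff_distrib sum_subtractf mult_ac)
  also have "\<dots> = (\<Sum>i\<in>I. \<Sum>j\<in>I. if i = j then lam i * (c i)\<^sup>2 else 0)"
    using a by (intro sum.cong refl) (auto simp: power2_eq_square)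
  also have "\<dots> = (\<Sum>i\<in>I. lam i * (c i)\<^sup>2)" using I by simp
  finally show ?thesis .
qed

lemma nsq_eigen_sum:
  assumes I: "finite I" "I \<subseteq> {1..}"
  shows "nsq (\<lambda>x. \<Sum>i\<in>I. c i * \<phi> i x) = (\<Sum>i\<in>I. (c i)\<^sup>2)"
proof -
  have i: "i \<in> I \<Longrightarrow> i \<ge> 1" for i using I by auto
  have "nsq (\<lambda>x. \<Sum>i\<in>I. c i * \<phi> i x) = (\<Sum>i\<in>I. \<Sum>j\<in>I. c i * c j * ip (\<phi> i) (\<phi> j))"
    using integral_square_sum[of I Omega \<phi> "\<lambda>_. 1" c]
      L2_mult_integrable[OF eigenfunction(3) eigenfunction(3)] i by (simp add: ip_def)
  also have "\<dots> = (\<Sum>i\<in>I. \<Sum>j\<in>I. if i = j then (c i)\<^sup>2 else 0)"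
    using orthonormal i by (intro sum.cong refl) (auto simp: power2_eq_square)
  finally show ?thesis using I by simp
qed

lemma HsD:
  assumes "v \<in> Hs \<phi> lam 1"
  shows "v \<in> L2" "(\<Sum>n=1..N. lam n * (ip v (\<phi> n))\<^sup>2) \<le> (Hs_norm \<phi> lam 1 v)\<^sup>2"
proof -
  show "v \<in> L2" using assms by (simp add: Hs_def)
  have s: "(\<lambda>n. lam n powr 1 * (ip v (\<phi> n))\<^sup>2) summable_on {1..}" using assms by (simp add: Hs_def)
  have "(\<Sum>n=1..N. lam n * (ip v (\<phi> n))\<^sup>2) = (\<Sum>n=1..N. lam n powr 1 * (ip v (\<phi> n))\<^sup>2)"
    by (intro sum.cong refl) (auto simp: lam_pos less_imp_le)
  also have "\<dots> \<le> (\<Sum>\<^sub>\<infinity>n\<in>{1..}. lam n powr 1 * (ip v (\<phi> n))\<^sup>2)"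
    by (rule finite_sum_le_infsum[OF s]) auto
  also have "\<dots> = (Hs_norm \<phi> lam 1 v)\<^sup>2"
    unfolding Hs_norm_def by (subst real_sqrt_pow2) (auto intro!: infsum_nonneg)
  finally show "(\<Sum>n=1..N. lam n * (ip v (\<phi> n))\<^sup>2) \<le> (Hs_norm \<phi> lam 1 v)\<^sup>2" .
qed

lemma expansion: "v \<in> L2 \<Longrightarrow> (\<lambda>N. nsq (\<lambda>x. v x - (\<Sum>n=1..N. ip v (\<phi> n) * \<phi> n x))) \<longlonglongrightarrow> 0"
  using eb unfolding eigenbasis_def by blast

text \<open>The space \<open>\<H>\<^sup>1\<close> is defined through the decay of coefficients, whereas the eigenfunction relation may be tested
  only with elements of \<open>H\<^sub>0\<^sup>1\<close>; this inclusion connects the two. The form of a difference of partial sums of the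
  expansion of \<open>v\<close> is a block of the convergent series \<open>\<Sum> \<lambda>\<^sub>n (v,\<phi>\<^sub>n)\<^sup>2\<close>. By coercivity the
  derivatives of the partial sums are Cauchy, hence convergent, and the graph of differentiation is closed.\<close>

lemma Hs_subset_H01:
  assumes v: "v \<in> Hs \<phi> lam 1" shows "v \<in> H01"
proof -
  define c where "c n = ip v (\<phi> n)" for n
  define S where "S N x = (\<Sum>n=1..N. c n * \<phi> n x)" for N x
  define G where "G N x = (\<Sum>n=1..N. c n * wderiv (\<phi> n) x)" for N x
  define P where "P N = (\<Sum>n=1..N. lam n * (c n)\<^sup>2)" for N :: nat
  define \<kappa> where "\<kappa> = min 1 (1 - 4 * \<mu>)"
  have \<kappa>: "\<kappa> > 0" using mu by (simp add: \<kappa>_def)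
  have SG: "H01_graph (S N) (G N)" for N
    unfolding S_def G_def by (intro H01_graph_sum eigenfunction) auto
  have split: "sum f {1..N} = sum f {1..M} + sum f {M+1..N}" if "M \<le> N" for f :: "nat \<Rightarrow> real" and M N
    using sum.ub_add_nat[of 1 M f "N - M"] that by simp
  have Pinc: "incseq P"
    unfolding P_def by (rule incseq_SucI) (simp add: lam_pos less_imp_le)
  have "P N \<le> (Hs_norm \<phi> lam 1 v)\<^sup>2" for N using HsD(2)[OF v] by (simp add: P_def c_def)
  then obtain L where L: "P \<longlonglongrightarrow> L" "\<And>N. P N \<le> L"
    using incseq_convergent[OF Pinc] by blast
  have cauchy: "nsq (\<lambda>x. G N x - G M x) \<le> (L - P M) / \<kappa>" if "M \<le> N" for M N
  proof -
    have eq: "G N x - G M x = (\<Sum>n\<in>{M+1..N}. c n * wderiv (\<phi> n) x)" for x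
      using split[OF that, of "\<lambda>n. c n * wderiv (\<phi> n) x"] by (simp add: G_def)
    have h: "H01_graph (\<lambda>x. \<Sum>n\<in>{M+1..N}. c n * \<phi> n x) (\<lambda>x. \<Sum>n\<in>{M+1..N}. c n * wderiv (\<phi> n) x)"
      by (intro H01_graph_sum eigenfunction) auto
    have "\<kappa> * nsq (\<lambda>x. \<Sum>n\<in>{M+1..N}. c n * wderiv (\<phi> n) x) \<le> (\<Sum>n\<in>{M+1..N}. lam n * (c n)\<^sup>2)"
      using a_form_coercive[OF h mu] energy_sum[of "{M+1..N}" c] unfolding \<kappa>_def by auto
    also have "\<dots> = P N - P M" using split[OF that, of "\<lambda>n. lam n * (c n)\<^sup>2"] by (simp add: P_def)
    also have "\<dots> \<le> L - P M" using L(2)[of N] by simp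
    finally show ?thesis unfolding eq using \<kappa> by (simp add: field_simps)
  qed
  have "(\<lambda>M. (L - P M) / \<kappa>) \<longlonglongrightarrow> (L - L) / \<kappa>" using \<kappa> by (intro tendsto_intros L) auto
  then have e: "(\<lambda>M. (L - P M) / \<kappa>) \<longlonglongrightarrow> 0" by simp
  have "G k \<in> L2" for k using SG by (auto simp: H01_graph_def)
  from L2_complete[OF this e cauchy] obtain g where g: "g \<in> L2" "(\<lambda>k. nsq (\<lambda>x. g x - G k x)) \<longlonglongrightarrow> 0"
    by blast
  have "H01_graph v g"
    using expansion[OF HsD(1)[OF v]]
    by (intro H01_graph_closed[OF SG HsD(1)[OF v] g(1) _ g(2)]) (simp add: S_def c_def)
  then show ?thesis by (rule H01_graph_imp_H01)
qed

text \<open>Parseval's identity together with \<open>\<lambda>\<^sub>1 \<le> \<lambda>\<^sub>n\<close>. The lemma makes \<open>L\<^sup>2\<close> functions bounded functionals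
  on \<open>\<H>\<^sup>1\<close>.\<close>

lemma nsq_le_Hs_norm:
  assumes w: "w \<in> Hs \<phi> lam 1"
  shows "nsq w \<le> (Hs_norm \<phi> lam 1 w)\<^sup>2 / lam 1"
proof (rule LIMSEQ_le_const2)
  show "(\<lambda>N. nsq (\<lambda>x. \<Sum>n=1..N. ip w (\<phi> n) * \<phi> n x)) \<longlonglongrightarrow> nsq w"
    by (rule L2_tendsto_nsq[OF _ HsD(1)[OF w] expansion[OF HsD(1)[OF w]]])
       (intro L2_sum eigenfunction; simp)
  have "nsq (\<lambda>x. \<Sum>n=1..N. ip w (\<phi> n) * \<phi> n x) \<le> (Hs_norm \<phi> lam 1 w)\<^sup>2 / lam 1" for N
  proof -
    have "lam 1 * (\<Sum>n=1..N. (ip w (\<phi> n))\<^sup>2) \<le> (\<Sum>n=1..N. lam n * (ip w (\<phi> n))\<^sup>2)"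
      unfolding sum_distrib_left by (intro sum_mono mult_right_mono lam_ge) auto
    also have "\<dots> \<le> (Hs_norm \<phi> lam 1 w)\<^sup>2" by (rule HsD(2)[OF w])
    finally show ?thesis using nsq_eigen_sum[of "{1..N}" "\<lambda>n. ip w (\<phi> n)"] lam_pos[of 1] by (simp add: field_simps)
  qed
  then show "\<exists>N. \<forall>n\<ge>N. nsq (\<lambda>x. \<Sum>n=1..n. ip w (\<phi> n) * \<phi> n x) \<le> (Hs_norm \<phi> lam 1 w)\<^sup>2 / lam 1" by blast
qed

lemma Hs_norm_nonneg: "0 \<le> Hs_norm \<phi> lam 1 w"
  unfolding Hs_norm_def by (auto intro!: infsum_nonneg)

lemma Hs_scale:
  assumes "w \<in> Hs \<phi> lam 1"
  shows "(\<lambda>x. a * w x) \<in> Hs \<phi> lam 1" "Hs_norm \<phi> lam 1 (\<lambda>x. a * w x) = \<bar>a\<bar> * Hs_norm \<phi> lam 1 w"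
proof -
  have eq: "lam n powr 1 * (ip (\<lambda>x. a * w x) (\<phi> n))\<^sup>2 = a\<^sup>2 * (lam n powr 1 * (ip w (\<phi> n))\<^sup>2)" for n
    by (simp add: ip_def mult.assoc power_mult_distrib)
  show "(\<lambda>x. a * w x) \<in> Hs \<phi> lam 1"
    using assms unfolding Hs_def mem_Collect_eq eq by (intro conjI L2_cmult summable_on_cmult_right) blast+
  show "Hs_norm \<phi> lam 1 (\<lambda>x. a * w x) = \<bar>a\<bar> * Hs_norm \<phi> lam 1 w"
    unfolding Hs_norm_def eq by (simp add: infsum_cmult_right' real_sqrt_mult)
qed

text \<open>The dual norm is a supremum of reals, which bounds the individual values only because the functional is bounded
  on the unit ball; membership in the dual space is therefore essential wherever a dual norm is used.\<close>

lemma Hdual_norm_bound: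
  assumes \<xi>: "\<xi> \<in> Hdual \<phi> lam 1" and w: "w \<in> Hs \<phi> lam 1"
  shows "\<bar>\<xi> w\<bar> \<le> Hdual_norm \<phi> lam 1 \<xi> * Hs_norm \<phi> lam 1 w"
proof -
  obtain C where C: "\<And>v. v \<in> Hs \<phi> lam 1 \<Longrightarrow> \<bar>\<xi> v\<bar> \<le> C * Hs_norm \<phi> lam 1 v"
    using \<xi> unfolding Hdual_def by blast
  show ?thesis
  proof (cases "Hs_norm \<phi> lam 1 w = 0")
    case True
    then show ?thesis using C[OF w] by simp
  next
    case False
    define r where "r = Hs_norm \<phi> lam 1 w"
    have r: "r > 0" using False Hs_norm_nonneg[of w] by (simp add: r_def)
    let ?w = "\<lambda>x. inverse r * w x"
    have "\<bar>\<xi> ?w\<bar> \<le> Hdual_norm \<phi> lam 1 \<xi>"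
      unfolding Hdual_norm_def
    proof (rule cSUP_upper)
      show "?w \<in> {v \<in> Hs \<phi> lam 1. Hs_norm \<phi> lam 1 v \<le> 1}"
        using Hs_scale[OF w, of "inverse r"] r by (simp add: r_def)
      have "\<bar>\<xi> v\<bar> \<le> \<bar>C\<bar>" if "v \<in> Hs \<phi> lam 1" "Hs_norm \<phi> lam 1 v \<le> 1" for v
      proof -
        have "C * Hs_norm \<phi> lam 1 v \<le> \<bar>C\<bar> * Hs_norm \<phi> lam 1 v"
          by (intro mult_right_mono Hs_norm_nonneg) auto
        also have "\<dots> \<le> \<bar>C\<bar> * 1" using that by (intro mult_left_mono) auto
        finally show ?thesis using C[OF that(1)] by linarith
      qed
      then show "bdd_above ((\<lambda>v. \<bar>\<xi> v\<bar>) ` {v \<in> Hs \<phi> lam 1. Hs_norm \<phi> lam 1 v \<le> 1})"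
        by (intro bdd_aboveI2[where M = "\<bar>C\<bar>"]) auto
    qed
    moreover have "\<xi> (\<lambda>x. inverse r * w x + 0 * w x) = inverse r * \<xi> w + 0 * \<xi> w"
      using \<xi> w unfolding Hdual_def by blast
    then have "\<xi> ?w = inverse r * \<xi> w" by (simp only: mult_zero_left add_0_right)
    ultimately have "inverse r * \<bar>\<xi> w\<bar> \<le> Hdual_norm \<phi> lam 1 \<xi>" using r by (simp add: abs_mult)
    then show ?thesis using r by (simp add: field_simps flip: r_def)
  qed
qed

lemma Hdual_lincomb:
  assumes "\<xi> \<in> Hdual \<phi> lam 1" "\<eta> \<in> Hdual \<phi> lam 1"
  shows "(\<lambda>w. a * \<xi> w + b * \<eta> w) \<in> Hdual \<phi> lam 1"
proof -
  obtain C where C: "\<And>v. v \<in> Hs \<phi> lam 1 \<Longrightarrow> \<bar>\<xi> v\<bar> \<le> C * Hs_norm \<phi> lam 1 v"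
    using assms unfolding Hdual_def by blast
  obtain D where D: "\<And>v. v \<in> Hs \<phi> lam 1 \<Longrightarrow> \<bar>\<eta> v\<bar> \<le> D * Hs_norm \<phi> lam 1 v"
    using assms unfolding Hdual_def by blast
  have "\<bar>a * \<xi> v + b * \<eta> v\<bar> \<le> (\<bar>a\<bar> * C + \<bar>b\<bar> * D) * Hs_norm \<phi> lam 1 v" if "v \<in> Hs \<phi> lam 1" for v
  proof -
    have "\<bar>a * \<xi> v + b * \<eta> v\<bar> \<le> \<bar>a\<bar> * \<bar>\<xi> v\<bar> + \<bar>b\<bar> * \<bar>\<eta> v\<bar>"
      using abs_triangle_ineq[of "a * \<xi> v" "b * \<eta> v"] by (simp add: abs_mult)
    also have "\<dots> \<le> \<bar>a\<bar> * (C * Hs_norm \<phi> lam 1 v) + \<bar>b\<bar> * (D * Hs_norm \<phi> lam 1 v)"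
      by (intro add_mono mult_left_mono C D that) auto
    finally show ?thesis by (simp add: algebra_simps)
  qed
  moreover have "a * \<xi> (\<lambda>x. s * v x + t * w x) + b * \<eta> (\<lambda>x. s * v x + t * w x)
      = s * (a * \<xi> v + b * \<eta> v) + t * (a * \<xi> w + b * \<eta> w)"
    if "v \<in> Hs \<phi> lam 1" "w \<in> Hs \<phi> lam 1" for v w s t
  proof -
    have "\<xi> (\<lambda>x. s * v x + t * w x) = s * \<xi> v + t * \<xi> w" "\<eta> (\<lambda>x. s * v x + t * w x) = s * \<eta> v + t * \<eta> w"
      using assms that unfolding Hdual_def by blast+
    then show ?thesis by (simp add: algebra_simps)
  qed
  ultimately show ?thesis unfolding Hdual_def by blast
qed

lemma ip_Hdual:
  assumes u: "u \<in> L2" shows "ip u \<in> Hdual \<phi> lam 1"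
proof -
  have "\<bar>ip u w\<bar> \<le> sqrt (nsq u / lam 1) * Hs_norm \<phi> lam 1 w" if w: "w \<in> Hs \<phi> lam 1" for w
  proof -
    have "(ip u w)\<^sup>2 \<le> nsq u * nsq w" using ip_Cauchy_Schwarz[OF u HsD(1)[OF w]] .
    also have "\<dots> \<le> nsq u * ((Hs_norm \<phi> lam 1 w)\<^sup>2 / lam 1)"
      by (intro mult_left_mono nsq_le_Hs_norm[OF w]) auto
    finally have "\<bar>ip u w\<bar> \<le> sqrt (nsq u / lam 1 * (Hs_norm \<phi> lam 1 w)\<^sup>2)"
      by (intro real_le_rsqrt) simp
    then show ?thesis using Hs_norm_nonneg[of w] by (simp add: real_sqrt_mult real_sqrt_divide)
  qed
  moreover have "ip u (\<lambda>x. a * v x + b * w x) = a * ip u v + b * ip u w"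
    if "v \<in> Hs \<phi> lam 1" "w \<in> Hs \<phi> lam 1" for v w a b
    using ip_lincomb_left[OF HsD(1)[OF that(1)] HsD(1)[OF that(2)] u, of a b] by (simp add: ip_commute)
  ultimately show ?thesis unfolding Hdual_def by blast
qed

lemma eigenfunction_Hs:
  assumes "n \<ge> 1" shows "\<phi> n \<in> Hs \<phi> lam 1"
proof -
  have "(\<lambda>m. lam m powr 1 * (ip (\<phi> n) (\<phi> m))\<^sup>2) summable_on {1..}"
    by (rule has_sum_imp_summable, rule has_sum_finite_neutralI[of "{n}"])
       (use assms orthonormal in auto)
  then show ?thesis using eigenfunction[OF assms] by (simp add: Hs_def)
qed

lemma Hdual_tendsto:
  assumes "\<And>s. s \<in> S \<Longrightarrow> \<xi> s \<in> Hdual \<phi> lam 1" and w: "w \<in> Hs \<phi> lam 1"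
    and "((\<lambda>s. Hdual_norm \<phi> lam 1 (\<xi> s)) \<longlongrightarrow> 0) (at t within S)"
  shows "((\<lambda>s. \<xi> s w) \<longlongrightarrow> 0) (at t within S)"
proof (rule Lim_null_comparison)
  show "((\<lambda>s. Hdual_norm \<phi> lam 1 (\<xi> s) * Hs_norm \<phi> lam 1 w) \<longlongrightarrow> 0) (at t within S)"
    using tendsto_mult_left_zero[OF assms(3)] .
  show "\<forall>\<^sub>F s in at t within S. norm (\<xi> s w) \<le> Hdual_norm \<phi> lam 1 (\<xi> s) * Hs_norm \<phi> lam 1 w"
    unfolding eventually_at_filter using Hdual_norm_bound[OF assms(1) w] by simp
qed

text \<open>Convergence in \<open>\<H>\<^sup>-\<^sup>1\<close> can be tested with a fixed \<open>w\<close>, so a \<open>C\<^sup>1\<close> function with values in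
  \<open>\<H>\<^sup>-\<^sup>1\<close> has \<open>C\<^sup>1\<close> scalar components.\<close>

lemma C1_Hm1_derivD:
  assumes C: "C1_Hm1_deriv \<phi> lam T u u'" and w: "w \<in> Hs \<phi> lam 1" and t: "t \<in> {0..T}"
  shows "((\<lambda>s. ip (u s) w) has_real_derivative u' t w) (at t within {0..T})"
    and "continuous_on {0..T} (\<lambda>s. u' s w)"
proof -
  have d: "(\<lambda>w. (ip (u s) w - ip (u t) w) / (s - t) - u' t w) \<in> Hdual \<phi> lam 1"
    if "s \<in> {0..T}" "t \<in> {0..T}" for s t
  proof -
    have us: "u s \<in> L2" "u t \<in> L2" "u' t \<in> Hdual \<phi> lam 1"
      using C that unfolding C1_Hm1_deriv_def by blast+
    have "(\<lambda>w. 1 * ((1 / (s - t)) * ip (u s) w + (- 1 / (s - t)) * ip (u t) w) + (- 1) * u' t w) \<in> Hdual \<phi> lam 1"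
      by (intro Hdual_lincomb ip_Hdual us)
    then show ?thesis by (simp add: diff_divide_distrib)
  qed
  have "((\<lambda>s. (ip (u s) w - ip (u t) w) / (s - t) - u' t w) \<longlongrightarrow> 0) (at t within {0..T})"
    by (rule Hdual_tendsto[OF d[OF _ t] w]) (use C t in \<open>auto simp: C1_Hm1_deriv_def\<close>)
  then show "((\<lambda>s. ip (u s) w) has_real_derivative u' t w) (at t within {0..T})"
    unfolding has_field_derivative_iff by (rule LIM_zero_cancel)
  have d': "(\<lambda>w. u' s w - u' t w) \<in> Hdual \<phi> lam 1" if "s \<in> {0..T}" "t \<in> {0..T}" for s t
  proof -
    have us: "u' s \<in> Hdual \<phi> lam 1" "u' t \<in> Hdual \<phi> lam 1"
      using C that unfolding C1_Hm1_deriv_def by blast+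
    show ?thesis using Hdual_lincomb[OF us, of 1 "-1"] by simp
  qed
  have "((\<lambda>s. u' s w) \<longlongrightarrow> u' t w) (at t within {0..T})" if t: "t \<in> {0..T}" for t
    by (rule LIM_zero_cancel, rule Hdual_tendsto[OF d'[OF _ t] w])
       (use C t in \<open>auto simp: C1_Hm1_deriv_def\<close>)
  then show "continuous_on {0..T} (\<lambda>s. u' s w)" by (simp add: continuous_on_def)
qed

end

section \<open>Riemann-Liouville integrals and Volterra equations\<close>


text \<open>For Borel integrands the integral may be taken with respect to Borel-Lebesgue measure, so that Fubini's theorem
  applies to the jointly Borel kernels below; the product of two completed measures would not be complete.\<close>

lemma RL_integral_lborel:
  assumes [measurable]: "g \<in> borel_measurable borel"
  shows "RL_integral \<beta> g t = 1 / Gamma \<beta> * (LBINT s. indicator {0<..<t} s * ((t - s) powr (\<beta> - 1) * g s))"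
  unfolding RL_integral_def by (subst integral_lebesgue_on_eq_lborel) auto

lemma RL_integral_cong:
  assumes "\<And>s. 0 < s \<Longrightarrow> s < t \<Longrightarrow> g s = h s" shows "RL_integral \<beta> g t = RL_integral \<beta> h t"
  unfolding RL_integral_def
  by (intro arg_cong2[of _ _ _ _ "(*)"] refl Bochner_Integration.integral_cong) (use assms in auto)

lemma indicator_times_if: "indicator S x * (y :: real) = (if x \<in> S then y else 0)"
  by auto

lemma powr_kernel:
  fixes a t \<beta> :: real
  assumes "\<beta> > 0" "a \<le> t"
  shows "integrable lborel (\<lambda>s. indicator {a<..<t} s * (t - s) powr (\<beta> - 1))"
    and "(LBINT s. indicator {a<..<t} s * (t - s) powr (\<beta> - 1)) = (t - a) powr \<beta> / \<beta>"
proof -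
  have h0: "((\<lambda>x. x powr (\<beta> - 1)) has_integral ((t - a) powr (\<beta> - 1 + 1) / (\<beta> - 1 + 1))) {0..t - a}"
    using assms by (intro has_integral_powr_from_0) auto
  then have h: "((\<lambda>x. x powr (\<beta> - 1)) has_integral ((t - a) powr \<beta> / \<beta>)) {0<..<t - a}"
    by (simp add: has_integral_Icc_iff_Ioo)
  then have "((\<lambda>x. indicator {0<..<t - a} x * x powr (\<beta> - 1)) has_integral ((t - a) powr \<beta> / \<beta>)) UNIV"
    by (subst (asm) has_integral_restrict_UNIV[symmetric]) (simp only: indicator_times_if)
  then have n: "(\<integral>\<^sup>+x. ennreal (indicator {0<..<t - a} x * x powr (\<beta> - 1)) \<partial>lborel) = ennreal ((t - a) powr \<beta> / \<beta>)"
    by (intro nn_integral_has_integral_lborel) auto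
  have hb: "has_bochner_integral lborel (\<lambda>x. indicator {0<..<t - a} x * x powr (\<beta> - 1)) ((t - a) powr \<beta> / \<beta>)"
    using assms n by (intro has_bochner_integral_nn_integral) auto
  have eq: "indicator {0<..<t - a} (t + (-1) * s) * (t + (-1) * s) powr (\<beta> - 1)
      = indicator {a<..<t} s * (t - s) powr (\<beta> - 1)" for s
    by (auto simp: indicator_def)
  show "integrable lborel (\<lambda>s. indicator {a<..<t} s * (t - s) powr (\<beta> - 1))"
    using lborel_integrable_real_affine[of "\<lambda>x. indicator {0<..<t - a} x * x powr (\<beta> - 1)" "-1" t]
      has_bochner_integral_iff[THEN iffD1, OF hb] unfolding eq by simp
  show "(LBINT s. indicator {a<..<t} s * (t - s) powr (\<beta> - 1)) = (t - a) powr \<beta> / \<beta>"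
    using lborel_integral_real_affine[of "-1" "\<lambda>x. indicator {0<..<t - a} x * x powr (\<beta> - 1)" t]
      has_bochner_integral_iff[THEN iffD1, OF hb] unfolding eq by simp
qed

lemma RL_integrable:
  fixes \<beta> t M :: real and h :: "real \<Rightarrow> real"
  assumes "\<beta> > 0" and [measurable]: "h \<in> borel_measurable borel" and "\<And>s. 0 < s \<Longrightarrow> s < t \<Longrightarrow> \<bar>h s\<bar> \<le> M"
  shows "integrable lborel (\<lambda>s. indicator {0<..<t} s * ((t - s) powr (\<beta> - 1) * h s))"
proof (cases "t > 0")
  case True
  show ?thesis
  proof (rule Bochner_Integration.integrable_bound)
    show "integrable lborel (\<lambda>s. indicator {0<..<t} s * (t - s) powr (\<beta> - 1) * M)"
      using powr_kernel(1)[of \<beta> 0 t] assms True by simp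
    show "AE s in lborel. norm (indicator {0<..<t} s * ((t - s) powr (\<beta> - 1) * h s))
        \<le> norm (indicator {0<..<t} s * (t - s) powr (\<beta> - 1) * M)"
    proof (rule AE_I2)
      fix s
      have "\<bar>h s\<bar> \<le> \<bar>M\<bar>" if "0 < s" "s < t" using assms(3)[OF that] by linarith
      then show "norm (indicator {0<..<t} s * ((t - s) powr (\<beta> - 1) * h s))
        \<le> norm (indicator {0<..<t} s * (t - s) powr (\<beta> - 1) * M)"
        by (auto simp: indicator_def abs_mult intro!: mult_left_mono)
    qed
  qed simp
qed simp

lemma RL_integral_lincomb:
  assumes "\<beta> > 0" "g \<in> borel_measurable borel" "h \<in> borel_measurable borel"
    and "\<And>s. 0 < s \<Longrightarrow> s < t \<Longrightarrow> \<bar>g s\<bar> \<le> M" "\<And>s. 0 < s \<Longrightarrow> s < t \<Longrightarrow> \<bar>h s\<bar> \<le> N"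
  shows "RL_integral \<beta> (\<lambda>s. a * g s + b * h s) t = a * RL_integral \<beta> g t + b * RL_integral \<beta> h t"
proof -
  note i = RL_integrable[OF assms(1,2,4)] RL_integrable[OF assms(1,3,5)]
  have "(LBINT s. indicator {0<..<t} s * ((t - s) powr (\<beta> - 1) * (a * g s + b * h s)))
    = (LBINT s. a * (indicator {0<..<t} s * ((t - s) powr (\<beta> - 1) * g s))
        + b * (indicator {0<..<t} s * ((t - s) powr (\<beta> - 1) * h s)))"
    by (simp add: algebra_simps)
  also have "\<dots> = a * (LBINT s. indicator {0<..<t} s * ((t - s) powr (\<beta> - 1) * g s))
        + b * (LBINT s. indicator {0<..<t} s * ((t - s) powr (\<beta> - 1) * h s))"
    using i by simp
  finally show ?thesis
    using assms(2,3) by (simp add: RL_integral_lborel algebra_simps)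
qed

lemma RL_integral_bound:
  assumes "\<beta> > 0" "h \<in> borel_measurable borel" "\<And>s. 0 < s \<Longrightarrow> s < t \<Longrightarrow> \<bar>h s\<bar> \<le> M" "0 \<le> t" "0 \<le> M"
  shows "\<bar>RL_integral \<beta> h t\<bar> \<le> M * t powr \<beta> / Gamma (\<beta> + 1)"
proof -
  have G: "Gamma \<beta> > 0" using assms by simp
  have "\<bar>LBINT s. indicator {0<..<t} s * ((t - s) powr (\<beta> - 1) * h s)\<bar>
      \<le> (LBINT s. \<bar>indicator {0<..<t} s * ((t - s) powr (\<beta> - 1) * h s)\<bar>)"
    by (rule integral_abs_bound)
  also have "\<dots> \<le> (LBINT s. indicator {0<..<t} s * (t - s) powr (\<beta> - 1) * M)"
  proof (rule integral_mono)
    show "integrable lborel (\<lambda>s. \<bar>indicator {0<..<t} s * ((t - s) powr (\<beta> - 1) * h s)\<bar>)"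
      using RL_integrable[OF assms(1-3)] by (rule integrable_abs)
    show "integrable lborel (\<lambda>s. indicator {0<..<t} s * (t - s) powr (\<beta> - 1) * M)"
      using powr_kernel(1)[OF assms(1,4)] by simp
    fix s
    show "\<bar>indicator {0<..<t} s * ((t - s) powr (\<beta> - 1) * h s)\<bar> \<le> indicator {0<..<t} s * (t - s) powr (\<beta> - 1) * M"
      using assms(3)[of s] by (auto simp: indicator_def abs_mult intro!: mult_left_mono)
  qed
  also have "\<dots> = t powr \<beta> / \<beta> * M" using powr_kernel(2)[OF assms(1,4)] by simp
  finally have le: "\<bar>LBINT s. indicator {0<..<t} s * ((t - s) powr (\<beta> - 1) * h s)\<bar> \<le> t powr \<beta> / \<beta> * M" .
  have "\<bar>RL_integral \<beta> h t\<bar> = 1 / Gamma \<beta> * \<bar>LBINT s. indicator {0<..<t} s * ((t - s) powr (\<beta> - 1) * h s)\<bar>"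
    using G by (simp add: RL_integral_lborel[OF assms(2)] abs_mult)
  also have "\<dots> \<le> 1 / Gamma \<beta> * (t powr \<beta> / \<beta> * M)"
    using G by (intro mult_left_mono le) auto
  also have "\<dots> = M * t powr \<beta> / Gamma (\<beta> + 1)"
  proof -
    have "\<beta> \<notin> \<int>\<^sub>\<le>\<^sub>0" using assms(1) by (auto dest: nonpos_Ints_nonpos)
    then have "Gamma (\<beta> + 1) = \<beta> * Gamma \<beta>" by (rule Gamma_plus1)
    then show ?thesis by (simp add: mult.commute)
  qed
  finally show ?thesis .
qed

lemma RL_integral_measurable:
  assumes [measurable]: "h \<in> borel_measurable borel"
  shows "RL_integral \<beta> h \<in> borel_measurable borel"
proof -
  have "(\<lambda>t. LBINT s. indicator {p. 0 < snd p \<and> snd p < fst p} (t, s) * ((t - s) powr (\<beta> - 1) * h s)) \<in> borel_measurable borel"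
    by measurable
  moreover have "indicator {p. 0 < snd p \<and> snd p < fst p} (t, s) = (indicator {0<..<t} s :: real)" for t s :: real
    by (auto simp: indicator_def)
  ultimately show ?thesis by (simp add: RL_integral_lborel[OF assms, abs_def])
qed

lemma Beta_kernel:
  fixes a b r t :: real
  assumes ab: "a > 0" "b > 0" and "r < t"
  shows "(LBINT s. indicator {r<..<t} s * ((t - s) powr (a - 1) * (s - r) powr (b - 1))) = (t - r) powr (a + b - 1) * Beta a b"
proof -
  have "((\<lambda>x. x powr (b - 1) * (1 - x) powr (a - 1)) has_integral Beta b a) {0<..<1}"
    using has_integral_Beta_real[OF ab(2,1)] by (simp add: has_integral_Icc_iff_Ioo)
  then have "((\<lambda>x. indicator {0<..<1} x * (x powr (b - 1) * (1 - x) powr (a - 1))) has_integral Beta b a) UNIV"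
    by (subst (asm) has_integral_restrict_UNIV[symmetric]) (simp only: indicator_times_if)
  then have n: "(\<integral>\<^sup>+x. ennreal (indicator {0<..<1} x * (x powr (b - 1) * (1 - x) powr (a - 1))) \<partial>lborel) = ennreal (Beta b a)"
    by (intro nn_integral_has_integral_lborel) auto
  have "Beta b a \<ge> 0" unfolding Beta_def using ab by simp
  then have "has_bochner_integral lborel (\<lambda>x. indicator {0<..<1} x * (x powr (b - 1) * (1 - x) powr (a - 1))) (Beta b a)"
    using n by (intro has_bochner_integral_nn_integral) auto
  then have B: "(LBINT x. indicator {0<..<1} x * (x powr (b - 1) * (1 - x) powr (a - 1))) = Beta b a"
    by (simp add: has_bochner_integral_iff)
  have d: "t - r > 0" using assms by simp
  have eq: "indicator {r<..<t} (r + (t - r) * x) * ((t - (r + (t - r) * x)) powr (a - 1) * ((r + (t - r) * x) - r) powr (b - 1))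
      = (t - r) powr (a + b - 2) * (indicator {0<..<1} x * (x powr (b - 1) * (1 - x) powr (a - 1)))" for x
  proof (cases "x \<in> {0<..<1}")
    case True
    then have "(t - r) * x < (t - r) * 1" "(t - r) * x > 0" using d by (intro mult_strict_left_mono mult_pos_pos; simp)+
    then have "r + (t - r) * x \<in> {r<..<t}" by auto
    moreover have "t - (r + (t - r) * x) = (t - r) * (1 - x)" by (simp add: algebra_simps)
    moreover have "(t - r) powr (a + b - 2) = (t - r) powr (a - 1) * (t - r) powr (b - 1)"
      by (simp flip: powr_add)
    ultimately show ?thesis using True d by (simp add: powr_mult)
  next
    case False
    then have "(t - r) * x \<le> 0 \<or> (t - r) * 1 \<le> (t - r) * x"
      using d by (auto simp: mult_le_0_iff)
    then have "r + (t - r) * x \<notin> {r<..<t}" by auto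
    then show ?thesis using False by simp
  qed
  have "(LBINT s. indicator {r<..<t} s * ((t - s) powr (a - 1) * (s - r) powr (b - 1)))
      = (t - r) * (LBINT x. (t - r) powr (a + b - 2) * (indicator {0<..<1} x * (x powr (b - 1) * (1 - x) powr (a - 1))))"
    using lborel_integral_real_affine[of "t - r" "\<lambda>s. indicator {r<..<t} s * ((t - s) powr (a - 1) * (s - r) powr (b - 1))" r] d
    unfolding eq by simp
  also have "\<dots> = (t - r) powr 1 * (t - r) powr (a + b - 2) * Beta b a" using B d by simp
  also have "\<dots> = (t - r) powr (a + b - 1) * Beta a b"
    using powr_add[of "t - r" 1 "a + b - 2"] by (simp only: Beta_commute[of b a]) (simp add: algebra_simps)
  finally show ?thesis .
qed

text \<open>Exchanging the order of integration reduces the claim to the Beta integral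
  \<open>\<integral>\<^sub>r\<^sup>t (t-s)\<^sup>a\<^sup>-\<^sup>1 (s-r)\<^sup>b\<^sup>-\<^sup>1 ds = (t-r)\<^sup>a\<^sup>+\<^sup>b\<^sup>-\<^sup>1 B(a,b)\<close>.\<close>

lemma RL_semigroup:
  assumes ab: "a > 0" "b > 0" and h[measurable]: "h \<in> borel_measurable borel" and M: "\<And>s. \<bar>h s\<bar> \<le> M"
  shows "RL_integral a (RL_integral b h) t = RL_integral (a + b) h t"
proof (cases "t > 0")
  case False
  then show ?thesis by (simp add: RL_integral_def)
next
  case t: True
  have M0: "M \<ge> 0" using M[of 0] by linarith
  define F where "F s r = indicator {p. 0 < snd p \<and> snd p < fst p \<and> fst p < t} (s, r) *
      ((t - s) powr (a - 1) * ((s - r) powr (b - 1) * h r))" for s r :: real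
  have Fm[measurable]: "case_prod F \<in> borel_measurable (lborel \<Otimes>\<^sub>M lborel)" unfolding F_def by measurable
  \<comment> \<open>F1 is the form for integrating over r first, F2 the one for integrating over s first.\<close>
  have F1: "F s r = indicator {0<..<t} s * (t - s) powr (a - 1) * (indicator {0<..<s} r * ((s - r) powr (b - 1) * h r))" for s r
    by (auto simp: F_def indicator_def)
  have F2: "F s r = indicator {0<..<t} r * h r * (indicator {r<..<t} s * ((t - s) powr (a - 1) * (s - r) powr (b - 1)))" for s r
    by (auto simp: F_def indicator_def)
  have ii: "integrable lborel (F s)" for s
    unfolding F1 by (intro integrable_mult_right RL_integrable[OF ab(2) h M])
  have Fi: "integrable (lborel \<Otimes>\<^sub>M lborel) (case_prod F)"
  proof (rule lborel_pair.Fubini_integrable)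
    show "AE s in lborel. integrable lborel (\<lambda>r. case_prod F (s, r))" using ii by simp
    show "integrable lborel (\<lambda>s. LBINT r. norm (case_prod F (s, r)))"
    proof (rule Bochner_Integration.integrable_bound)
      show "integrable lborel (\<lambda>s. indicator {0<..<t} s * (t - s) powr (a - 1) * (M * t powr b / b))"
        using powr_kernel(1)[of a 0 t] ab t by simp
      show "AE s in lborel. norm (LBINT r. norm (case_prod F (s, r)))
        \<le> norm (indicator {0<..<t} s * (t - s) powr (a - 1) * (M * t powr b / b))"
      proof (rule AE_I2)
        fix s
        show "norm (LBINT r. norm (case_prod F (s, r)))
          \<le> norm (indicator {0<..<t} s * (t - s) powr (a - 1) * (M * t powr b / b))"
        proof (cases "s \<in> {0<..<t}")
          case True
          have "(LBINT r. norm (F s r)) \<le> (LBINT r. (t - s) powr (a - 1) * M * (indicator {0<..<s} r * (s - r) powr (b - 1)))"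
          proof (rule integral_mono)
            show "integrable lborel (\<lambda>r. norm (F s r))" using ii by simp
            show "integrable lborel (\<lambda>r. (t - s) powr (a - 1) * M * (indicator {0<..<s} r * (s - r) powr (b - 1)))"
              using powr_kernel(1)[of b 0 s] ab True by simp
            fix r
            have "\<bar>h r\<bar> * X \<le> M * X" if "X \<ge> 0" for X using M that by (intro mult_right_mono)
            from this[of "(t - s) powr (a - 1) * (s - r) powr (b - 1)"]
            show "norm (F s r) \<le> (t - s) powr (a - 1) * M * (indicator {0<..<s} r * (s - r) powr (b - 1))"
              using True unfolding F1 by (auto simp: indicator_def abs_mult mult_ac)
          qed
          also have "\<dots> = (t - s) powr (a - 1) * M * (s powr b / b)"
            using powr_kernel(2)[of b 0 s] ab True by simp
          also have "\<dots> \<le> (t - s) powr (a - 1) * M * (t powr b / b)"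
            using True ab M0 by (intro mult_left_mono divide_right_mono powr_mono2) auto
          finally show ?thesis using True ab M0 by (simp add: mult_ac)
        qed (simp add: F1)
      qed
    qed measurable
  qed measurable
  have "indicator {0<..<t} s * ((t - s) powr (a - 1) * RL_integral b h s) = 1 / Gamma b * (LBINT r. F s r)" for s
  proof -
    have "(LBINT r. F s r) = indicator {0<..<t} s * (t - s) powr (a - 1) * (LBINT r. indicator {0<..<s} r * ((s - r) powr (b - 1) * h r))"
      unfolding F1 by (rule integral_mult_right_zero)
    then show ?thesis by (simp add: RL_integral_lborel[OF h])
  qed
  then have "(LBINT s. indicator {0<..<t} s * ((t - s) powr (a - 1) * RL_integral b h s))
      = (LBINT s. 1 / Gamma b * (LBINT r. F s r))" by presburger
  also have "\<dots> = 1 / Gamma b * (LBINT s. LBINT r. F s r)" by simp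
  also have "(LBINT s. LBINT r. F s r) = (LBINT r. LBINT s. F s r)"
    using lborel_pair.Fubini_integral[OF Fi] by simp
  also have "\<dots> = (LBINT r. Beta a b * (indicator {0<..<t} r * ((t - r) powr (a + b - 1) * h r)))"
  proof (rule Bochner_Integration.integral_cong[OF refl])
    fix r
    show "(LBINT s. F s r) = Beta a b * (indicator {0<..<t} r * ((t - r) powr (a + b - 1) * h r))"
      unfolding F2 using Beta_kernel[OF ab, of r t] by (cases "r < t") (auto simp: mult_ac)
  qed
  finally have "RL_integral a (RL_integral b h) t = 1 / Gamma a * (1 / Gamma b * (Beta a b *
      (LBINT r. indicator {0<..<t} r * ((t - r) powr (a + b - 1) * h r))))"
    by (simp add: RL_integral_lborel[OF RL_integral_measurable[OF h]])
  moreover have "1 / Gamma a * (1 / Gamma b * (Beta a b * X)) = 1 / Gamma (a + b) * X" for X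
  proof -
    have "Gamma a > 0" "Gamma b > 0" using ab by auto
    then show ?thesis by (simp add: Beta_def)
  qed
  ultimately show ?thesis by (simp add: RL_integral_lborel[OF h])
qed

text \<open>Since \<open>\<alpha> > 1\<close>, the Mittag-Leffler coefficients are dominated by those of the exponential series. The Gamma function
  increases only from about \<open>1.46\<close> on, whence \<open>k \<ge> 1\<close>.\<close>

lemma Gamma_ge_fact:
  assumes "\<alpha> > 1" "\<beta> \<ge> 1" "k \<ge> 1" shows "fact k \<le> Gamma (\<alpha> * real k + \<beta>)"
proof -
  have "real k \<le> \<alpha> * real k" using assms by (simp add: mult_le_cancel_right1)
  then have le: "1 + real k \<le> \<alpha> * real k + \<beta>" using assms by linarith
  have "fact k = Gamma (1 + real k)" using Gamma_fact[of k, where ?'a = real] by simp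
  also have "\<dots> \<le> Gamma (\<alpha> * real k + \<beta>)"
  proof (cases "1 + real k = \<alpha> * real k + \<beta>")
    case False
    then show ?thesis using le assms Gamma_real_strict_mono[of "1 + real k" "\<alpha> * real k + \<beta>"] by force
  qed simp
  finally show ?thesis .
qed

lemma mittag_leffler_summable:
  assumes "\<alpha> > 1" "\<beta> \<ge> 1"
  shows "summable (\<lambda>k. z ^ k / Gamma (\<alpha> * real k + \<beta>))"
proof (rule summable_comparison_test)
  show "summable (\<lambda>k. inverse (fact k) * \<bar>z\<bar> ^ k)" by (rule summable_exp)
  have "norm (z ^ k / Gamma (\<alpha> * real k + \<beta>)) \<le> inverse (fact k) * \<bar>z\<bar> ^ k" if "k \<ge> 1" for k
  proof -
    note G = Gamma_ge_fact[OF assms that]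
    have "Gamma (\<alpha> * real k + \<beta>) > 0" using assms by (intro Gamma_real_pos add_nonneg_pos) auto
    then have "norm (z ^ k / Gamma (\<alpha> * real k + \<beta>)) = \<bar>z\<bar> ^ k / Gamma (\<alpha> * real k + \<beta>)"
      by (simp add: power_abs)
    also have "\<dots> \<le> \<bar>z\<bar> ^ k / fact k" using G by (intro divide_left_mono mult_pos_pos) (auto intro: less_le_trans[OF fact_gt_zero])
    finally show ?thesis by (simp add: field_simps)
  qed
  then show "\<exists>N. \<forall>k\<ge>N. norm (z ^ k / Gamma (\<alpha> * real k + \<beta>)) \<le> inverse (fact k) * \<bar>z\<bar> ^ k" by blast
qed

text \<open>Substituting the equation into its own right-hand side; the orders of the integrals add up by the semigroup
  property.\<close>

lemma Volterra_iterate: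
  assumes \<alpha>: "\<alpha> > 0" and q: "q \<in> borel_measurable borel" "\<And>s. \<bar>q s\<bar> \<le> Q"
    and d: "d \<in> borel_measurable borel" "\<And>s. \<bar>d s\<bar> \<le> D"
    and eq: "\<And>t. 0 < t \<Longrightarrow> t \<le> T \<Longrightarrow> d t = RL_integral \<alpha> (\<lambda>s. c * q s + (- l) * d s) t"
    and t: "0 < t" "t \<le> T"
  shows "d t = (\<Sum>k\<le>N. (- l) ^ k * c * RL_integral (\<alpha> * real k + \<alpha>) q t)
    + (- l) ^ Suc N * RL_integral (\<alpha> * real (Suc N)) d t"
proof (induction N)
  case 0
  show ?case using eq[OF t] RL_integral_lincomb[OF \<alpha> q(1) d(1) q(2) d(2), where t = t and a = c and b = "- l"] by simp
next
  case (Suc N)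
  define b where "b = \<alpha> * real (Suc N)"
  have b: "b > 0" using \<alpha> by (simp add: b_def)
  have "RL_integral b d t = RL_integral b (RL_integral \<alpha> (\<lambda>s. c * q s + (- l) * d s)) t"
    by (rule RL_integral_cong) (use eq t in auto)
  also have "\<dots> = RL_integral (b + \<alpha>) (\<lambda>s. c * q s + (- l) * d s) t"
  proof (rule RL_semigroup[OF b \<alpha>])
    show "(\<lambda>s. c * q s + (- l) * d s) \<in> borel_measurable borel" using q d by measurable
    show "\<bar>c * q s + (- l) * d s\<bar> \<le> \<bar>c\<bar> * Q + \<bar>l\<bar> * D" for s
    proof -
      have "\<bar>c * q s + (- l) * d s\<bar> \<le> \<bar>c\<bar> * \<bar>q s\<bar> + \<bar>l\<bar> * \<bar>d s\<bar>"
        using abs_triangle_ineq[of "c * q s" "(- l) * d s"] by (simp add: abs_mult)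
      also have "\<dots> \<le> \<bar>c\<bar> * Q + \<bar>l\<bar> * D" by (intro add_mono mult_left_mono q d) auto
      finally show ?thesis .
    qed
  qed
  also have "\<dots> = c * RL_integral (b + \<alpha>) q t + (- l) * RL_integral (b + \<alpha>) d t"
    by (rule RL_integral_lincomb[OF _ q(1) d(1) q(2) d(2)]) (use b \<alpha> in simp)
  finally have step: "RL_integral b d t = c * RL_integral (b + \<alpha>) q t + (- l) * RL_integral (b + \<alpha>) d t" .
  have e: "\<alpha> * real (Suc (Suc N)) = b + \<alpha>" "\<alpha> * real (Suc N) + \<alpha> = b + \<alpha>"
    by (simp_all add: b_def algebra_simps)
  have "d t = (\<Sum>k\<le>N. (- l) ^ k * c * RL_integral (\<alpha> * real k + \<alpha>) q t)
    + (- l) ^ Suc N * (c * RL_integral (b + \<alpha>) q t + (- l) * RL_integral (b + \<alpha>) d t)"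
    using Suc.IH by (simp only: b_def[symmetric] step)
  then show ?case
    unfolding sum.atMost_Suc e power_Suc[of _ "Suc N"] by (simp only: algebra_simps)
qed

text \<open>In the limit of the iteration the remainder \<open>(-l)\<^sup>N I\<^sup>\<alpha>\<^sup>N d\<close> vanishes, because it is bounded by a multiple of
  the general term of a Mittag-Leffler series. The kernels of the remaining integrals sum up to
  \<open>(T-s)\<^sup>\<alpha>\<^sup>-\<^sup>1 E\<^sub>\<alpha>\<^sub>,\<^sub>\<alpha>(-l(T-s)\<^sup>\<alpha>)\<close>, with dominated convergence.\<close>

lemma Volterra_solution:
  assumes \<alpha>: "\<alpha> > 1" and q: "q \<in> borel_measurable borel" "\<And>s. \<bar>q s\<bar> \<le> Q"
    and d: "d \<in> borel_measurable borel" "\<And>s. \<bar>d s\<bar> \<le> D"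
    and eq: "\<And>t. 0 < t \<Longrightarrow> t \<le> T \<Longrightarrow> d t = RL_integral \<alpha> (\<lambda>s. c * q s + (- l) * d s) t"
    and T: "0 < T"
  shows "d T = c * (LINT s|lebesgue_on {0<..<T}.
     (T - s) powr (\<alpha> - 1) * mittag_leffler \<alpha> \<alpha> (- l * (T - s) powr \<alpha>) * q s)"
proof -
  have a0: "\<alpha> > 0" using \<alpha> by simp
  note [measurable] = q(1) d(1)
  have D0: "D \<ge> 0" using d(2)[of 0] by linarith
  have Q0: "Q \<ge> 0" using q(2)[of 0] by linarith
  define g where "g N s = indicator {0<..<T} s * ((T - s) powr (\<alpha> - 1) *
     (\<Sum>k\<le>N. (- l * (T - s) powr \<alpha>) ^ k / Gamma (\<alpha> * real k + \<alpha>)) * q s)" for N s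
  define g' where "g' s = indicator {0<..<T} s * ((T - s) powr (\<alpha> - 1) *
     mittag_leffler \<alpha> \<alpha> (- l * (T - s) powr \<alpha>) * q s)" for s
  have gm[measurable]: "g N \<in> borel_measurable borel" for N unfolding g_def by measurable
  have g'm[measurable]: "g' \<in> borel_measurable borel" unfolding g'_def mittag_leffler_def by measurable
  define S where "S = (\<Sum>k. (\<bar>l\<bar> * T powr \<alpha>) ^ k / Gamma (\<alpha> * real k + \<alpha>))"
  have Gpos: "Gamma (\<alpha> * real k + \<alpha>) > 0" for k
    using \<alpha> by (intro Gamma_real_pos add_nonneg_pos) auto
  have lim: "(\<lambda>N. integral\<^sup>L lborel (g N)) \<longlonglongrightarrow> integral\<^sup>L lborel g'"
  proof (rule integral_dominated_convergence)
    show "integrable lborel (\<lambda>s. indicator {0<..<T} s * (T - s) powr (\<alpha> - 1) * (S * Q))"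
      using powr_kernel(1)[of \<alpha> 0 T] a0 T by simp
    show "AE s in lborel. (\<lambda>N. g N s) \<longlonglongrightarrow> g' s"
    proof (rule AE_I2)
      fix s
      have "(\<lambda>N. \<Sum>k\<le>N. (- l * (T - s) powr \<alpha>) ^ k / Gamma (\<alpha> * real k + \<alpha>))
        \<longlonglongrightarrow> mittag_leffler \<alpha> \<alpha> (- l * (T - s) powr \<alpha>)"
        unfolding mittag_leffler_def using \<alpha> by (intro summable_LIMSEQ' mittag_leffler_summable) auto
      then show "(\<lambda>N. g N s) \<longlonglongrightarrow> g' s" unfolding g_def g'_def by (intro tendsto_intros)
    qed
    show "AE s in lborel. norm (g N s) \<le> indicator {0<..<T} s * (T - s) powr (\<alpha> - 1) * (S * Q)" for N
    proof (rule AE_I2)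
      fix s
      show "norm (g N s) \<le> indicator {0<..<T} s * (T - s) powr (\<alpha> - 1) * (S * Q)"
      proof (cases "s \<in> {0<..<T}")
        case True
        have "\<bar>\<Sum>k\<le>N. (- l * (T - s) powr \<alpha>) ^ k / Gamma (\<alpha> * real k + \<alpha>)\<bar>
          \<le> (\<Sum>k\<le>N. (\<bar>l\<bar> * T powr \<alpha>) ^ k / Gamma (\<alpha> * real k + \<alpha>))"
        proof (rule order_trans[OF sum_abs sum_mono])
          fix k
          have "\<bar>(- l * (T - s) powr \<alpha>) ^ k / Gamma (\<alpha> * real k + \<alpha>)\<bar> = (\<bar>l\<bar> * (T - s) powr \<alpha>) ^ k / Gamma (\<alpha> * real k + \<alpha>)"
            using Gpos[of k] by (simp add: power_abs abs_mult)
          also have "\<dots> \<le> (\<bar>l\<bar> * T powr \<alpha>) ^ k / Gamma (\<alpha> * real k + \<alpha>)"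
            using True a0 Gpos[of k] by (intro divide_right_mono power_mono mult_left_mono powr_mono2) auto
          finally show "\<bar>(- l * (T - s) powr \<alpha>) ^ k / Gamma (\<alpha> * real k + \<alpha>)\<bar> \<le> (\<bar>l\<bar> * T powr \<alpha>) ^ k / Gamma (\<alpha> * real k + \<alpha>)" .
        qed
        also have "\<dots> \<le> S"
          unfolding S_def using \<alpha> Gpos by (intro sum_le_suminf mittag_leffler_summable) (auto intro!: divide_nonneg_pos)
        finally have "\<bar>\<Sum>k\<le>N. (- l * (T - s) powr \<alpha>) ^ k / Gamma (\<alpha> * real k + \<alpha>)\<bar> * \<bar>q s\<bar> \<le> S * Q"
          using q(2)[of s] by (intro mult_mono) auto
        then show ?thesis using True by (simp add: g_def abs_mult mult.assoc mult_left_mono)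
      qed (simp add: g_def)
    qed
  qed auto
  have gN: "integral\<^sup>L lborel (g N) = (\<Sum>k\<le>N. (- l) ^ k * RL_integral (\<alpha> * real k + \<alpha>) q T)" for N
  proof -
    have p: "\<alpha> * real k + \<alpha> > 0" for k using a0 by (intro add_nonneg_pos) auto
    have "g N s = (\<Sum>k\<le>N. (- l) ^ k / Gamma (\<alpha> * real k + \<alpha>) *
        (indicator {0<..<T} s * ((T - s) powr (\<alpha> * real k + \<alpha> - 1) * q s)))" for s
    proof (cases "s \<in> {0<..<T}")
      case True
      have "(T - s) powr (\<alpha> - 1) * ((- l * (T - s) powr \<alpha>) ^ k) = (- l) ^ k * (T - s) powr (\<alpha> * real k + \<alpha> - 1)" for k
      proof -
        have "((T - s) powr \<alpha>) ^ k = (T - s) powr (\<alpha> * real k)"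
          using True by (simp add: powr_powr flip: powr_realpow)
        moreover have "(T - s) powr (\<alpha> - 1) * (T - s) powr (\<alpha> * real k) = (T - s) powr (\<alpha> * real k + \<alpha> - 1)"
          by (simp flip: powr_add) (simp add: algebra_simps)
        ultimately show ?thesis
          unfolding power_mult_distrib[of "- l"] by (metis mult.left_commute)
      qed
      then show ?thesis using True unfolding g_def
        by (simp add: sum_distrib_left sum_distrib_right) (simp add: mult_ac)
    qed (simp add: g_def)
    then have "integral\<^sup>L lborel (g N) = (LBINT s. \<Sum>k\<le>N. (- l) ^ k / Gamma (\<alpha> * real k + \<alpha>) *
        (indicator {0<..<T} s * ((T - s) powr (\<alpha> * real k + \<alpha> - 1) * q s)))" by presburger
    also have "\<dots> = (\<Sum>k\<le>N. (- l) ^ k / Gamma (\<alpha> * real k + \<alpha>) *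
        (LBINT s. indicator {0<..<T} s * ((T - s) powr (\<alpha> * real k + \<alpha> - 1) * q s)))"
      by (subst Bochner_Integration.integral_sum) (auto intro!: RL_integrable[OF p q])
    finally show ?thesis by (simp add: RL_integral_lborel)
  qed
  have rem: "(\<lambda>N. (- l) ^ Suc N * RL_integral (\<alpha> * real (Suc N)) d T) \<longlonglongrightarrow> 0"
  proof (rule Lim_null_comparison)
    have "summable (\<lambda>k. (\<bar>l\<bar> * T powr \<alpha>) ^ k / Gamma (\<alpha> * real k + 1))"
      using \<alpha> by (intro mittag_leffler_summable) auto
    then have "(\<lambda>k. (\<bar>l\<bar> * T powr \<alpha>) ^ Suc k / Gamma (\<alpha> * real (Suc k) + 1)) \<longlonglongrightarrow> 0"
      using summable_LIMSEQ_zero LIMSEQ_Suc by blast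
    from tendsto_mult_right_zero[OF this, of D]
    show "(\<lambda>k. D * ((\<bar>l\<bar> * T powr \<alpha>) ^ Suc k / Gamma (\<alpha> * real (Suc k) + 1))) \<longlonglongrightarrow> 0" .
    have "norm ((- l) ^ Suc k * RL_integral (\<alpha> * real (Suc k)) d T) \<le> D * ((\<bar>l\<bar> * T powr \<alpha>) ^ Suc k / Gamma (\<alpha> * real (Suc k) + 1))" for k
    proof -
      have "\<bar>RL_integral (\<alpha> * real (Suc k)) d T\<bar> \<le> D * T powr (\<alpha> * real (Suc k)) / Gamma (\<alpha> * real (Suc k) + 1)"
        using a0 T D0 d by (intro RL_integral_bound) auto
      also have "T powr (\<alpha> * real (Suc k)) = (T powr \<alpha>) ^ Suc k"
        using T by (simp only: powr_powr[symmetric] powr_realpow powr_gt_zero)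
      finally have "\<bar>l\<bar> ^ Suc k * \<bar>RL_integral (\<alpha> * real (Suc k)) d T\<bar>
        \<le> \<bar>l\<bar> ^ Suc k * (D * (T powr \<alpha>) ^ Suc k / Gamma (\<alpha> * real (Suc k) + 1))"
        by (intro mult_left_mono) auto
      then show ?thesis by (simp only: real_norm_def abs_mult power_abs abs_minus_cancel power_mult_distrib times_divide_eq_right mult_ac)
    qed
    then show "\<forall>\<^sub>F k in sequentially. norm ((- l) ^ Suc k * RL_integral (\<alpha> * real (Suc k)) d T) \<le> D * ((\<bar>l\<bar> * T powr \<alpha>) ^ Suc k / Gamma (\<alpha> * real (Suc k) + 1))" by simp
  qed
  have "d T = c * integral\<^sup>L lborel (g N) + (- l) ^ Suc N * RL_integral (\<alpha> * real (Suc N)) d T" for N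
    unfolding gN using Volterra_iterate[OF a0 q d eq T order_refl, of N] by (simp add: sum_distrib_left mult_ac)
  then have "(\<lambda>N::nat. d T) \<longlonglongrightarrow> c * integral\<^sup>L lborel g' + 0"
    using tendsto_add[OF tendsto_mult[OF tendsto_const lim] rem, of c] by simp
  then have "d T = c * integral\<^sup>L lborel g'" by (simp add: LIMSEQ_const_iff)
  also have "integral\<^sup>L lborel g' = (LINT s|lebesgue_on {0<..<T}.
     (T - s) powr (\<alpha> - 1) * mittag_leffler \<alpha> \<alpha> (- l * (T - s) powr \<alpha>) * q s)"
    unfolding g'_def[abs_def]
    by (rule integral_lebesgue_on_eq_lborel[symmetric]) (simp_all only: g'_def[symmetric, abs_def] g'm, simp)
  finally show ?thesis .
qed

section \<open>From the Caputo equation to a Volterra equation\<close>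


text \<open>Substituting \<open>s = t x\<close> moves the parameter from the singular kernel and the domain of integration into the
  continuous function.\<close>

lemma RL_integral_continuous:
  assumes "\<beta> > 0" and f[measurable]: "f \<in> borel_measurable borel" and C: "\<And>s. \<bar>f s\<bar> \<le> C"
    and cont: "continuous_on {0..T} f"
  shows "continuous_on {0<..<T} (RL_integral \<beta> f)"
proof -
  define I where "I t = (LBINT x. indicator {0<..<1} x * ((1 - x) powr (\<beta> - 1) * f (t * x)))" for t
  have scale: "RL_integral \<beta> f t = t powr \<beta> / Gamma \<beta> * I t" if t: "t > 0" for t
  proof -
    have eq: "indicator {0<..<t} (0 + t * x) * ((t - (0 + t * x)) powr (\<beta> - 1) * f (0 + t * x))
      = t powr (\<beta> - 1) * (indicator {0<..<1} x * ((1 - x) powr (\<beta> - 1) * f (t * x)))" for x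
    proof (cases "x \<in> {0<..<1}")
      case True
      then have "t * x < t * 1" "t * x > 0" using t by (intro mult_strict_left_mono mult_pos_pos; simp)+
      then have "0 + t * x \<in> {0<..<t}" by auto
      moreover have "t - (0 + t * x) = t * (1 - x)" by (simp add: algebra_simps)
      ultimately show ?thesis using True t by (simp add: powr_mult)
    next
      case False
      then have "0 + t * x \<notin> {0<..<t}" using t by (auto simp: zero_less_mult_iff mult_less_cancel_left1)
      then show ?thesis using False by simp
    qed
    have "(LBINT s. indicator {0<..<t} s * ((t - s) powr (\<beta> - 1) * f s)) = t * (t powr (\<beta> - 1) * I t)"
      using lborel_integral_real_affine[of t "\<lambda>s. indicator {0<..<t} s * ((t - s) powr (\<beta> - 1) * f s)" 0] t
      unfolding eq I_def by simp
    also have "\<dots> = t powr 1 * t powr (\<beta> - 1) * I t" using t by simp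
    also have "t powr 1 * t powr (\<beta> - 1) = t powr \<beta>" using powr_add[of t 1 "\<beta> - 1"] by simp
    finally show ?thesis by (simp add: RL_integral_lborel[OF f])
  qed
  have "continuous_on {0<..<T} I"
    unfolding continuous_on_sequentially
  proof (intro allI ballI impI)
    fix x :: "nat \<Rightarrow> real" and a assume a: "a \<in> {0<..<T}" and x: "(\<forall>n. x n \<in> {0<..<T}) \<and> x \<longlonglongrightarrow> a"
    have "(\<lambda>n. I (x n)) \<longlonglongrightarrow> I a"
      unfolding I_def
    proof (rule integral_dominated_convergence)
      show "integrable lborel (\<lambda>s. indicator {0<..<1} s * (1 - s) powr (\<beta> - 1) * C)"
        using powr_kernel(1)[of \<beta> 0 1] assms by simp
      show "AE s in lborel. (\<lambda>n. indicator {0<..<1} s * ((1 - s) powr (\<beta> - 1) * f (x n * s)))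
        \<longlonglongrightarrow> indicator {0<..<1} s * ((1 - s) powr (\<beta> - 1) * f (a * s))"
      proof (rule AE_I2)
        fix s :: real
        show "(\<lambda>n. indicator {0<..<1} s * ((1 - s) powr (\<beta> - 1) * f (x n * s)))
          \<longlonglongrightarrow> indicator {0<..<1} s * ((1 - s) powr (\<beta> - 1) * f (a * s))"
        proof (cases "s \<in> {0<..<1}")
          case True
          have in01: "z * s \<in> {0..T}" if "z \<in> {0<..<T}" for z
          proof -
            have "z * s \<le> T * 1" using that True by (intro mult_mono) auto
            then show ?thesis using that True by auto
          qed
          have "(\<lambda>n. f (x n * s)) \<longlonglongrightarrow> f (a * s)"
            by (rule continuous_on_tendsto_compose[OF cont])
               (use x a in01 in \<open>auto intro!: tendsto_intros\<close>)
          then show ?thesis by (intro tendsto_intros)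
        qed simp
      qed
      show "AE s in lborel. norm (indicator {0<..<1} s * ((1 - s) powr (\<beta> - 1) * f (x n * s)))
        \<le> indicator {0<..<1} s * (1 - s) powr (\<beta> - 1) * C" for n
        using C by (auto simp: indicator_def abs_mult intro!: mult_left_mono)
    qed measurable
    then show "(I \<circ> x) \<longlonglongrightarrow> I a" by (simp add: o_def)
  qed
  then have "continuous_on {0<..<T} (\<lambda>t. t powr \<beta> / Gamma \<beta> * I t)"
    using assms by (intro continuous_intros) (auto simp: Gamma_eq_zero_iff dest: nonpos_Ints_nonpos)
  then show ?thesis by (rule continuous_on_eq) (simp add: scale)
qed

lemma RL_integral_1:
  assumes [measurable]: "h \<in> borel_measurable borel"
  shows "RL_integral 1 h t = (LBINT s. indicator {0<..<t} s * h s)"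
proof -
  have "indicator {0<..<t} s * ((t - s) powr (1 - 1) * h s) = indicator {0<..<t} s * h s" for s
    by (auto simp: indicator_def)
  then show ?thesis by (simp only: RL_integral_lborel[OF assms]) simp
qed

text \<open>By the lemma of du Bois-Reymond the continuous function \<open>g = I\<^sup>2\<^sup>-\<^sup>\<alpha>(y' - y'(0))\<close> is a primitive of \<open>H\<close>, and it tends
  to zero at the origin, so \<open>g = I\<^sup>1 H\<close>. Applying \<open>I\<^sup>\<alpha>\<^sup>-\<^sup>1\<close> to both sides gives
  \<open>I\<^sup>1(y' - y'(0)) = I\<^sup>\<alpha> H\<close>, and the left-hand side is elementary.\<close>

lemma caputo_ode_imp_Volterra:
  fixes y y' H :: "real \<Rightarrow> real"
  assumes T: "T > 0" and \<alpha>: "1 < \<alpha>" "\<alpha> < 2"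
    and y: "\<And>t. t \<in> {0..T} \<Longrightarrow> (y has_real_derivative y' t) (at t within {0..T})"
    and y': "continuous_on {0..T} y'"
    and H[measurable]: "H \<in> borel_measurable borel" and M: "\<And>s. \<bar>H s\<bar> \<le> M"
    and eq: "\<And>\<psi>. test_fun 0 T \<psi> \<Longrightarrow>
      (LINT t|lebesgue_on {0<..<T}. deriv \<psi> t * RL_integral (2 - \<alpha>) (\<lambda>s. y' s - y' 0) t)
      = - (LINT t|lebesgue_on {0<..<T}. \<psi> t * H t)"
    and t: "0 < t" "t \<le> T"
  shows "y t = y 0 + t * y' 0 + RL_integral \<alpha> H t"
proof -
  \<comment> \<open>Outside [0,T] nothing is known about y', so it is cut off to obtain a bounded Borel function.\<close>
  define f where "f s = indicator {0..T} s * (y' s - y' 0)" for s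
  have cf': "continuous_on {0..T} (\<lambda>s. y' s - y' 0)" by (intro continuous_intros y')
  have fm[measurable]: "f \<in> borel_measurable borel"
    using borel_measurable_continuous_on_indicator[OF _ cf'] by (simp add: f_def[abs_def])
  have cf: "continuous_on {0..T} f"
    using cf' by (rule continuous_on_eq) (simp add: f_def)
  obtain C where C0: "\<forall>z\<in>f ` {0..T}. norm z \<le> C"
    using compact_continuous_image[OF cf compact_Icc, THEN compact_imp_bounded] bounded_iff by metis
  have Cnn: "C \<ge> 0" using C0 T by (metis atLeastAtMost_iff image_eqI less_imp_le norm_ge_zero order_refl order_trans)
  have C: "\<bar>f s\<bar> \<le> C" for s using C0 Cnn by (cases "s \<in> {0..T}") (auto simp: f_def)
  define g where "g = RL_integral (2 - \<alpha>) f"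
  have gc: "continuous_on {0<..<T} g"
    unfolding g_def using \<alpha> by (intro RL_integral_continuous[OF _ fm C cf]) auto
  have Hi: "integrable lborel (\<lambda>s. indicator {0<..<r} s * H s)" for r
  proof (rule Bochner_Integration.integrable_bound)
    show "integrable lborel (\<lambda>s. indicator {0<..<r} s * M)"
      by (cases "0 \<le> r") (auto intro!: integrable_mult_left integrable_real_indicator)
    show "AE s in lborel. norm (indicator {0<..<r} s * H s) \<le> norm (indicator {0<..<r} s * M)"
      using M by (auto simp: indicator_def intro: order_trans[OF _ abs_ge_self])
  qed measurable
  have weak: "(LINT t|lebesgue_on {0<..<T}. deriv \<psi> t * g t) = - (LINT t|lebesgue_on {0<..<T}. \<psi> t * H t)"
    if \<psi>: "test_fun 0 T \<psi>" for \<psi>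
  proof -
    have "RL_integral (2 - \<alpha>) (\<lambda>s. y' s - y' 0) t = g t" if "t < T" for t
      unfolding g_def by (rule RL_integral_cong) (use that in \<open>auto simp: f_def\<close>)
    then have "(LINT t|lebesgue_on {0<..<T}. deriv \<psi> t * g t)
      = (LINT t|lebesgue_on {0<..<T}. deriv \<psi> t * RL_integral (2 - \<alpha>) (\<lambda>s. y' s - y' 0) t)"
      by (intro Bochner_Integration.integral_cong refl) auto
    then show ?thesis using eq[OF \<psi>] by simp
  qed
  have g1: "g t = RL_integral 1 H t" if t: "0 < t" "t < T" for t
  proof -
    \<comment> \<open>Any sequence in (0,t) tending to zero serves to move the left endpoint to the origin.\<close>
    define s where "s n = t / 2 * inverse (real (Suc n))" for n :: nat
    have s: "0 < s n" "s n < t" for n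
    proof -
      show "0 < s n" using t by (simp add: s_def)
      have "s n \<le> t / 2 * 1" unfolding s_def using t by (intro mult_left_mono) (auto simp: inverse_le_1_iff)
      then show "s n < t" using t by simp
    qed
    have s0: "s \<longlonglongrightarrow> 0"
      unfolding s_def by (rule tendsto_mult_right_zero[OF LIMSEQ_inverse_real_of_nat])
    have "g t - g (s n) = (LBINT x. indicator {s n<..t} x * H x)" for n
    proof -
      have "integrable (lebesgue_on {0<..<T}) H"
        by (subst integrable_restrict_space) (use Hi[of T] in \<open>auto simp: integrable_completion\<close>)
      then have "g t - g (s n) = (LINT x|lebesgue_on {0<..<T}. indicator {s n<..t} x * H x)"
        by (rule du_Bois_Reymond[OF gc _ weak s t(2)])
      also have "\<dots> = (LBINT x. indicator {0<..<T} x * (indicator {s n<..t} x * H x))"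
        by (rule integral_lebesgue_on_eq_lborel) auto
      also have "\<dots> = (LBINT x. indicator {s n<..t} x * H x)"
        using s[of n] t by (intro Bochner_Integration.integral_cong) (auto simp: indicator_def)
      finally show ?thesis .
    qed
    moreover have "(\<lambda>n. LBINT x. indicator {s n<..t} x * H x) \<longlonglongrightarrow> (LBINT x. indicator {0<..<t} x * H x)"
    proof (rule integral_dominated_convergence)
      show "integrable lborel (\<lambda>x. \<bar>indicator {0<..<T} x * H x\<bar>)" using Hi by (rule integrable_abs)
      show "AE x in lborel. (\<lambda>n. indicator {s n<..t} x * H x) \<longlonglongrightarrow> indicator {0<..<t} x * H x"
        using AE_lborel_singleton[of t]
      proof eventually_elim
        case (elim x)
        have "eventually (\<lambda>n. indicator {s n<..t} x * H x = indicator {0<..<t} x * H x) sequentially"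
        proof (cases "0 < x")
          case True
          have "eventually (\<lambda>n. s n < x) sequentially" using s0 True by (rule order_tendstoD)
          then show ?thesis by eventually_elim (use True elim in \<open>auto simp: indicator_def\<close>)
        next
          case False
          then have "x \<notin> {s n<..t}" for n using s(1)[of n] by auto
          then show ?thesis using False by simp
        qed
        then show ?case by (rule tendsto_eventually)
      qed
      show "AE x in lborel. norm (indicator {s n<..t} x * H x) \<le> \<bar>indicator {0<..<T} x * H x\<bar>" for n
        using s[of n] t by (auto simp: indicator_def)
    qed measurable
    moreover have "(\<lambda>n. g (s n)) \<longlonglongrightarrow> 0"
    proof (rule Lim_null_comparison)
      show "\<forall>\<^sub>F n in sequentially. norm (g (s n)) \<le> C * s n powr (2 - \<alpha>) / Gamma (2 - \<alpha> + 1)"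
      proof (intro always_eventually allI)
        fix n
        have "\<bar>RL_integral (2 - \<alpha>) f (s n)\<bar> \<le> C * s n powr (2 - \<alpha>) / Gamma (2 - \<alpha> + 1)"
          by (rule RL_integral_bound[OF _ fm C _ Cnn]) (use \<alpha> s(1)[of n] in auto)
        then show "norm (g (s n)) \<le> C * s n powr (2 - \<alpha>) / Gamma (2 - \<alpha> + 1)" by (simp add: g_def)
      qed
      have "(\<lambda>n. s n powr (2 - \<alpha>)) \<longlonglongrightarrow> 0"
        using s(1) \<alpha> by (intro tendsto_zero_powrI[OF s0 tendsto_const]) (auto simp: less_imp_le)
      from tendsto_mult_right_zero[OF this, of "C / Gamma (2 - \<alpha> + 1)"]
      show "(\<lambda>n. C * s n powr (2 - \<alpha>) / Gamma (2 - \<alpha> + 1)) \<longlonglongrightarrow> 0" by simp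
    qed
    then have "(\<lambda>n. g t - g (s n)) \<longlonglongrightarrow> g t - 0" by (intro tendsto_intros)
    ultimately have "g t = (LBINT x. indicator {0<..<t} x * H x)"
      using LIMSEQ_unique by simp
    then show ?thesis by (simp add: RL_integral_1)
  qed
  have "RL_integral (\<alpha> - 1) (RL_integral (2 - \<alpha>) f) t = RL_integral (\<alpha> - 1) (RL_integral 1 H) t"
    by (rule RL_integral_cong) (use g1 t in \<open>auto simp: g_def\<close>)
  then have "RL_integral 1 f t = RL_integral \<alpha> H t"
    using RL_semigroup[OF _ _ fm C, of "\<alpha> - 1" "2 - \<alpha>" t] RL_semigroup[OF _ _ H M, of "\<alpha> - 1" 1 t] \<alpha> by simp
  moreover have "RL_integral 1 f t = y t - y 0 - t * y' 0"
  proof -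
    have "RL_integral 1 f t = (LBINT s. indicator {0..t} s *\<^sub>R (y' s - y' 0))"
      unfolding RL_integral_1[OF fm]
    proof (rule integral_cong_AE)
      show "AE s in lborel. indicator {0<..<t} s * f s = indicator {0..t} s *\<^sub>R (y' s - y' 0)"
        using AE_lborel_singleton[of 0] AE_lborel_singleton[of t]
        by eventually_elim (use t in \<open>auto simp: f_def indicator_def\<close>)
      have "continuous_on {0..t} (\<lambda>s. y' s - y' 0)" using cf' t by (auto intro: continuous_on_subset)
      from borel_measurable_continuous_on_indicator[OF _ this]
      show "(\<lambda>s. indicator {0..t} s *\<^sub>R (y' s - y' 0)) \<in> borel_measurable lborel" by simp
    qed measurable
    also have "\<dots> = (y t - t * y' 0) - (y 0 - 0 * y' 0)"
    proof (rule integral_FTC_atLeastAtMost)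
      show "continuous_on {0..t} (\<lambda>s. y' s - y' 0)" using cf' t by (auto intro: continuous_on_subset)
      fix s assume s: "0 \<le> s" "s \<le> t"
      have "((\<lambda>s. y s - s * y' 0) has_real_derivative y' s - 1 * y' 0) (at s within {0..T})"
        by (intro DERIV_diff y DERIV_cmult_right DERIV_ident) (use s t in auto)
      then have "((\<lambda>s. y s - s * y' 0) has_real_derivative y' s - y' 0) (at s within {0..t})"
        using t by (auto intro: DERIV_subset)
      then show "((\<lambda>s. y s - s * y' 0) has_vector_derivative y' s - y' 0) (at s within {0..t})"
        by (simp add: has_real_derivative_iff_has_vector_derivative)
    qed (use t in auto)
    finally show ?thesis by simp
  qed
  ultimately show ?thesis by simp
qed

section \<open>Recovering the source from the terminal state\<close>


text \<open>An essentially bounded function is replaced by an everywhere bounded Borel function, so that the calculus of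
  Riemann-Liouville integrals applies; the bound is enforced by truncation.\<close>

lemma Linfty_borel_representative:
  assumes "q \<in> Linfty T"
  obtains q' Q where "q' \<in> borel_measurable borel" "\<And>s. \<bar>q' s\<bar> \<le> Q" "AE t in lebesgue_on {0<..<T}. q t = q' t"
proof -
  obtain C where C: "AE t in lebesgue_on {0<..<T}. \<bar>q t\<bar> \<le> C" and qm: "q \<in> borel_measurable (lebesgue_on {0<..<T})"
    using assms by (auto simp: Linfty_def)
  have "(\<lambda>x. indicator {0<..<T} x *\<^sub>R q x) \<in> borel_measurable lebesgue"
    using qm by (subst (asm) borel_measurable_restrict_space_iff) auto
  then obtain h where h: "h \<in> borel_measurable borel" "AE x in lborel. indicator {0<..<T} x *\<^sub>R q x = h x"
    using completion_ex_borel_measurable_real by force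
  define q' where "q' x = max (- \<bar>C\<bar>) (min \<bar>C\<bar> (h x))" for x
  show thesis
  proof (rule that[of q' "\<bar>C\<bar>"])
    show "q' \<in> borel_measurable borel" unfolding q'_def using h(1) by measurable
    show "\<bar>q' s\<bar> \<le> \<bar>C\<bar>" for s by (auto simp: q'_def)
    have "AE t in lebesgue_on {0<..<T}. q t = h t"
      by (subst AE_restrict_space_iff) (use AE_completion[OF h(2)] in \<open>auto elim!: eventually_mono\<close>)
    with C show "AE t in lebesgue_on {0<..<T}. q t = q' t"
      by eventually_elim (auto simp: q'_def)
  qed
qed

lemma borel_measurable_lebesgue_on_AE:
  fixes f g :: "real \<Rightarrow> real"
  assumes "f \<in> borel_measurable (lebesgue_on {0<..<T})" "AE t in lebesgue_on {0<..<T}. f t = g t"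
  shows "g \<in> borel_measurable (lebesgue_on {0<..<T})"
proof -
  have "(\<lambda>x. indicator {0<..<T} x *\<^sub>R f x) \<in> borel_measurable lebesgue"
    using assms(1) by (subst (asm) borel_measurable_restrict_space_iff) auto
  moreover have "AE x in lebesgue. indicator {0<..<T} x *\<^sub>R f x = indicator {0<..<T} x *\<^sub>R g x"
    using assms(2) by (subst (asm) AE_restrict_space_iff) (auto elim!: eventually_mono simp: indicator_def)
  ultimately have "(\<lambda>x. indicator {0<..<T} x *\<^sub>R g x) \<in> borel_measurable lebesgue"
    by (rule borel_measurable_AE)
  then show ?thesis by (subst borel_measurable_restrict_space_iff) auto
qed

lemma borel_measurable_imp_lebesgue_on:
  "f \<in> borel_measurable borel \<Longrightarrow> f \<in> borel_measurable (lebesgue_on S)" for f :: "real \<Rightarrow> real"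
  by (intro measurable_restrict_space1 measurable_completion) simp

context eigenbasis_of begin

text \<open>Testing the weak formulation with \<open>\<phi>\<^sub>n\<close> yields the fractional equation
  \<open>D\<^sup>\<alpha> y + \<lambda>\<^sub>n y = (p,\<phi>\<^sub>n) q\<close> for the coefficient \<open>y(t) = (u(t),\<phi>\<^sub>n)\<close>, here in integrated form. The
  function \<open>Y\<close> is \<open>y\<close> cut off outside \<open>[0,T]\<close>, where \<open>u\<close> is arbitrary.\<close>

lemma weak_solution_coefficient:
  assumes T: "T > 0" and \<alpha>: "1 < \<alpha>" "\<alpha> < 2"
    and u0: "u0 \<in> L2" and p: "p \<in> L2" and n: "n \<ge> 1"
    and q': "q' \<in> borel_measurable borel" "\<And>s. \<bar>q' s\<bar> \<le> Q" "AE t in lebesgue_on {0<..<T}. q t = q' t"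
    and sol: "solution_for \<mu> \<phi> lam \<alpha> T u0 u1 q p u"
    and Y_def: "\<And>t. Y t = indicator {0..T} t * ip (u t) (\<phi> n)"
  obtains D where "Y \<in> borel_measurable borel" "\<And>s. \<bar>Y s\<bar> \<le> D"
    "\<And>t. 0 < t \<Longrightarrow> t \<le> T \<Longrightarrow> Y t = ip u0 (\<phi> n) + t * ip u1 (\<phi> n)
        + RL_integral \<alpha> (\<lambda>s. ip p (\<phi> n) * q' s + (- lam n) * Y s) t"
proof -
  have w: "\<phi> n \<in> Hs \<phi> lam 1" by (rule eigenfunction_Hs[OF n])
  obtain u' D where C0: "u \<in> C0_H1 \<phi> lam T" and C1: "C1_Hm1_deriv \<phi> lam T u u'"
    and cap: "caputo_deriv \<phi> lam \<alpha> T u' D" and i0: "AE x in Omega. u 0 x = u0 x"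
    and i1: "\<And>w. w \<in> Hs \<phi> lam 1 \<Longrightarrow> u' 0 w = ip u1 w"
    and eq: "AE t in lebesgue_on {0<..<T}. \<forall>v\<in>Hs \<phi> lam 1. D t v + a_form \<mu> (u t) v = ip (\<lambda>x. p x * q t) v"
    using sol unfolding solution_for_def weak_solution_def by blast
  have uHs: "u t \<in> Hs \<phi> lam 1" if "t \<in> {0..T}" for t using C0 that by (auto simp: C0_H1_def)
  define y where "y t = ip (u t) (\<phi> n)" for t
  define y' where "y' t = u' t (\<phi> n)" for t
  have y: "(y has_real_derivative y' t) (at t within {0..T})" if "t \<in> {0..T}" for t
    unfolding y_def y'_def by (rule C1_Hm1_derivD(1)[OF C1 w that])
  have y'c: "continuous_on {0..T} y'"
    unfolding y'_def using C1_Hm1_derivD(2)[OF C1 w, of 0] T by simp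
  have yc: "continuous_on {0..T} y"
    using y by (intro DERIV_continuous_on) auto
  have Ye: "Y t = indicator {0..T} t * y t" for t by (simp add: Y_def y_def)
  have Ym[measurable]: "Y \<in> borel_measurable borel"
    using borel_measurable_continuous_on_indicator[OF _ yc] by (simp add: Ye[abs_def])
  obtain B where B0: "\<forall>z\<in>y ` {0..T}. norm z \<le> B"
    using compact_continuous_image[OF yc compact_Icc, THEN compact_imp_bounded] bounded_iff by metis
  have Yb: "\<bar>Y s\<bar> \<le> \<bar>B\<bar>" for s
    using B0 by (cases "s \<in> {0..T}") (auto simp: Ye intro: order_trans[OF _ abs_ge_self])
  define H where "H s = ip p (\<phi> n) * q' s + (- lam n) * Y s" for s
  have Hm[measurable]: "H \<in> borel_measurable borel" unfolding H_def using q'(1) by measurable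
  have Hb: "\<bar>H s\<bar> \<le> \<bar>ip p (\<phi> n)\<bar> * Q + \<bar>lam n\<bar> * \<bar>B\<bar>" for s
  proof -
    have "\<bar>H s\<bar> \<le> \<bar>ip p (\<phi> n)\<bar> * \<bar>q' s\<bar> + \<bar>lam n\<bar> * \<bar>Y s\<bar>"
      unfolding H_def using abs_triangle_ineq[of "ip p (\<phi> n) * q' s" "(- lam n) * Y s"] by (simp add: abs_mult)
    also have "\<dots> \<le> \<bar>ip p (\<phi> n)\<bar> * Q + \<bar>lam n\<bar> * \<bar>B\<bar>"
      by (intro add_mono mult_left_mono q' Yb) auto
    finally show ?thesis .
  qed
  have DH: "AE t in lebesgue_on {0<..<T}. H t = D t (\<phi> n)"
    using eq q'(3) AE_space
  proof eventually_elim
    case (elim t)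
    then have t: "t \<in> {0..T}" by auto
    have "D t (\<phi> n) + a_form \<mu> (u t) (\<phi> n) = ip (\<lambda>x. p x * q t) (\<phi> n)" using elim w by blast
    moreover have "ip (\<lambda>x. p x * q t) (\<phi> n) = q t * ip p (\<phi> n)"
    proof -
      have "ip (\<lambda>x. p x * q t) (\<phi> n) = (LINT x|Omega. q t * (p x * \<phi> n x))" by (simp add: ip_def mult_ac)
      then show ?thesis by (simp add: ip_def)
    qed
    ultimately show ?case
      using a_form_eigenfunction[OF Hs_subset_H01[OF uHs[OF t]] n] elim t
      by (simp add: H_def Ye y_def algebra_simps)
  qed
  have weak: "(LINT t|lebesgue_on {0<..<T}. deriv \<psi> t * RL_integral (2 - \<alpha>) (\<lambda>s. y' s - y' 0) t)
      = - (LINT t|lebesgue_on {0<..<T}. \<psi> t * H t)" if \<psi>: "test_fun 0 T \<psi>" for \<psi>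
  proof -
    have m: "\<psi> \<in> borel_measurable (lebesgue_on {0<..<T})"
      using \<psi> by (intro continuous_imp_measurable_on_sets_lebesgue smooth_continuous test_fun_smooth) auto
    have Hm': "H \<in> borel_measurable (lebesgue_on {0<..<T})" by (rule borel_measurable_imp_lebesgue_on[OF Hm])
    have "(LINT t|lebesgue_on {0<..<T}. \<psi> t * D t (\<phi> n)) = (LINT t|lebesgue_on {0<..<T}. \<psi> t * H t)"
      by (intro integral_cong_AE borel_measurable_times m Hm' borel_measurable_lebesgue_on_AE[OF Hm' DH])
         (use DH in \<open>auto elim!: eventually_mono\<close>)
    then show ?thesis using cap \<psi> w unfolding caputo_deriv_def y'_def by simp
  qed
  have y0: "y 0 = ip u0 (\<phi> n)"
    unfolding y_def ip_def
    using T by (intro integral_cong_AE borel_measurable_times L2D(1) u0 HsD(1)[OF uHs] eigenfunction(3)[OF n])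
       (use i0 in \<open>auto elim!: eventually_mono\<close>)
  show thesis
  proof (rule that[OF Ym Yb])
    fix t assume t: "0 < t" "t \<le> T"
    show "Y t = ip u0 (\<phi> n) + t * ip u1 (\<phi> n) + RL_integral \<alpha> (\<lambda>s. ip p (\<phi> n) * q' s + (- lam n) * Y s) t"
      using caputo_ode_imp_Volterra[OF T \<alpha> y y'c Hm Hb weak t] y0 i1[OF w] t
      by (simp add: Ye y'_def H_def[abs_def])
  qed
qed

text \<open>For equal initial data the data terms in the two integral equations cancel, and the difference of the
  coefficients solves a Volterra equation whose solution at time \<open>T\<close> is explicit.\<close>

lemma terminal_coefficient_difference:
  assumes T: "T > 0" and \<alpha>: "1 < \<alpha>" "\<alpha> < 2"
    and u0: "u0 \<in> L2" and q: "q \<in> Linfty T" and p: "p \<in> L2" "p' \<in> L2" and n: "n \<ge> 1"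
    and sol: "solution_for \<mu> \<phi> lam \<alpha> T u0 u1 q p u" "solution_for \<mu> \<phi> lam \<alpha> T u0 u1 q p' v"
  shows "ip (u T) (\<phi> n) - ip (v T) (\<phi> n) = (ip p (\<phi> n) - ip p' (\<phi> n)) * K_coeff lam \<alpha> T q n"
proof -
  obtain q' Q where q': "q' \<in> borel_measurable borel" "\<And>s. \<bar>q' s\<bar> \<le> Q" "AE t in lebesgue_on {0<..<T}. q t = q' t"
    using Linfty_borel_representative[OF q] by blast
  define Y where "Y t = indicator {0..T} t * ip (u t) (\<phi> n)" for t
  define Z where "Z t = indicator {0..T} t * ip (v t) (\<phi> n)" for t
  obtain C where Y: "Y \<in> borel_measurable borel" "\<And>s. \<bar>Y s\<bar> \<le> C"
    "\<And>t. 0 < t \<Longrightarrow> t \<le> T \<Longrightarrow> Y t = ip u0 (\<phi> n) + t * ip u1 (\<phi> n)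
        + RL_integral \<alpha> (\<lambda>s. ip p (\<phi> n) * q' s + (- lam n) * Y s) t"
    using weak_solution_coefficient[OF T \<alpha> u0 p(1) n q' sol(1) Y_def] by blast
  obtain D where Z: "Z \<in> borel_measurable borel" "\<And>s. \<bar>Z s\<bar> \<le> D"
    "\<And>t. 0 < t \<Longrightarrow> t \<le> T \<Longrightarrow> Z t = ip u0 (\<phi> n) + t * ip u1 (\<phi> n)
        + RL_integral \<alpha> (\<lambda>s. ip p' (\<phi> n) * q' s + (- lam n) * Z s) t"
    using weak_solution_coefficient[OF T \<alpha> u0 p(2) n q' sol(2) Z_def] by blast
  note [measurable] = q'(1) Y(1) Z(1)
  let ?c = "ip p (\<phi> n) - ip p' (\<phi> n)"
  have bnd: "\<bar>a * q' s + (- lam n) * X s\<bar> \<le> \<bar>a\<bar> * Q + \<bar>lam n\<bar> * E" if "\<And>s. \<bar>X s\<bar> \<le> E" for a s E and X :: "real \<Rightarrow> real"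
  proof -
    have "\<bar>a * q' s + (- lam n) * X s\<bar> \<le> \<bar>a\<bar> * \<bar>q' s\<bar> + \<bar>lam n\<bar> * \<bar>X s\<bar>"
      using abs_triangle_ineq[of "a * q' s" "(- lam n) * X s"] by (simp add: abs_mult)
    also have "\<dots> \<le> \<bar>a\<bar> * Q + \<bar>lam n\<bar> * E" by (intro add_mono mult_left_mono q' that) auto
    finally show ?thesis .
  qed
  have "Y T - Z T = ?c * (LINT s|lebesgue_on {0<..<T}.
     (T - s) powr (\<alpha> - 1) * mittag_leffler \<alpha> \<alpha> (- lam n * (T - s) powr \<alpha>) * q' s)"
  proof (rule Volterra_solution[OF \<alpha>(1) q'(1,2), where d = "\<lambda>t. Y t - Z t" and D = "C + D", OF _ _ _ T])
    show "\<bar>Y s - Z s\<bar> \<le> C + D" for s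
      using Y(2)[of s] Z(2)[of s] abs_triangle_ineq4[of "Y s" "Z s"] by linarith
    fix t assume t: "0 < t" "t \<le> T"
    have "RL_integral \<alpha> (\<lambda>s. 1 * (ip p (\<phi> n) * q' s + (- lam n) * Y s) + (- 1) * (ip p' (\<phi> n) * q' s + (- lam n) * Z s)) t
      = 1 * RL_integral \<alpha> (\<lambda>s. ip p (\<phi> n) * q' s + (- lam n) * Y s) t
       + (- 1) * RL_integral \<alpha> (\<lambda>s. ip p' (\<phi> n) * q' s + (- lam n) * Z s) t"
      by (rule RL_integral_lincomb[OF _ _ _ bnd[OF Y(2)] bnd[OF Z(2)]]) (use \<alpha> in \<open>simp, measurable\<close>)
    moreover have "(\<lambda>s. 1 * (ip p (\<phi> n) * q' s + (- lam n) * Y s) + (- 1) * (ip p' (\<phi> n) * q' s + (- lam n) * Z s))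
      = (\<lambda>s. ?c * q' s + (- lam n) * (Y s - Z s))" by (auto simp: algebra_simps)
    ultimately show "Y t - Z t = RL_integral \<alpha> (\<lambda>s. ?c * q' s + (- lam n) * (Y s - Z s)) t"
      using Y(3)[OF t] Z(3)[OF t] by simp
  qed measurable
  also have "(LINT s|lebesgue_on {0<..<T}.
     (T - s) powr (\<alpha> - 1) * mittag_leffler \<alpha> \<alpha> (- lam n * (T - s) powr \<alpha>) * q' s) = K_coeff lam \<alpha> T q n"
    unfolding K_coeff_def
  proof (rule integral_cong_AE)
    have [measurable]: "(\<lambda>s. (T - s) powr (\<alpha> - 1) * mittag_leffler \<alpha> \<alpha> (- lam n * (T - s) powr \<alpha>)) \<in> borel_measurable borel"
      unfolding mittag_leffler_def by measurable
    then have m: "(\<lambda>s. (T - s) powr (\<alpha> - 1) * mittag_leffler \<alpha> \<alpha> (- lam n * (T - s) powr \<alpha>)) \<in> borel_measurable (lebesgue_on {0<..<T})"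
      by (rule borel_measurable_imp_lebesgue_on)
    show "(\<lambda>s. (T - s) powr (\<alpha> - 1) * mittag_leffler \<alpha> \<alpha> (- lam n * (T - s) powr \<alpha>) * q' s) \<in> borel_measurable (lebesgue_on {0<..<T})"
      by (intro borel_measurable_times m borel_measurable_imp_lebesgue_on q'(1))
    show "(\<lambda>s. (T - s) powr (\<alpha> - 1) * mittag_leffler \<alpha> \<alpha> (- lam n * (T - s) powr \<alpha>) * q s) \<in> borel_measurable (lebesgue_on {0<..<T})"
      using q by (intro borel_measurable_times m) (auto simp: Linfty_def)
    show "AE s in lebesgue_on {0<..<T}. (T - s) powr (\<alpha> - 1) * mittag_leffler \<alpha> \<alpha> (- lam n * (T - s) powr \<alpha>) * q' s
      = (T - s) powr (\<alpha> - 1) * mittag_leffler \<alpha> \<alpha> (- lam n * (T - s) powr \<alpha>) * q s"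
      using q'(3) by eventually_elim simp
  qed
  finally show ?thesis using T by (simp add: Y_def Z_def)
qed

lemma eq_AE_if_coefficients_eq:
  assumes "p \<in> L2" "p' \<in> L2" "\<And>n. n \<ge> 1 \<Longrightarrow> ip p (\<phi> n) = ip p' (\<phi> n)"
  shows "AE x in Omega. p x = p' x"
proof -
  have d: "(\<lambda>x. p x - p' x) \<in> L2" using assms L2_diff by blast
  have z: "ip (\<lambda>x. p x - p' x) (\<phi> n) = 0" if "n \<ge> 1" for n
    using ip_diff_left[OF assms(1,2) eigenfunction(3)[OF that]] assms(3)[OF that] by simp
  have "(\<Sum>n=1..N. ip (\<lambda>x. p x - p' x) (\<phi> n) * \<phi> n x) = 0" for N x
    by (rule sum.neutral) (use z in auto)
  then have "nsq (\<lambda>x. p x - p' x) = 0" using expansion[OF d] by (simp add: LIMSEQ_const_iff)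
  from nsq_eq_0_AE[OF d this] show ?thesis by simp
qed

lemma solution_terminal_L2:
  assumes "solution_for \<mu> \<phi> lam \<alpha> T u0 u1 q p u" "T \<ge> 0" shows "u T \<in> L2"
  using assms HsD(1) unfolding solution_for_def weak_solution_def C0_H1_def by auto

end

theorem theorem2:
  fixes \<mu> \<alpha> T :: real
    and \<phi> :: "nat \<Rightarrow> real \<Rightarrow> real" and lam :: "nat \<Rightarrow> real"
    and u0 u1 q \<omega>obs :: "real \<Rightarrow> real"
  assumes "T > 0" and "1 < \<alpha>" and "\<alpha> < 2" and "\<mu> < 1/4"
    and "eigenbasis \<mu> \<phi> lam"
    and "u0 \<in> Hs \<phi> lam 1" and "u1 \<in> L2" and "q \<in> Linfty T"
    and "\<forall>n\<ge>1. K_coeff lam \<alpha> T q n \<noteq> 0"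
  shows "(\<forall>z. solution_for \<mu> \<phi> lam \<alpha> T u0 u1 q (\<lambda>_. 0) z \<longrightarrow>
            at_most_one_in_L2 (\<lambda>p. A_graph \<mu> \<phi> lam \<alpha> T u0 u1 q p (\<lambda>x. \<omega>obs x - z T x)))
       \<and> at_most_one_in_L2 (\<lambda>p. \<exists>u. solution_for \<mu> \<phi> lam \<alpha> T u0 u1 q p u \<and>
                                     (AE x in Omega. u T x = \<omega>obs x))"
proof -
  interpret eigenbasis_of \<mu> \<phi> lam using assms by unfold_locales
  let ?sol = "solution_for \<mu> \<phi> lam \<alpha> T u0 u1 q"
  have u0: "u0 \<in> L2" using HsD(1) assms(6) .
  note diff = terminal_coefficient_difference[OF assms(1-3) u0 assms(8)]
  \<comment> \<open>The two occurrences of the forward map come with their own solutions z and z' for the zero source;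
    comparing u with z and v with z' removes the need to identify them.\<close>
  have key: "AE x in Omega. p x = p' x"
    if p: "p \<in> L2" "p' \<in> L2" and sol: "?sol p u" "?sol p' v" "?sol (\<lambda>_. 0) z" "?sol (\<lambda>_. 0) z'"
      and AE: "AE x in Omega. u T x - z T x = v T x - z' T x" for p p' u v z z'
  proof (rule eq_AE_if_coefficients_eq[OF p])
    fix n :: nat assume n: "n \<ge> 1"
    note TL = solution_terminal_L2[OF sol(1)] solution_terminal_L2[OF sol(2)]
      solution_terminal_L2[OF sol(3)] solution_terminal_L2[OF sol(4)]
    have "ip (\<lambda>x. u T x - z T x) (\<phi> n) = ip (\<lambda>x. v T x - z' T x) (\<phi> n)"
      unfolding ip_def using assms(1) n
      by (intro integral_cong_AE borel_measurable_times L2D(1) L2_diff TL eigenfunction(3))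
         (use AE in \<open>auto elim!: eventually_mono\<close>)
    then have "ip (u T) (\<phi> n) - ip (z T) (\<phi> n) = ip (v T) (\<phi> n) - ip (z' T) (\<phi> n)"
      using ip_diff_left[OF TL(1,3) eigenfunction(3)[OF n]] ip_diff_left[OF TL(2,4) eigenfunction(3)[OF n]] assms(1)
      by simp
    then have "ip p (\<phi> n) * K_coeff lam \<alpha> T q n = ip p' (\<phi> n) * K_coeff lam \<alpha> T q n"
      using diff[OF p(1) L2_zero n sol(1,3)] diff[OF p(2) L2_zero n sol(2,4)] by (simp add: ip_def)
    then show "ip p (\<phi> n) = ip p' (\<phi> n)" using assms(9) n by simp
  qed
  show ?thesis
  proof (intro conjI allI impI)
    fix z assume "?sol (\<lambda>_. 0) z"
    show "at_most_one_in_L2 (\<lambda>p. A_graph \<mu> \<phi> lam \<alpha> T u0 u1 q p (\<lambda>x. \<omega>obs x - z T x))"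
      unfolding at_most_one_in_L2_def
    proof (intro ballI impI)
      fix p p' assume p: "p \<in> L2" "p' \<in> L2" and A: "A_graph \<mu> \<phi> lam \<alpha> T u0 u1 q p (\<lambda>x. \<omega>obs x - z T x)"
        "A_graph \<mu> \<phi> lam \<alpha> T u0 u1 q p' (\<lambda>x. \<omega>obs x - z T x)"
      from A(1) obtain u a where u: "?sol p u" "?sol (\<lambda>_. 0) a" "AE x in Omega. u T x - a T x = \<omega>obs x - z T x"
        unfolding A_graph_def by blast
      from A(2) obtain v b where v: "?sol p' v" "?sol (\<lambda>_. 0) b" "AE x in Omega. v T x - b T x = \<omega>obs x - z T x"
        unfolding A_graph_def by blast
      have "AE x in Omega. u T x - a T x = v T x - b T x"
        using u(3) v(3) by eventually_elim simp
      then show "AE x in Omega. p x = p' x" by (rule key[OF p u(1) v(1) u(2) v(2)])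
    qed
  next
    show "at_most_one_in_L2 (\<lambda>p. \<exists>u. ?sol p u \<and> (AE x in Omega. u T x = \<omega>obs x))"
      unfolding at_most_one_in_L2_def
    proof (intro ballI impI)
      fix p p' assume p: "p \<in> L2" "p' \<in> L2" and A: "\<exists>u. ?sol p u \<and> (AE x in Omega. u T x = \<omega>obs x)"
        "\<exists>u. ?sol p' u \<and> (AE x in Omega. u T x = \<omega>obs x)"
      from A(1) obtain u where u: "?sol p u" "AE x in Omega. u T x = \<omega>obs x" by blast
      from A(2) obtain v where v: "?sol p' v" "AE x in Omega. v T x = \<omega>obs x" by blast
      show "AE x in Omega. p x = p' x"
      proof (rule eq_AE_if_coefficients_eq[OF p])
        fix n :: nat assume n: "n \<ge> 1"
        have "AE x in Omega. u T x = v T x" using u(2) v(2) by eventually_elim simp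
        then have "ip (u T) (\<phi> n) = ip (v T) (\<phi> n)"
          unfolding ip_def using assms(1) n
          by (intro integral_cong_AE borel_measurable_times L2D(1) eigenfunction(3)
                solution_terminal_L2[OF u(1)] solution_terminal_L2[OF v(1)])
             (auto elim!: eventually_mono)
        then show "ip p (\<phi> n) = ip p' (\<phi> n)" using diff[OF p n u(1) v(1)] assms(9) n by simp
      qed
    qed
  qed
qed

end
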